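(* Let $\mathcal{U}\subset W^{1,\infty}_{u^*}(\Omega_T)$ be an admissible class. Assume that, for each $\epsilon>0$, $\mathcal{U}_\epsilon$ is dense in $\mathcal{U}$ under the $L^\infty$-norm. Then, given any $\varphi\in\mathcal{U}$, for each $\eta>0$ there exists a weak solution $u\in W^{1,\infty}_{u^*}(\Omega_T)$ of the Perona-Malik problem (P) satisfying $\|u-\varphi\|_{L^\infty(\Omega_T)}<\eta$. Furthermore, if $\mathcal{U}$ contains a function in $W^{1,\infty}_{u^*}(\Omega_T)$ that is not a weak solution of (P), then (P) admits infinitely many weak solutions.
   Context: Setting: $\Omega\subset\mathbb{R}^n$ is a smooth bounded convex domain with outer unit normal $\mathbf{n}$, $T>0$, $\Omega_T=\Omega\times(0,T)$, and $u_0$ is a smooth function on $\bar\Omega$ with $Du_0\not\equiv0$ in $\Omega$, $\partial u_0/\partial\mathbf{n}=0$ on $\partial\Omega$, and $\int_\Omega u_0\,dx=0$. $D$ and $\operatorname{div}$ are with respect to the spatial variable $x$; subscript $t$ is the time derivative. Let $\sigma(p)=\frac{p}{1+|p|^2}$ ($p\in\mathbb{R}^n$). Problem (P): $u_t=\operatorname{div}(\sigma(Du))$ in $\Omega_T$, $\partial u/\partial\mathbf{n}=0$ on $\partial\Omega\times(0,T)$, $u(x,0)=u_0(x)$ for $x\in\Omega$. A weak solution of (P) is a function $u\in W^{1,\infty}(\Omega_T)$ such that for all $\zeta\in C^\infty(\bar\Omega_T)$ and $s\in[0,T]$, $$\int_\Omega u(x,s)\zeta(x,s)\,dx+\int_0^s\int_\Omega(-u\zeta_t+\sigma(Du)\cdot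 D\zeta)\,dx\,dt=\int_\Omega u_0(x)\zeta(x,0)\,dx.$$ Fix $\Phi=(u^*,v^* )$ with $u^*\in W^{1,\infty}(\Omega_T)$, $v^*\in W^{1,\infty}(\Omega_T;\mathbb{R}^n)$ such that $u^*(x,0)=u_0(x)$ for $x\in\Omega$, $\operatorname{div}v^*=u^*$ a.e. in $\Omega_T$, and $v^*(\cdot,t)\cdot\mathbf{n}|_{\partial\Omega}=0$ for all $t\in[0,T]$. $W^{1,\infty}_{u^*}(\Omega_T)$ and $W^{1,\infty}_{v^*}(\Omega_T;\mathbb{R}^n)$ denote the Dirichlet classes of $W^{1,\infty}$ functions having the same trace on $\partial\Omega_T$ (the boundary of the space-time cylinder) as $u^*$, respectively $v^*$. An admissible class is a nonempty subset $\mathcal{U}$ of $W^{1,\infty}_{u^*}(\Omega_T)$, bounded in $W^{1,\infty}(\Omega_T)$, such that for each $u\in\mathcal{U}$ there exists $v\in W^{1,\infty}_{v^*}(\Omega_T;\mathbb{R}^n)$ with $\operatorname{div}v=u$ a.e. in $\Omega_T$ and $\|v_t\|_{L^\infty(\Omega_T)}\le 1/2$. For $\epsilon>0$, $\mathcal{U}_\epsilon$ is the set of $u\in\mathcal{U}$ for which there exists $v\in W^{1,\infty}_{v^*}(\Omega_T;\mathbb{R}^n)$ with $\operatorname{div}v=u$ a.e. in $\Omega_T$, $\|v_t\|_{L^\infty(\Omega_T)}\le1/2$ and $\int_{\Omega_T}|v_t-\sigma(Du)|\,dx\,dt\le\epsilon|\Omega_T|$. *)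

theory Defs
  imports "HOL-Analysis.Analysis" "HOL-Probability.Essential_Supremum"
begin

section \<open>Smooth functions\<close>

primrec Ck_on :: "nat \<Rightarrow> 'a::euclidean_space set \<Rightarrow> ('a \<Rightarrow> real) \<Rightarrow> bool" where
  "Ck_on 0 U f \<longleftrightarrow> continuous_on U f"
| "Ck_on (Suc k) U f \<longleftrightarrow>
     (\<forall>x\<in>U. f differentiable (at x)) \<and> (\<forall>b. Ck_on k U (\<lambda>x. frechet_derivative f (at x) b))"

text \<open>For an open set \<open>S\<close> this is the usual \<open>C\<^sup>\<infinity>(S)\<close>. For a closed set, such as the closure of a
  domain, it is smoothness in a neighbourhood of \<open>S\<close>, so that two-sided derivatives exist at
  boundary points as well.\<close>

definition smooth_on :: "'a::euclidean_space set \<Rightarrow> ('a \<Rightarrow> real) \<Rightarrow> bool" where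
  "smooth_on S f \<longleftrightarrow> (\<exists>U. open U \<and> S \<subseteq> U \<and> (\<forall>k. Ck_on k U f))"

definition test_function :: "'a::euclidean_space set \<Rightarrow> ('a \<Rightarrow> real) \<Rightarrow> bool" where
  "test_function S \<phi> \<longleftrightarrow> smooth_on UNIV \<phi> \<and>
     compact (closure {x. \<phi> x \<noteq> 0}) \<and> closure {x. \<phi> x \<noteq> 0} \<subseteq> S"

definition grad :: "(real^'n \<Rightarrow> real) \<Rightarrow> real^'n \<Rightarrow> real^'n" where
  "grad f x = (\<chi> i. frechet_derivative f (at x) (axis i 1))"


section \<open>Smooth bounded convex domains\<close>

definition defining_function ::
    "(real^'n) set \<Rightarrow> real^'n \<Rightarrow> (real^'n) set \<Rightarrow> (real^'n \<Rightarrow> real) \<Rightarrow> bool" where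
  "defining_function \<Omega> x U \<rho> \<longleftrightarrow> open U \<and> x \<in> U \<and> smooth_on U \<rho> \<and>
     (\<forall>y\<in>U. grad \<rho> y \<noteq> 0) \<and> \<Omega> \<inter> U = {y\<in>U. \<rho> y < 0}"

definition smooth_bounded_convex_domain :: "(real^'n) set \<Rightarrow> bool" where
  "smooth_bounded_convex_domain \<Omega> \<longleftrightarrow>
     open \<Omega> \<and> \<Omega> \<noteq> {} \<and> bounded \<Omega> \<and> convex \<Omega> \<and>
     (\<forall>x\<in>frontier \<Omega>. \<exists>U \<rho>. defining_function \<Omega> x U \<rho>)"

text \<open>At a boundary point the value does not depend on the choice of the defining function.\<close>

definition outer_normal :: "(real^'n) set \<Rightarrow> real^'n \<Rightarrow> real^'n" where
  "outer_normal \<Omega> x =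
     (SOME \<nu>. \<exists>U \<rho>. defining_function \<Omega> x U \<rho> \<and> \<nu> = grad \<rho> x /\<^sub>R norm (grad \<rho> x))"


section \<open>Weak derivatives and the space $W^{1,\infty}$\<close>

text \<open>The library's essential supremum is infinite for non-measurable functions.\<close>

definition Linf_norm :: "'a::euclidean_space set \<Rightarrow> ('a \<Rightarrow> 'b::euclidean_space) \<Rightarrow> ereal" where
  "Linf_norm S f = esssup (lebesgue_on S) (\<lambda>x. ereal (norm (f x)))"

definition Linf :: "'a::euclidean_space set \<Rightarrow> ('a \<Rightarrow> 'b::euclidean_space) set" where
  "Linf S = {f. f \<in> borel_measurable (lebesgue_on S) \<and> Linf_norm S f < \<infinity>}"

definition locally_integrable_on ::
    "('a::euclidean_space \<Rightarrow> 'b::euclidean_space) \<Rightarrow> 'a set \<Rightarrow> bool" where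
  "locally_integrable_on f S \<longleftrightarrow> (\<forall>K. compact K \<and> K \<subseteq> S \<longrightarrow> set_integrable lebesgue K f)"

definition has_weak_deriv ::
    "'a::euclidean_space set \<Rightarrow> 'a \<Rightarrow> ('a \<Rightarrow> 'b::euclidean_space) \<Rightarrow> ('a \<Rightarrow> 'b) \<Rightarrow> bool" where
  "has_weak_deriv S b f g \<longleftrightarrow> locally_integrable_on f S \<and> locally_integrable_on g S \<and>
     (\<forall>\<phi>. test_function S \<phi> \<longrightarrow>
        (LINT x:S|lebesgue. frechet_derivative \<phi> (at x) b *\<^sub>R f x)
          = - (LINT x:S|lebesgue. \<phi> x *\<^sub>R g x))"

text \<open>The weak derivative in direction \<open>b\<close>, determined up to a null subset of \<open>S\<close>.\<close>

definition weak_deriv ::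
    "'a::euclidean_space set \<Rightarrow> 'a \<Rightarrow> ('a \<Rightarrow> 'b::euclidean_space) \<Rightarrow> 'a \<Rightarrow> 'b" where
  "weak_deriv S b f = (SOME g. has_weak_deriv S b f g)"

definition sobolev_W1inf :: "'a::euclidean_space set \<Rightarrow> ('a \<Rightarrow> 'b::euclidean_space) set" where
  "sobolev_W1inf S = {f \<in> Linf S. \<forall>b\<in>Basis. \<exists>g\<in>Linf S. has_weak_deriv S b f g}"

definition W1inf_norm :: "'a::euclidean_space set \<Rightarrow> ('a \<Rightarrow> 'b::euclidean_space) \<Rightarrow> ereal" where
  "W1inf_norm S f = Linf_norm S f + (\<Sum>b\<in>Basis. Linf_norm S (weak_deriv S b f))"

text \<open>On a bounded convex open set \<open>S\<close> every class in \<open>sobolev_W1inf S\<close> has a representative that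
  is continuous on the closure of \<open>S\<close>, and its values on the closure are unique. Elements of
  $W^{1,\infty}(S)$ are given by this representative (its values outside the closure are
  irrelevant). The trace is then the restriction to the boundary, and the time slices
  \<open>u(\<cdot>,s)\<close> of a function on a space-time cylinder have a pointwise meaning for every \<open>s\<close>.\<close>

definition W1inf :: "'a::euclidean_space set \<Rightarrow> ('a \<Rightarrow> 'b::euclidean_space) set" where
  "W1inf S = {f \<in> sobolev_W1inf S. continuous_on (closure S) f}"

definition W1inf_dirichlet ::
    "'a::euclidean_space set \<Rightarrow> ('a \<Rightarrow> 'b::euclidean_space) \<Rightarrow> ('a \<Rightarrow> 'b) set" where
  "W1inf_dirichlet S g = {f \<in> W1inf S. \<forall>z\<in>frontier S. f z = g z}"

definition ae_equal :: "'a::euclidean_space set \<Rightarrow> (('a \<Rightarrow> 'b) \<times> ('a \<Rightarrow> 'b)) set" where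
  "ae_equal S = {(f, g). AE z in lebesgue_on S. f z = g z}"


section \<open>Space-time cylinders\<close>

definition cylinder :: "(real^'n) set \<Rightarrow> real \<Rightarrow> ((real^'n) \<times> real) set" where
  "cylinder \<Omega> T = \<Omega> \<times> {0<..<T}"

definition Dx :: "((real^'n) \<times> real) set \<Rightarrow> ((real^'n) \<times> real \<Rightarrow> real) \<Rightarrow> (real^'n) \<times> real \<Rightarrow> real^'n"
  where "Dx S u z = (\<chi> i. weak_deriv S (axis i 1, 0) u z)"

definition divx ::
    "((real^'n) \<times> real) set \<Rightarrow> ((real^'n) \<times> real \<Rightarrow> real^'n) \<Rightarrow> (real^'n) \<times> real \<Rightarrow> real" where
  "divx S v z = (\<Sum>i\<in>UNIV. weak_deriv S (axis i 1, 0) v z $ i)"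

definition Dt ::
    "((real^'n) \<times> real) set \<Rightarrow> ((real^'n) \<times> real \<Rightarrow> 'b::euclidean_space) \<Rightarrow> (real^'n) \<times> real \<Rightarrow> 'b"
  where "Dt S v = weak_deriv S (0, 1) v"

text \<open>Classical counterparts, used for the smooth test functions.\<close>

definition classical_Dx :: "((real^'n) \<times> real \<Rightarrow> real) \<Rightarrow> (real^'n) \<times> real \<Rightarrow> real^'n" where
  "classical_Dx \<zeta> z = (\<chi> i. frechet_derivative \<zeta> (at z) (axis i 1, 0))"

definition classical_Dt :: "((real^'n) \<times> real \<Rightarrow> real) \<Rightarrow> (real^'n) \<times> real \<Rightarrow> real" where
  "classical_Dt \<zeta> z = frechet_derivative \<zeta> (at z) (0, 1)"


section \<open>The Perona-Malik problem\<close>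

definition sigma :: "real^'n \<Rightarrow> real^'n" where
  "sigma p = p /\<^sub>R (1 + (norm p)\<^sup>2)"

definition weak_solution ::
    "(real^'n) set \<Rightarrow> real \<Rightarrow> (real^'n \<Rightarrow> real) \<Rightarrow> ((real^'n) \<times> real \<Rightarrow> real) \<Rightarrow> bool" where
  "weak_solution \<Omega> T u0 u \<longleftrightarrow> u \<in> W1inf (cylinder \<Omega> T) \<and>
     (\<forall>\<zeta> s. smooth_on (closure (cylinder \<Omega> T)) \<zeta> \<and> s \<in> {0..T} \<longrightarrow>
        (LINT x:\<Omega>|lebesgue. u (x, s) * \<zeta> (x, s))
        + (LINT z:cylinder \<Omega> s|lebesgue.
             - u z * classical_Dt \<zeta> z + sigma (Dx (cylinder \<Omega> T) u z) \<bullet> classical_Dx \<zeta> z)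
        = (LINT x:\<Omega>|lebesgue. u0 x * \<zeta> (x, 0)))"

text \<open>The functions \<open>v\<close> that may accompany \<open>u\<close> in the definition of an admissible class.\<close>

definition admissible_flux ::
    "(real^'n) set \<Rightarrow> real \<Rightarrow> ((real^'n) \<times> real \<Rightarrow> real^'n) \<Rightarrow> ((real^'n) \<times> real \<Rightarrow> real)
      \<Rightarrow> ((real^'n) \<times> real \<Rightarrow> real^'n) \<Rightarrow> bool" where
  "admissible_flux \<Omega> T vs u v \<longleftrightarrow> v \<in> W1inf_dirichlet (cylinder \<Omega> T) vs \<and>
     (AE z in lebesgue_on (cylinder \<Omega> T). divx (cylinder \<Omega> T) v z = u z) \<and>
     Linf_norm (cylinder \<Omega> T) (Dt (cylinder \<Omega> T) v) \<le> ereal (1/2)"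

definition admissible_class ::
    "(real^'n) set \<Rightarrow> real \<Rightarrow> ((real^'n) \<times> real \<Rightarrow> real) \<Rightarrow> ((real^'n) \<times> real \<Rightarrow> real^'n)
      \<Rightarrow> ((real^'n) \<times> real \<Rightarrow> real) set \<Rightarrow> bool" where
  "admissible_class \<Omega> T us vs \<U> \<longleftrightarrow>
     \<U> \<noteq> {} \<and> \<U> \<subseteq> W1inf_dirichlet (cylinder \<Omega> T) us \<and>
     (\<exists>M::real. \<forall>u\<in>\<U>. W1inf_norm (cylinder \<Omega> T) u \<le> ereal M) \<and>
     (\<forall>u\<in>\<U>. \<exists>v. admissible_flux \<Omega> T vs u v)"

definition approx_class ::
    "(real^'n) set \<Rightarrow> real \<Rightarrow> ((real^'n) \<times> real \<Rightarrow> real^'n) \<Rightarrow> ((real^'n) \<times> real \<Rightarrow> real) set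
      \<Rightarrow> real \<Rightarrow> ((real^'n) \<times> real \<Rightarrow> real) set" where
  "approx_class \<Omega> T vs \<U> \<epsilon> = {u \<in> \<U>. \<exists>v. admissible_flux \<Omega> T vs u v \<and>
     (LINT z:cylinder \<Omega> T|lebesgue.
        norm (Dt (cylinder \<Omega> T) v z - sigma (Dx (cylinder \<Omega> T) u z)))
       \<le> \<epsilon> * measure lebesgue (cylinder \<Omega> T)}"

definition Linf_dense_in ::
    "'a::euclidean_space set \<Rightarrow> ('a \<Rightarrow> real) set \<Rightarrow> ('a \<Rightarrow> real) set \<Rightarrow> bool" where
  "Linf_dense_in S A B \<longleftrightarrow> A \<subseteq> B \<and>
     (\<forall>u\<in>B. \<forall>\<delta>>0. \<exists>w\<in>A. Linf_norm S (\<lambda>z. w z - u z) < ereal \<delta>)"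

end

theory Submission
  imports Defs
begin

text \<open>
  A potential \<open>v\<close> of \<open>u\<close>, that is, \<open>div v = u\<close> with \<open>v\<close> tangential to \<open>\<partial>\<Omega>\<close>, turns \<open>u\<^sub>t = div v\<^sub>t\<close> with
  zero boundary flux into an identity (\<open>flux_identity\<close>). For \<open>u \<in> \<U>\<^sub>\<epsilon>\<close> the field \<open>v\<^sub>t\<close> is \<open>\<epsilon>\<close>-close to \<open>\<sigma>(Du)\<close> in
  the mean, so \<open>u\<close> solves the problem up to an error of order \<open>\<epsilon>\<close>. If \<open>u k \<in> \<U>\<^sub>\<epsilon>\<close> with \<open>\<epsilon>\<close> tending to \<open>0\<close>
  converges uniformly and the gradients converge almost everywhere, the limit is a weak solution
  (\<open>weak_solution_of_limit\<close>). The task is to find such a sequence near a given \<open>\<phi> \<in> \<U>\<close>.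

  The usual argument is that the gradient is a map of Baire class one on the uniform closure of \<open>\<U>\<close>
  and therefore has a dense set of points of continuity. Here the sequence is constructed
  directly. By weak continuity of \<open>D\<close> on bounded sets, the energy \<open>F(u) = \<integral> |Du|\<^sup>2\<close> satisfies
  \<open>\<integral> |Dw - Du|\<^sup>2 \<le> F(w) - F(u) + \<delta>\<close> for \<open>w\<close> uniformly close to \<open>u\<close> (\<open>energy_gap\<close>). Choosing each \<open>u k\<close> as an almost
  maximizer of \<open>F\<close> on \<open>\<U>\<^sub>\<epsilon>\<close> within the current ball, and then shrinking the ball, makes the gradients a
  rapidly convergent Cauchy sequence in \<open>L\<^sup>2\<close> (\<open>nested_almost_maximizers\<close>); the density assumption keeps the
  admissible choices nonempty. The limit is in the Sobolev space by \<open>W1inf_limit\<close>.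

  The identity is proved by testing the weak derivatives of \<open>v\<close>. Since second derivatives of a test
  function \<open>\<Psi>\<close> commute, \<open>\<integral> v\<^sub>t \<bullet> D\<Psi> = \<integral> u \<Psi>\<^sub>t\<close>. To reach test functions that do not vanish on the boundary, cutoffs
  in time and in space are inserted and removed in the limit. No boundary integrals occur: the space cutoffs
  are functions of a softmax of finitely many supporting half spaces (\<open>convex_cutoff\<close>). Their gradients
  have size \<open>1/\<delta>\<close> on a layer of measure \<open>O(\<delta>)\<close>, and by convexity they point almost in a direction of the
  normal cone, which by smoothness of the boundary is spanned by the outer normal. Hence \<open>v \<bullet> D\<omega>\<close> tends to
  \<open>0\<close> in the mean (\<open>cutoffs_with_vanishing_flux\<close>).

  If \<open>w \<in> \<U>\<close> is not a weak solution, it has a positive distance to every weak solution, while weak solutions come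
  arbitrarily close to \<open>w\<close>; so there are infinitely many of them.
\<close>

section \<open>Calculus of infinitely differentiable functions\<close>

text \<open>\<open>Cinf_on U f\<close> is meant for open \<open>U\<close>: all iterated directional derivatives of \<open>f\<close> exist and are
  continuous on \<open>U\<close>.\<close>

abbreviation Cinf_on :: "'a::euclidean_space set \<Rightarrow> ('a \<Rightarrow> real) \<Rightarrow> bool" where
  "Cinf_on U f \<equiv> \<forall>k. Ck_on k U f"

lemma Ck_on_subset: "Ck_on k U f \<Longrightarrow> V \<subseteq> U \<Longrightarrow> Ck_on k V f"
  by (induction k arbitrary: f) (auto intro: continuous_on_subset)

lemma Ck_on_cong:
  assumes "open U" "\<And>x. x \<in> U \<Longrightarrow> f x = g x" "Ck_on k U f"
  shows "Ck_on k U g"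
  using assms(2,3)
proof (induction k arbitrary: f g)
  case 0
  then show ?case by (simp cong: continuous_on_cong)
next
  case (Suc k)
  have fd: "f differentiable at x" if "x \<in> U" for x using Suc.prems that by auto
  have gd: "g differentiable at x" if "x \<in> U" for x
    using fd[OF that] has_derivative_transform_within_open[OF _ \<open>open U\<close> that] Suc.prems(1)
    unfolding differentiable_def by metis
  have "frechet_derivative f (at x) = frechet_derivative g (at x)" if "x \<in> U" for x
    using frechet_derivative_transform_within_open[OF fd[OF that] \<open>open U\<close> that] Suc.prems(1) by blast
  then have "Ck_on k U (\<lambda>x. frechet_derivative g (at x) b)" for b
    using Suc.IH[of "\<lambda>x. frechet_derivative f (at x) b" "\<lambda>x. frechet_derivative g (at x) b"] Suc.prems
    by auto
  then show ?case using gd by simp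
qed

lemma Ck_on_local:
  assumes "\<And>x. x \<in> U \<Longrightarrow> \<exists>V. open V \<and> x \<in> V \<and> Ck_on k V f"
  shows "Ck_on k U f"
  using assms
proof (induction k arbitrary: f)
  case 0
  then have "continuous (at x) f" if "x \<in> U" for x
    using that by (metis Ck_on.simps(1) continuous_on_eq_continuous_at)
  then show ?case by (simp add: continuous_at_imp_continuous_on)
next
  case (Suc k)
  have "\<exists>V. open V \<and> x \<in> V \<and> Ck_on k V (\<lambda>x. frechet_derivative f (at x) b)" if "x \<in> U" for x b
    using Suc.prems[OF that] by auto
  then show ?case using Suc.IH Suc.prems by fastforce
qed

lemma Ck_on_Suc_imp: "Ck_on (Suc k) U f \<Longrightarrow> Ck_on k U f"
proof (induction k arbitrary: f)
  case 0
  then have "f differentiable_on U"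
    by (auto simp: differentiable_on_def intro: differentiable_at_withinI)
  then show ?case by (simp add: differentiable_imp_continuous_on)
next
  case (Suc k)
  have "\<forall>b. Ck_on (Suc k) U (\<lambda>x. frechet_derivative f (at x) b)" "\<forall>x\<in>U. f differentiable at x"
    using Suc.prems by auto
  then show ?case using Suc.IH by simp
qed

lemma Ck_on_const: "Ck_on k U (\<lambda>x. c)"
  by (induction k arbitrary: c) auto

lemma Ck_on_linear:
  assumes "bounded_linear L"
  shows "Ck_on k U L"
proof (cases k)
  case 0
  then show ?thesis using assms by (simp add: linear_continuous_on)
next
  case (Suc j)
  have "(L has_derivative L) (at x)" for x using assms by (rule bounded_linear_imp_has_derivative)
  then have "L differentiable at x" "frechet_derivative L (at x) = L" for x
    by (auto simp: differentiable_def frechet_derivative_at[symmetric])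
  then show ?thesis using Suc by (simp add: Ck_on_const)
qed

lemma Ck_on_SucI:
  assumes "open U" "\<And>x. x \<in> U \<Longrightarrow> (f has_derivative D x) (at x)" "\<And>b. Ck_on k U (\<lambda>x. D x b)"
  shows "Ck_on (Suc k) U f"
proof -
  have "Ck_on k U (\<lambda>x. frechet_derivative f (at x) b)" for b
    using assms(3)[of b]
    by (rule Ck_on_cong[OF \<open>open U\<close>, rotated]) (simp add: frechet_derivative_at[OF assms(2), symmetric])
  then show ?thesis using assms(2) by (auto simp: differentiable_def)
qed

lemma Ck_on_add:
  assumes "open U" "Ck_on k U f" "Ck_on k U g"
  shows "Ck_on k U (\<lambda>x. f x + g x)"
  using assms(2,3)
proof (induction k arbitrary: f g)
  case 0
  then show ?case by (auto intro: continuous_intros)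
next
  case (Suc k)
  have D: "((\<lambda>x. f x + g x) has_derivative
      (\<lambda>b. frechet_derivative f (at x) b + frechet_derivative g (at x) b)) (at x)" if "x \<in> U" for x
    using Suc.prems that by (auto intro!: has_derivative_add simp: frechet_derivative_works[symmetric])
  have "Ck_on k U (\<lambda>x. frechet_derivative f (at x) b + frechet_derivative g (at x) b)" for b
    using Suc by auto
  with D show ?case by (rule Ck_on_SucI[OF \<open>open U\<close>])
qed

lemma Ck_on_mult:
  assumes "open U" "Ck_on k U f" "Ck_on k U g"
  shows "Ck_on k U (\<lambda>x. f x * g x)"
  using assms(2,3)
proof (induction k arbitrary: f g)
  case 0
  then show ?case by (auto intro: continuous_intros)
next
  case (Suc k)
  have D: "((\<lambda>x. f x * g x) has_derivative
      (\<lambda>b. f x * frechet_derivative g (at x) b + frechet_derivative f (at x) b * g x)) (at x)" if "x \<in> U" for x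
    using Suc.prems that by (auto intro!: has_derivative_mult simp: frechet_derivative_works[symmetric])
  have "Ck_on k U (\<lambda>x. f x * frechet_derivative g (at x) b + frechet_derivative f (at x) b * g x)" for b
    using Suc.prems Ck_on_Suc_imp[OF Suc.prems(1)] Ck_on_Suc_imp[OF Suc.prems(2)]
    by (auto intro!: Ck_on_add[OF \<open>open U\<close>] Suc.IH)
  with D show ?case by (rule Ck_on_SucI[OF \<open>open U\<close>])
qed

lemma Ck_on_sum:
  assumes "open U" "\<And>i. i \<in> I \<Longrightarrow> Ck_on k U (f i)"
  shows "Ck_on k U (\<lambda>x. \<Sum>i\<in>I. f i x)"
proof (cases "finite I")
  case True
  then show ?thesis using assms(2)
    by (induction I rule: finite_induct) (auto intro: Ck_on_const Ck_on_add[OF \<open>open U\<close>])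
qed (simp add: Ck_on_const)

lemma Ck_on_compose:
  fixes h :: "real \<Rightarrow> real" and f :: "'a::euclidean_space \<Rightarrow> real"
  assumes "open U" "Ck_on k V h" "Ck_on k U f" "\<And>x. x \<in> U \<Longrightarrow> f x \<in> V"
  shows "Ck_on k U (\<lambda>x. h (f x))"
  using assms(2,3)
proof (induction k arbitrary: h)
  case 0
  then show ?case using continuous_on_compose2[of V h U f] assms(4) by auto
next
  case (Suc k)
  have D: "((\<lambda>x. h (f x)) has_derivative
      (\<lambda>b. frechet_derivative f (at x) b * frechet_derivative h (at (f x)) 1)) (at x)" if "x \<in> U" for x
  proof -
    have "h differentiable at (f x)" "f differentiable at x" using Suc.prems that assms(4) by auto
    then have hd: "(h has_derivative frechet_derivative h (at (f x))) (at (f x))"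
      and fd: "(f has_derivative frechet_derivative f (at x)) (at x)"
      by (auto simp: frechet_derivative_works[symmetric])
    have eq: "c * frechet_derivative h (at (f x)) 1 = frechet_derivative h (at (f x)) c" for c
      using linear_scale[OF has_derivative_linear[OF hd], of c 1] by simp
    show ?thesis unfolding eq by (rule has_derivative_compose[OF fd hd])
  qed
  have "Ck_on k U (\<lambda>x. frechet_derivative f (at x) b * frechet_derivative h (at (f x)) 1)" for b
    using Suc.prems Ck_on_Suc_imp[OF Suc.prems(2)]
    by (auto intro!: Ck_on_mult[OF \<open>open U\<close>] Suc.IH)
  with D show ?case by (rule Ck_on_SucI[OF \<open>open U\<close>])
qed

lemma Ck_on_compose_linear:
  fixes L :: "'a::euclidean_space \<Rightarrow> 'b::euclidean_space"
  assumes "open U" "bounded_linear L" "Ck_on k V f" "\<And>x. x \<in> U \<Longrightarrow> L x \<in> V"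
  shows "Ck_on k U (\<lambda>x. f (L x))"
  using assms(3)
proof (induction k arbitrary: f)
  case 0
  then show ?case
    using continuous_on_compose2[of V f U L] assms(2,4) by (auto simp: linear_continuous_on)
next
  case (Suc k)
  have D: "((\<lambda>x. f (L x)) has_derivative (\<lambda>b. frechet_derivative f (at (L x)) (L b))) (at x)"
    if "x \<in> U" for x
  proof -
    have "(f has_derivative frechet_derivative f (at (L x))) (at (L x))"
      using Suc.prems assms(4) that by (auto simp: frechet_derivative_works[symmetric])
    then show ?thesis
      by (rule has_derivative_compose[OF bounded_linear_imp_has_derivative[OF assms(2)]])
  qed
  have "Ck_on k U (\<lambda>x. frechet_derivative f (at (L x)) (L b))" for b
    using Suc.prems by (auto intro!: Suc.IH[of "\<lambda>x. frechet_derivative f (at x) (L b)"])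
  with D show ?case by (rule Ck_on_SucI[OF \<open>open U\<close>])
qed

lemma Cinf_on_deriv: "Cinf_on U f \<Longrightarrow> Cinf_on U (\<lambda>x. frechet_derivative f (at x) b)"
  by (metis Ck_on.simps(2))

lemma Cinf_on_differentiable: "Cinf_on U f \<Longrightarrow> x \<in> U \<Longrightarrow> f differentiable at x"
  by (metis Ck_on.simps(2))

lemma Cinf_on_continuous: "Cinf_on U f \<Longrightarrow> continuous_on U f"
  by (metis Ck_on.simps(1))

lemma Ck_on_real_deriv:
  fixes f f' :: "real \<Rightarrow> real"
  assumes "open U" "\<And>x. x \<in> U \<Longrightarrow> (f has_real_derivative f' x) (at x)" "Ck_on k U f'"
  shows "Ck_on (Suc k) U f"
proof -
  have D: "(f has_derivative (\<lambda>b. f' x * b)) (at x)" if "x \<in> U" for x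
    using assms(2)[OF that] by (simp add: has_field_derivative_def)
  have "Ck_on k U (\<lambda>x. f' x * b)" for b
    using assms(3) by (auto intro!: Ck_on_mult[OF \<open>open U\<close>] Ck_on_const)
  with D show ?thesis by (rule Ck_on_SucI[OF \<open>open U\<close>])
qed

lemma Cinf_on_exp: "Cinf_on UNIV (exp :: real \<Rightarrow> real)"
proof
  show "Ck_on k UNIV (exp :: real \<Rightarrow> real)" for k
    by (induction k) (auto intro!: Ck_on_real_deriv[where f'=exp] continuous_intros simp del: Ck_on.simps(2))
qed

lemma Cinf_on_inverse: "Cinf_on {0<..} (inverse :: real \<Rightarrow> real)"
proof
  show "Ck_on k {0<..} (inverse :: real \<Rightarrow> real)" for k
  proof (induction k)
    case (Suc k)
    have "Ck_on k {0<..} (\<lambda>x::real. - 1 * (inverse x * inverse x))"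
      by (intro Ck_on_mult Ck_on_const Suc open_greaterThan)
    then show ?case
      by (rule Ck_on_real_deriv[rotated 2]) (auto intro!: derivative_eq_intros simp: field_simps)
  qed (auto intro!: continuous_intros)
qed

lemma Cinf_on_ln: "Cinf_on {0<..} (ln :: real \<Rightarrow> real)"
proof
  show "Ck_on k {0<..} (ln :: real \<Rightarrow> real)" for k
  proof (cases k)
    case (Suc j)
    have "Ck_on j {0<..} (inverse :: real \<Rightarrow> real)" using Cinf_on_inverse by blast
    then show ?thesis unfolding Suc
      by (rule Ck_on_real_deriv[rotated 2]) (auto intro!: derivative_eq_intros simp: field_simps)
  qed (auto intro!: continuous_intros)
qed

lemma Cinf_on_real_polynomial_function:
  assumes "real_polynomial_function p"
  shows "Cinf_on UNIV p"
  using assms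
proof (induction)
  case (linear f)
  then show ?case using Ck_on_linear by blast
qed (simp_all add: Ck_on_const Ck_on_add Ck_on_mult)

lemma smooth_on_UNIV_iff: "smooth_on UNIV f \<longleftrightarrow> Cinf_on UNIV f"
  unfolding smooth_on_def by (metis open_UNIV subset_UNIV top.extremum_unique)

lemma test_function_iff:
  "test_function S \<phi> \<longleftrightarrow> Cinf_on UNIV \<phi> \<and> compact (closure {x. \<phi> x \<noteq> 0}) \<and> closure {x. \<phi> x \<noteq> 0} \<subseteq> S"
  by (simp add: test_function_def smooth_on_UNIV_iff)

section \<open>A smooth step function\<close>

text \<open>The functions \<open>p(1/t) exp(-1/t)\<close>, extended by \<open>0\<close> to \<open>t \<le> 0\<close>. The polynomial factor makes the class
  closed under differentiation, so that smoothness at \<open>0\<close> is a matter of first derivatives only.\<close>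

definition flat_exp :: "real poly \<Rightarrow> real \<Rightarrow> real" where
  "flat_exp p t = (if t > 0 then poly p (1/t) * exp (-1/t) else 0)"

lemma poly_times_exp_minus_tendsto: "((\<lambda>x::real. poly p x * exp (-x)) \<longlongrightarrow> 0) at_top"
proof -
  have "((\<lambda>x::real. \<Sum>i\<le>degree p. coeff p i * (x ^ i / exp x)) \<longlongrightarrow> (\<Sum>i\<le>degree p. coeff p i * 0)) at_top"
    by (intro tendsto_sum tendsto_mult tendsto_const tendsto_power_div_exp_0)
  moreover have "(\<Sum>i\<le>degree p. coeff p i * (x ^ i / exp x)) = poly p x * exp (-x)" for x :: real
    by (simp add: poly_altdef sum_distrib_right exp_minus divide_inverse mult.assoc)
  ultimately show ?thesis by simp
qed

lemma flat_exp_deriv: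
  "(flat_exp p has_real_derivative flat_exp ((p - pderiv p) * [:0,0,1:]) t) (at t)"
proof (cases "t = 0")
  case False
  show ?thesis
  proof (cases "t > 0")
    case True
    have "((\<lambda>t. poly p (1/t) * exp (-1/t)) has_real_derivative
        flat_exp ((p - pderiv p) * [:0,0,1:]) t) (at t)"
      using True by (auto intro!: derivative_eq_intros simp: flat_exp_def field_simps power2_eq_square)
    then show ?thesis
      by (rule DERIV_cong_ev[OF refl _ refl, THEN iffD1, rotated])
        (use True in \<open>auto simp: flat_exp_def intro!: eventually_mono[OF eventually_nhds_in_open[of "{0<..}" t]]\<close>)
  next
    case neg: False
    have "((\<lambda>t. 0) has_real_derivative flat_exp ((p - pderiv p) * [:0,0,1:]) t) (at t)"
      using neg by (auto simp: flat_exp_def)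
    then show ?thesis
      by (rule DERIV_cong_ev[OF refl _ refl, THEN iffD1, rotated])
        (use neg False in \<open>auto simp: flat_exp_def intro!: eventually_mono[OF eventually_nhds_in_open[of "{..<0}" t]]\<close>)
  qed
next
  case True
  have "((\<lambda>h. flat_exp p h / h) \<longlongrightarrow> 0) (at_right 0)"
  proof -
    have "((\<lambda>h. poly ([:0,1:] * p) (inverse h) * exp (- inverse h)) \<longlongrightarrow> 0) (at_right (0::real))"
      by (rule filterlim_compose[OF poly_times_exp_minus_tendsto filterlim_inverse_at_top_right])
    then show ?thesis
      by (rule Lim_transform_eventually)
        (auto simp: flat_exp_def divide_inverse mult_ac intro!: eventually_at_right_less[THEN eventually_mono])
  qed
  moreover have "((\<lambda>h. flat_exp p h / h) \<longlongrightarrow> 0) (at_left 0)"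
    by (rule Lim_transform_eventually[OF tendsto_const])
      (auto simp: flat_exp_def eventually_at_filter)
  ultimately have "((\<lambda>h. flat_exp p h / h) \<longlongrightarrow> 0) (at 0)"
    by (simp add: filterlim_at_split)
  moreover have "flat_exp q 0 = 0" for q by (simp add: flat_exp_def)
  ultimately show ?thesis unfolding True by (simp add: DERIV_def)
qed

lemma Cinf_on_flat_exp: "Cinf_on UNIV (flat_exp p)"
proof
  show "Ck_on k UNIV (flat_exp p)" for k
  proof (induction k arbitrary: p)
    case 0
    show ?case
      using flat_exp_deriv by (auto intro!: continuous_at_imp_continuous_on DERIV_isCont)
  next
    case (Suc k)
    show ?case by (rule Ck_on_real_deriv[OF open_UNIV flat_exp_deriv Suc])
  qed
qed

text \<open>With \<open>e(t) = exp(-1/t)\<close> for \<open>t > 0\<close> and \<open>e(t) = 0\<close> otherwise, the step is \<open>e(t) / (e(t) + e(1 - t))\<close>.\<close>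

lemma smooth_step_exists:
  "\<exists>h::real \<Rightarrow> real. Cinf_on UNIV h \<and> mono h \<and> (\<forall>t\<le>0. h t = 0) \<and> (\<forall>t\<ge>1. h t = 1) \<and>
     (\<forall>t. 0 \<le> h t \<and> h t \<le> 1)"
proof -
  define e where "e = flat_exp 1"
  have e0: "e t = 0" if "t \<le> 0" for t using that by (simp add: e_def flat_exp_def)
  have epos: "e t > 0" if "t > 0" for t using that by (simp add: e_def flat_exp_def)
  have enn: "e t \<ge> 0" for t using e0 epos by (metis less_eq_real_def linorder_not_le)
  have emono: "e s \<le> e t" if "s \<le> t" for s t
  proof (cases "s \<le> 0")
    case True then show ?thesis using e0 enn by simp
  next
    case False then show ?thesis using that by (simp add: e_def flat_exp_def field_simps)
  qed
  define d where "d t = e t + e (1 - t)" for t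
  have dpos: "d t > 0" for t
    using epos[of t] epos[of "1-t"] enn[of t] enn[of "1-t"] unfolding d_def by (cases "t > 0") auto
  define h where "h t = e t * inverse (d t)" for t
  have e: "Cinf_on UNIV e" unfolding e_def by (rule Cinf_on_flat_exp)
  have l: "Ck_on k UNIV (\<lambda>t::real. 1 + - 1 * t)" for k
    by (intro Ck_on_add Ck_on_const Ck_on_mult open_UNIV Ck_on_linear bounded_linear_ident)
  have "Ck_on k UNIV (\<lambda>t. e (1 + - 1 * t))" for k
    by (rule Ck_on_compose[OF open_UNIV _ l]) (use e in auto)
  then have d: "Ck_on k UNIV d" for k
    unfolding d_def using e by (auto intro!: Ck_on_add)
  have "Ck_on k UNIV (\<lambda>t. inverse (d t))" for k
    by (rule Ck_on_compose[OF open_UNIV _ d, where V="{0<..}"]) (use Cinf_on_inverse dpos in auto)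
  then have "Cinf_on UNIV h"
    unfolding h_def using e by (auto intro!: Ck_on_mult)
  moreover have "mono h"
  proof (rule monoI)
    fix s t :: real assume "s \<le> t"
    have "e s * e (1 - t) \<le> e t * e (1 - s)"
      using \<open>s \<le> t\<close> by (intro mult_mono emono enn) auto
    then have "e s * d t \<le> e t * d s" by (simp add: d_def algebra_simps)
    then show "h s \<le> h t"
      unfolding h_def using dpos[of s] dpos[of t] by (simp add: field_simps)
  qed
  moreover have "\<forall>t\<le>0. h t = 0" by (simp add: h_def e0)
  moreover have h1: "h t = 1" if "t \<ge> 1" for t
  proof -
    have "d t = e t" using e0[of "1-t"] that by (simp add: d_def)
    then show ?thesis using dpos[of t] by (simp add: h_def)
  qed
  moreover have "0 \<le> h t" "h t \<le> 1" for t
    using dpos[of t] enn[of t] enn[of "1-t"] by (auto simp: h_def field_simps d_def)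
  ultimately show ?thesis by (intro exI[of _ h] conjI allI impI) simp_all
qed

section \<open>Symmetry of second derivatives\<close>

lemma has_real_derivative_along_line:
  fixes f :: "'a::euclidean_space \<Rightarrow> real"
  assumes "f differentiable (at (c + s *\<^sub>R a))"
  shows "((\<lambda>s. f (c + s *\<^sub>R a)) has_real_derivative frechet_derivative f (at (c + s *\<^sub>R a)) a) (at s)"
proof -
  have 1: "((\<lambda>s. c + s *\<^sub>R a) has_derivative (\<lambda>t. t *\<^sub>R a)) (at s)"
    by (auto intro!: derivative_eq_intros)
  have 2: "(f has_derivative frechet_derivative f (at (c + s *\<^sub>R a))) (at (c + s *\<^sub>R a))"
    using assms frechet_derivative_works by blast
  have "frechet_derivative f (at (c + s *\<^sub>R a)) (t *\<^sub>R a) =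
      frechet_derivative f (at (c + s *\<^sub>R a)) a * t" for t
    using linear_scale[OF linear_frechet_derivative[OF assms], of t a] by (simp add: mult.commute)
  then show ?thesis
    using has_derivative_compose[OF 1 2] by (simp add: has_field_derivative_def)
qed

text \<open>The second difference quotient of \<open>f\<close> in the directions \<open>a\<close>, \<open>b\<close> is symmetric, and by the mean
  value theorem, applied twice, it equals the mixed derivative at an intermediate point.\<close>

lemma second_difference_mean_value:
  fixes f :: "'a::euclidean_space \<Rightarrow> real"
  assumes f: "Cinf_on (ball x r) f" and h: "h > 0" "h * (norm a + norm b) < r"
  shows "\<exists>y. norm (y - x) \<le> h * (norm a + norm b) \<and>
     f (x + h *\<^sub>R a + h *\<^sub>R b) - f (x + h *\<^sub>R a) - f (x + h *\<^sub>R b) + f x =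
       h * h * frechet_derivative (\<lambda>y. frechet_derivative f (at y) a) (at y) b"
proof -
  let ?D = "\<lambda>y. frechet_derivative f (at y) a"
  have inb: "norm (s *\<^sub>R a + t *\<^sub>R b) \<le> h * (norm a + norm b)" if "0 \<le> s" "s \<le> h" "0 \<le> t" "t \<le> h" for s t
  proof -
    have "norm (s *\<^sub>R a + t *\<^sub>R b) \<le> s * norm a + t * norm b"
      using norm_triangle_ineq[of "s *\<^sub>R a" "t *\<^sub>R b"] that by simp
    also have "\<dots> \<le> h * norm a + h * norm b" using that by (intro add_mono mult_right_mono) auto
    finally show ?thesis by (simp add: algebra_simps)
  qed
  have inb': "x + s *\<^sub>R a + t *\<^sub>R b \<in> ball x r" if "0 \<le> s" "s \<le> h" "0 \<le> t" "t \<le> h" for s t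
  proof -
    have "x - (x + s *\<^sub>R a + t *\<^sub>R b) = - (s *\<^sub>R a + t *\<^sub>R b)" by simp
    then show ?thesis using inb[OF that] h(2) by (simp only: mem_ball dist_norm norm_minus_cancel)
  qed
  define g where "g s = f (x + h *\<^sub>R b + s *\<^sub>R a) - f (x + s *\<^sub>R a)" for s
  have "(g has_real_derivative (?D (x + h *\<^sub>R b + s *\<^sub>R a) - ?D (x + s *\<^sub>R a))) (at s)"
    if "0 \<le> s" "s \<le> h" for s
  proof -
    have "x + h *\<^sub>R b + s *\<^sub>R a \<in> ball x r" "x + s *\<^sub>R a \<in> ball x r"
      using inb'[OF that, of h] inb'[OF that, of 0] h by (auto simp: add_ac)
    then show ?thesis
      unfolding g_def
      by (intro DERIV_diff has_real_derivative_along_line Cinf_on_differentiable[OF f])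
  qed
  then obtain s where s: "0 < s" "s < h"
    "g h - g 0 = h * (?D (x + h *\<^sub>R b + s *\<^sub>R a) - ?D (x + s *\<^sub>R a))"
    using MVT2[OF \<open>h > 0\<close>, of g "\<lambda>s. ?D (x + h *\<^sub>R b + s *\<^sub>R a) - ?D (x + s *\<^sub>R a)"] by auto
  define k where "k t = ?D (x + s *\<^sub>R a + t *\<^sub>R b)" for t
  have "(k has_real_derivative frechet_derivative ?D (at (x + s *\<^sub>R a + t *\<^sub>R b)) b) (at t)"
    if "0 \<le> t" "t \<le> h" for t
  proof -
    have "x + s *\<^sub>R a + t *\<^sub>R b \<in> ball x r"
      using inb'[of s t] s that by auto
    then show ?thesis
      unfolding k_def
      by (intro has_real_derivative_along_line Cinf_on_differentiable[OF Cinf_on_deriv[OF f]])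
  qed
  then obtain t where t: "0 < t" "t < h"
    "k h - k 0 = h * frechet_derivative ?D (at (x + s *\<^sub>R a + t *\<^sub>R b)) b"
    using MVT2[OF \<open>h > 0\<close>, of k "\<lambda>t. frechet_derivative ?D (at (x + s *\<^sub>R a + t *\<^sub>R b)) b"] by auto
  have "f (x + h *\<^sub>R a + h *\<^sub>R b) - f (x + h *\<^sub>R a) - f (x + h *\<^sub>R b) + f x = g h - g 0"
    by (simp add: g_def add_ac)
  also have "\<dots> = h * (k h - k 0)" using s by (simp add: k_def add_ac)
  finally have "f (x + h *\<^sub>R a + h *\<^sub>R b) - f (x + h *\<^sub>R a) - f (x + h *\<^sub>R b) + f x =
      h * h * frechet_derivative ?D (at (x + s *\<^sub>R a + t *\<^sub>R b)) b"
    using t by simp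
  moreover have "norm ((x + s *\<^sub>R a + t *\<^sub>R b) - x) \<le> h * (norm a + norm b)"
    using inb[of s t] s t by (simp add: algebra_simps)
  ultimately show ?thesis by blast
qed

lemma mixed_derivatives_commute:
  fixes f :: "'a::euclidean_space \<Rightarrow> real"
  assumes "open U" "Cinf_on U f" "x \<in> U"
  shows "frechet_derivative (\<lambda>y. frechet_derivative f (at y) a) (at x) b =
         frechet_derivative (\<lambda>y. frechet_derivative f (at y) b) (at x) a"
proof -
  let ?A = "\<lambda>x. frechet_derivative (\<lambda>y. frechet_derivative f (at y) a) (at x) b"
  let ?B = "\<lambda>x. frechet_derivative (\<lambda>y. frechet_derivative f (at y) b) (at x) a"
  obtain r where r: "r > 0" "ball x r \<subseteq> U" using assms open_contains_ball by blast
  have f: "Cinf_on (ball x r) f" using assms(2) r Ck_on_subset by blast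
  let ?c = "norm a + norm b"
  define h where "h n = r / (?c + 1) / real (n + 2)" for n :: nat
  have c: "?c + 1 > 0" by (simp add: add_nonneg_pos)
  have hpos: "h n > 0" for n using r c by (simp add: h_def)
  have hr: "h n * ?c < r" for n
  proof -
    have "r / (?c + 1) * ?c < r" using r c by (simp add: field_simps)
    moreover have "h n \<le> r / (?c + 1)"
      unfolding h_def using r c by (simp add: divide_le_eq mult_left_le)
    ultimately show ?thesis
      by (smt (verit) mult_right_mono norm_ge_zero)
  qed
  have h0: "h \<longlonglongrightarrow> 0"
  proof -
    have "(\<lambda>n. r / (?c + 1) / real (n + 2)) \<longlonglongrightarrow> 0" by (rule LIMSEQ_ignore_initial_segment[OF lim_const_over_n])
    then show ?thesis unfolding h_def .
  qed
  have "\<forall>n. \<exists>y. norm (y - x) \<le> h n * ?c \<and>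
     f (x + h n *\<^sub>R a + h n *\<^sub>R b) - f (x + h n *\<^sub>R a) - f (x + h n *\<^sub>R b) + f x = h n * h n * ?A y"
    using second_difference_mean_value[OF f hpos hr] by blast
  then obtain y where y: "\<And>n. norm (y n - x) \<le> h n * ?c"
    "\<And>n. f (x + h n *\<^sub>R a + h n *\<^sub>R b) - f (x + h n *\<^sub>R a) - f (x + h n *\<^sub>R b) + f x = h n * h n * ?A (y n)"
    by metis
  have "\<forall>n. \<exists>y. norm (y - x) \<le> h n * (norm b + norm a) \<and>
     f (x + h n *\<^sub>R b + h n *\<^sub>R a) - f (x + h n *\<^sub>R b) - f (x + h n *\<^sub>R a) + f x = h n * h n * ?B y"
    using second_difference_mean_value[OF f hpos, where a=b and b=a] hr
    by (metis add.commute)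
  then obtain z where z: "\<And>n. norm (z n - x) \<le> h n * (norm b + norm a)"
    "\<And>n. f (x + h n *\<^sub>R b + h n *\<^sub>R a) - f (x + h n *\<^sub>R b) - f (x + h n *\<^sub>R a) + f x = h n * h n * ?B (z n)"
    by metis
  have "h n * h n * ?A (y n) = h n * h n * ?B (z n)" for n
  proof -
    have "x + h n *\<^sub>R b + h n *\<^sub>R a = x + h n *\<^sub>R a + h n *\<^sub>R b" by (simp add: add_ac)
    then show ?thesis using y(2)[of n] z(2)[of n] by (simp only:)
  qed
  then have eq: "?A (y n) = ?B (z n)" for n using hpos[of n] by (metis less_irrefl mult_cancel_left mult_eq_0_iff)
  have hc: "(\<lambda>n. h n * ?c) \<longlonglongrightarrow> 0" using tendsto_mult_left_zero[OF h0] by simp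
  have "y \<longlonglongrightarrow> x"
    by (rule LIM_zero_cancel, rule tendsto_norm_zero_cancel, rule tendsto_sandwich[OF _ _ tendsto_const hc])
      (use y(1) in auto)
  have "z \<longlonglongrightarrow> x"
    by (rule LIM_zero_cancel, rule tendsto_norm_zero_cancel, rule tendsto_sandwich[OF _ _ tendsto_const hc])
      (use z(1) in \<open>auto simp: add.commute\<close>)
  have cA: "isCont ?A x" and cB: "isCont ?B x"
    using Cinf_on_continuous[OF Cinf_on_deriv[OF Cinf_on_deriv[OF assms(2)]]] assms(1,3)
    by (simp_all add: continuous_on_eq_continuous_at)
  have "(\<lambda>n. ?A (y n)) \<longlonglongrightarrow> ?A x" by (rule isCont_tendsto_compose[OF cA \<open>y \<longlonglongrightarrow> x\<close>])
  moreover have "(\<lambda>n. ?A (y n)) \<longlonglongrightarrow> ?B x"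
    unfolding eq by (rule isCont_tendsto_compose[OF cB \<open>z \<longlonglongrightarrow> x\<close>])
  ultimately show ?thesis by (rule LIMSEQ_unique)
qed

section \<open>Smooth cutoff functions of convex sets\<close>

lemma smooth_step_with_bounded_derivative:
  "\<exists>(h :: real \<Rightarrow> real) h' H. Cinf_on UNIV h \<and> 0 \<le> H \<and> continuous_on UNIV h' \<and>
     (\<forall>t. (h has_real_derivative h' t) (at t) \<and> 0 \<le> h' t \<and> h' t \<le> H \<and> 0 \<le> h t \<and> h t \<le> 1) \<and>
     (\<forall>t<0. h' t = 0) \<and> (\<forall>t>1. h' t = 0) \<and> (\<forall>t\<le>0. h t = 0) \<and> (\<forall>t\<ge>1. h t = 1)"
proof -
  obtain h :: "real \<Rightarrow> real" where h: "Cinf_on UNIV h" "mono h" "\<forall>t\<le>0. h t = 0" "\<forall>t\<ge>1. h t = 1"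
    "\<forall>t. 0 \<le> h t \<and> h t \<le> 1"
    using smooth_step_exists by blast
  define h' where "h' t = frechet_derivative h (at t) 1" for t
  have D: "(h has_real_derivative h' t) (at t)" for t
    using has_real_derivative_along_line[OF Cinf_on_differentiable[OF h(1)], of 0 t 1]
    by (simp add: h'_def)
  have c: "continuous_on UNIV h'"
    unfolding h'_def using Cinf_on_continuous[OF Cinf_on_deriv[OF h(1)]] .
  have neg: "h' t = 0" if "t < 0" for t
  proof -
    have "((\<lambda>_. 0) has_real_derivative h' t) (at t)"
      by (rule DERIV_cong_ev[OF refl _ refl, THEN iffD1, OF _ D])
        (use that h(3) in \<open>auto intro!: eventually_mono[OF eventually_nhds_in_open[of "{..<0}" t]]\<close>)
    then show ?thesis using DERIV_const DERIV_unique by blast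
  qed
  have pos: "h' t = 0" if "t > 1" for t
  proof -
    have "((\<lambda>_. 1) has_real_derivative h' t) (at t)"
      by (rule DERIV_cong_ev[OF refl _ refl, THEN iffD1, OF _ D])
        (use that h(4) in \<open>auto intro!: eventually_mono[OF eventually_nhds_in_open[of "{1<..}" t]]\<close>)
    then show ?thesis using DERIV_const DERIV_unique by blast
  qed
  have "compact (h' ` {0..1})"
    using c by (intro compact_continuous_image continuous_on_subset[OF c]) auto
  then obtain H where H: "\<forall>y\<in>h' ` {0..1}. \<bar>y\<bar> \<le> H"
    using compact_imp_bounded bounded_real by metis
  then have "\<bar>h' 0\<bar> \<le> H" by simp
  then have H0: "0 \<le> H" by linarith
  have Hb: "h' t \<le> H" for t
    using H neg[of t] pos[of t] H0 by (cases "t < 0"; cases "t > 1") (auto simp: abs_le_iff)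
  have nn: "0 \<le> h' t" for t
    using mono_on_imp_deriv_nonneg[of UNIV h "h' t" t] h(2) D by auto
  have all: "\<forall>t. (h has_real_derivative h' t) (at t) \<and> 0 \<le> h' t \<and> h' t \<le> H \<and> 0 \<le> h t \<and> h t \<le> 1"
    using D nn Hb h(5) by blast
  have out: "\<forall>t<0. h' t = 0" "\<forall>t>1. h' t = 0"
    using neg pos by blast+
  show ?thesis
    by (intro exI[of _ h] exI[of _ h'] exI[of _ H] conjI h(1) H0 c all out h(3) h(4))
qed

text \<open>Jensen's inequality for the exponential function.\<close>

lemma sum_convex_exp_ge:
  fixes w t :: "'i \<Rightarrow> real"
  assumes "\<And>i. i \<in> I \<Longrightarrow> 0 \<le> w i" "sum w I = 1"
  shows "exp (\<Sum>i\<in>I. w i * t i) \<le> (\<Sum>i\<in>I. w i * exp (t i))"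
proof -
  define m where "m = (\<Sum>i\<in>I. w i * t i)"
  have "(\<Sum>i\<in>I. w i * exp (t i)) = exp m * (\<Sum>i\<in>I. w i * exp (t i - m))"
    by (simp add: sum_distrib_left exp_diff field_simps)
  moreover have "(\<Sum>i\<in>I. w i * exp (t i - m)) \<ge> (\<Sum>i\<in>I. w i * (1 + (t i - m)))"
    using assms(1) exp_ge_add_one_self by (intro sum_mono mult_left_mono) auto
  moreover have "(\<Sum>i\<in>I. w i * (1 + (t i - m))) = 1"
  proof -
    have "(\<Sum>i\<in>I. w i * (1 + (t i - m))) = sum w I + (\<Sum>i\<in>I. w i * t i) - sum w I * m"
      by (simp add: algebra_simps sum.distrib sum_subtractf sum_distrib_left)
    then show ?thesis using assms(2) m_def by simp
  qed
  ultimately have "exp m * 1 \<le> (\<Sum>i\<in>I. w i * exp (t i))"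
    by (simp only: mult_le_cancel_left_pos exp_gt_zero)
  then show ?thesis by (simp add: m_def)
qed

text \<open>Finitely many supporting half spaces of \<open>\<Omega>\<close>, each moved inwards by \<open>\<delta>\<close>, cut out a subset
  of \<open>\<Omega>\<close>: they already separate \<open>\<Omega>\<close> from its compact boundary.\<close>

lemma finite_supporting_halfspaces:
  fixes \<Omega> :: "'a::euclidean_space set"
  assumes "open \<Omega>" "bounded \<Omega>" "convex \<Omega>" and ball: "ball a r \<subseteq> \<Omega>" and "0 < \<delta>" "\<delta> \<le> r"
  shows "\<exists>I :: ('a \<times> real) set. finite I \<and> I \<noteq> {} \<and>
    (\<forall>i\<in>I. norm (fst i) = 1 \<and> fst i \<bullet> a - snd i \<le> - r \<and> (\<forall>y\<in>\<Omega>. fst i \<bullet> y < snd i)) \<and>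
    {x. \<forall>i\<in>I. fst i \<bullet> x - snd i \<le> - \<delta>} \<subseteq> \<Omega>"
proof -
  have aO: "a \<in> \<Omega>" using ball \<open>0 < \<delta>\<close> \<open>\<delta> \<le> r\<close> by auto
  have "\<exists>p. norm p = 1 \<and> (\<forall>y\<in>\<Omega>. p \<bullet> y < p \<bullet> x)" if x: "x \<in> frontier \<Omega>" for x
  proof -
    have ri: "rel_interior (closure \<Omega>) = \<Omega>"
      using assms(1,3) by (simp add: convex_rel_interior_closure rel_interior_open)
    have "x \<in> closure \<Omega>" "x \<notin> rel_interior (closure \<Omega>)"
      using x assms(1) unfolding ri by (auto simp: frontier_def interior_open)
    then obtain q where q: "q \<noteq> 0" "\<And>y. y \<in> rel_interior (closure \<Omega>) \<Longrightarrow> q \<bullet> x < q \<bullet> y"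
      using supporting_hyperplane_rel_boundary[of "closure \<Omega>" x] assms(3) convex_closure by metis
    have "norm (- (q /\<^sub>R norm q)) = 1" "\<forall>y\<in>\<Omega>. - (q /\<^sub>R norm q) \<bullet> y < - (q /\<^sub>R norm q) \<bullet> x"
      using q unfolding ri by (auto simp: divide_simps)
    then show ?thesis by blast
  qed
  then obtain p where p: "\<And>x. x \<in> frontier \<Omega> \<Longrightarrow> norm (p x) = 1"
    "\<And>x y. x \<in> frontier \<Omega> \<Longrightarrow> y \<in> \<Omega> \<Longrightarrow> p x \<bullet> y < p x \<bullet> x"
    by metis
  have "compact (frontier \<Omega>)" using assms(2) by (simp add: compact_frontier_bounded)
  moreover have "open {y. p x \<bullet> y > p x \<bullet> x - \<delta>}" for x
    by (rule open_halfspace_gt)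
  moreover have "frontier \<Omega> \<subseteq> (\<Union>x\<in>frontier \<Omega>. {y. p x \<bullet> y > p x \<bullet> x - \<delta>})"
    using \<open>0 < \<delta>\<close> by auto
  ultimately obtain C where C: "C \<subseteq> frontier \<Omega>" "finite C"
    "frontier \<Omega> \<subseteq> (\<Union>x\<in>C. {y. p x \<bullet> y > p x \<bullet> x - \<delta>})"
    by (rule compactE_image)
  define I where "I = (\<lambda>x. (p x, p x \<bullet> x)) ` C"
  have IE: "\<exists>x\<in>frontier \<Omega>. q = p x \<and> c = p x \<bullet> x" if "(q, c) \<in> I" for q c
    using that C(1) unfolding I_def by auto
  have deep: "q \<bullet> a - c \<le> - r" if "(q, c) \<in> I" for q c
  proof -
    obtain x where x: "x \<in> frontier \<Omega>" "q = p x" "c = p x \<bullet> x" using IE[OF \<open>(q, c) \<in> I\<close>] by blast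
    have "s \<le> c - q \<bullet> a" if "s < r" for s
    proof (cases "s \<le> 0")
      case True
      then show ?thesis using p(2)[OF x(1) aO] x by auto
    next
      case False
      then have "a + s *\<^sub>R q \<in> \<Omega>"
        using that p(1)[OF x(1)] ball x(2) by (auto simp: subset_eq dist_norm)
      moreover have "q \<bullet> q = 1" using p(1)[OF x(1)] x by (simp add: norm_eq_1)
      ultimately show ?thesis using p(2)[OF x(1), of "a + s *\<^sub>R q"] x
        by (simp add: inner_add_right)
    qed
    then have "r \<le> c - q \<bullet> a" by (rule dense_le)
    then show ?thesis by simp
  qed
  have ne: "I \<noteq> {}"
  proof
    assume "I = {}"
    then have "frontier \<Omega> = {}" using C(3) unfolding I_def by auto
    then show False using frontier_eq_empty[of \<Omega>] aO assms(2) not_bounded_UNIV by auto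
  qed
  let ?K = "{x. \<forall>i\<in>I. fst i \<bullet> x - snd i \<le> - \<delta>}"
  have "?K = (\<Inter>i\<in>I. {x. fst i \<bullet> x \<le> snd i - \<delta>})" by (auto simp: algebra_simps)
  then have "convex ?K" by (auto intro!: convex_INT convex_halfspace_le)
  moreover have "a \<in> ?K"
  proof safe
    fix q c assume "(q, c) \<in> I"
    then have "q \<bullet> a - c \<le> - r" by (rule deep)
    then show "fst (q, c) \<bullet> a - snd (q, c) \<le> - \<delta>" using \<open>\<delta> \<le> r\<close> by simp
  qed
  moreover have "?K \<inter> frontier \<Omega> = {}"
  proof -
    { fix x assume x: "x \<in> frontier \<Omega>" "x \<in> ?K"
      then obtain y where y: "y \<in> C" "p y \<bullet> x > p y \<bullet> y - \<delta>" using C(3) by auto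
      then have "(p y, p y \<bullet> y) \<in> I" by (simp add: I_def)
      then have "p y \<bullet> x - p y \<bullet> y \<le> - \<delta>" using x(2) by auto
      then have False using y by simp }
    then show ?thesis by auto
  qed
  ultimately have K: "?K \<subseteq> \<Omega>"
    using connected_Int_frontier[of ?K \<Omega>] aO convex_connected[of ?K] by auto
  have "norm (fst i) = 1 \<and> fst i \<bullet> a - snd i \<le> - r \<and> (\<forall>y\<in>\<Omega>. fst i \<bullet> y < snd i)" if "i \<in> I" for i
    using IE[of "fst i" "snd i"] deep[of "fst i" "snd i"] p that by auto
  moreover have "finite I" using C(2) by (simp add: I_def)
  ultimately show ?thesis using ne K by (intro exI[of _ I]) simp
qed

text \<open>The cutoff is a smooth step applied to the softmax
  \<open>ln (\<Sum>i. exp (\<beta> (p\<^sub>i \<bullet> x - c\<^sub>i))) / \<beta>\<close> of the defining functions of finitely many half spaces. The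
  softmax is smooth, convex and close to the maximum. Its gradient \<open>Q\<close> is a convex combination of
  the unit vectors \<open>p\<^sub>i\<close>, and convexity makes \<open>Q x\<close> nearly an outer normal of \<open>\<Omega>\<close> at \<open>x\<close>
  wherever the cutoff varies.\<close>

lemma convex_cutoff:
  fixes \<Omega> :: "'a::euclidean_space set"
  assumes "open \<Omega>" "bounded \<Omega>" "convex \<Omega>" and ball: "ball a r \<subseteq> \<Omega>"
  shows "\<exists>H\<ge>0. \<forall>\<delta>. 0 < \<delta> \<and> 3 * \<delta> < r \<longrightarrow> (\<exists>\<omega> c Q.
    test_function \<Omega> \<omega> \<and>
    (\<forall>x. 0 \<le> \<omega> x \<and> \<omega> x \<le> 1 \<and> (\<omega> has_derivative (\<lambda>b. c x * (Q x \<bullet> b))) (at x) \<and>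
      norm (Q x) \<le> 1 \<and> \<bar>c x\<bar> \<le> H / \<delta>) \<and>
    (\<forall>z\<in>\<Omega>. \<omega> (a + (1 - 3 * \<delta> / r) *\<^sub>R (z - a)) = 1 \<and> c (a + (1 - 3 * \<delta> / r) *\<^sub>R (z - a)) = 0) \<and>
    (\<forall>x\<in>\<Omega>. \<forall>y\<in>\<Omega>. c x \<noteq> 0 \<longrightarrow> Q x \<bullet> (y - x) \<le> 3 * \<delta>))"
proof -
  obtain h h' :: "real \<Rightarrow> real" and H where hh: "Cinf_on UNIV h" "0 \<le> H"
    "\<forall>t. (h has_real_derivative h' t) (at t) \<and> 0 \<le> h' t \<and> h' t \<le> H \<and> 0 \<le> h t \<and> h t \<le> 1"
    "\<forall>t<0. h' t = 0" "\<forall>t>1. h' t = 0" "\<forall>t\<le>0. h t = 0" "\<forall>t\<ge>1. h t = 1"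
    using smooth_step_with_bounded_derivative by (elim exE conjE)
  have h: "Cinf_on UNIV h" "\<And>t. (h has_real_derivative h' t) (at t)" "\<And>t. \<bar>h' t\<bar> \<le> H"
    "\<And>t. t < 0 \<Longrightarrow> h' t = 0" "\<And>t. t > 1 \<Longrightarrow> h' t = 0"
    "\<And>t. t \<le> 0 \<Longrightarrow> h t = 0" "\<And>t. t \<ge> 1 \<Longrightarrow> h t = 1" "\<And>t. 0 \<le> h t" "\<And>t. h t \<le> 1"
    using hh by simp_all
  show ?thesis
  proof (intro exI[of _ H] conjI allI impI hh(2), elim conjE)
  fix \<delta> :: real assume "0 < \<delta>" "3 * \<delta> < r"
  have "\<delta> \<le> r" using \<open>0 < \<delta>\<close> \<open>3 * \<delta> < r\<close> by linarith
  obtain I :: "('a \<times> real) set" where I: "finite I" "I \<noteq> {}"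
    "\<forall>i\<in>I. norm (fst i) = 1 \<and> fst i \<bullet> a - snd i \<le> - r \<and> (\<forall>y\<in>\<Omega>. fst i \<bullet> y < snd i)"
    "{x. \<forall>i\<in>I. fst i \<bullet> x - snd i \<le> - \<delta>} \<subseteq> \<Omega>"
    using finite_supporting_halfspaces[OF assms(1-4) \<open>0 < \<delta>\<close> \<open>\<delta> \<le> r\<close>] by (elim exE conjE)
  define N where "N = real (card I)"
  have N: "N \<ge> 1" using I(1,2) by (simp add: N_def Suc_leI card_gt_0_iff)
  \<comment> \<open>The inverse temperature is so large that the softmax exceeds the maximum by at most \<open>\<delta>\<close>.\<close>
  define \<beta> where "\<beta> = N / \<delta>"
  have \<beta>: "\<beta> > 0" using N \<open>0 < \<delta>\<close> by (simp add: \<beta>_def)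
  have lnN: "ln N / \<beta> \<le> \<delta>"
    using N \<open>0 < \<delta>\<close> ln_le_minus_one[of N] by (simp add: \<beta>_def field_simps)
  define l where "l i x = fst i \<bullet> x - snd i" for i :: "'a \<times> real" and x
  define e where "e i x = exp (\<beta> * l i x)" for i x
  define Z where "Z x = (\<Sum>i\<in>I. e i x)" for x
  define f where "f x = ln (Z x) / \<beta>" for x
  define w where "w i x = e i x / Z x" for i x
  define Q where "Q x = (\<Sum>i\<in>I. w i x *\<^sub>R fst i)" for x
  define \<omega> where "\<omega> x = h (- f x / \<delta> - 1)" for x
  define c where "c x = - h' (- f x / \<delta> - 1) / \<delta>" for x
  have epos: "e i x > 0" for i x by (simp add: e_def)
  have Zpos: "Z x > 0" for x unfolding Z_def using I(1,2) epos by (intro sum_pos) auto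
  have wnn: "w i x \<ge> 0" for i x using epos[of i x] Zpos[of x] by (simp add: w_def)
  have wsum: "(\<Sum>i\<in>I. w i x) = 1" for x
    unfolding w_def sum_divide_distrib[symmetric] using Zpos[of x] by (simp add: Z_def)
  have lf: "l i x \<le> f x" if "i \<in> I" for i x
  proof -
    have "e i x \<le> Z x" unfolding Z_def
      using that I(1) epos by (intro member_le_sum) (auto simp: less_imp_le)
    then have "\<beta> * l i x \<le> ln (Z x)" using Zpos[of x] by (simp add: e_def ln_ge_iff)
    then show ?thesis using \<beta> by (simp add: f_def field_simps)
  qed
  have fl: "f x \<le> \<delta> + s" if "\<And>i. i \<in> I \<Longrightarrow> l i x \<le> s" for x s
  proof -
    have "Z x \<le> (\<Sum>i\<in>I. exp (\<beta> * s))" unfolding Z_def e_def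
      using that \<beta> by (intro sum_mono) auto
    then have "Z x \<le> N * exp (\<beta> * s)" by (simp add: N_def)
    then have "ln (Z x) \<le> ln (N * exp (\<beta> * s))" using Zpos[of x] N by simp
    also have "\<dots> = ln N + \<beta> * s" using N by (simp add: ln_mult)
    finally have "f x \<le> (ln N + \<beta> * s) / \<beta>"
      using \<beta> by (simp add: f_def divide_right_mono)
    also have "\<dots> = ln N / \<beta> + s" using \<beta> by (simp add: field_simps)
    finally show ?thesis using lnN by linarith
  qed
  have fO: "f x \<le> \<delta>" if "x \<in> \<Omega>" for x
  proof -
    have "l i x \<le> 0" if "i \<in> I" for i
      using I(3) that \<open>x \<in> \<Omega>\<close> by (simp add: l_def less_imp_le)
    then show ?thesis using fl[of x 0] by simp
  qed
  \<comment> \<open>Points of the homothetic copy are \<open>3\<delta>\<close> deep in every half space, because the centre is \<open>r\<close> deep.\<close>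
  have fdeep: "f (a + (1 - 3 * \<delta> / r) *\<^sub>R (z - a)) \<le> - 2 * \<delta>" if "z \<in> \<Omega>" for z
  proof -
    have "l i (a + (1 - 3 * \<delta> / r) *\<^sub>R (z - a)) \<le> - 3 * \<delta>" if "i \<in> I" for i
    proof -
      have 1: "fst i \<bullet> a - snd i \<le> - r" "fst i \<bullet> z - snd i < 0"
        using I(3) that \<open>z \<in> \<Omega>\<close> by auto
      have r: "r > 0" using \<open>\<delta> \<le> r\<close> \<open>0 < \<delta>\<close> by linarith
      have "l i (a + (1 - 3 * \<delta> / r) *\<^sub>R (z - a)) = 3 * \<delta> / r * (fst i \<bullet> a - snd i) + (1 - 3 * \<delta> / r) * (fst i \<bullet> z - snd i)"
        by (simp add: l_def inner_simps algebra_simps diff_divide_distrib add_divide_distrib)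
      moreover have "3 * \<delta> / r * (fst i \<bullet> a - snd i) \<le> 3 * \<delta> / r * (- r)"
        using 1 r \<open>0 < \<delta>\<close> by (intro mult_left_mono) auto
      moreover have "(1 - 3 * \<delta> / r) * (fst i \<bullet> z - snd i) \<le> 0"
        using 1 r \<open>3 * \<delta> < r\<close> by (intro mult_nonneg_nonpos) auto
      ultimately show ?thesis using r by simp
    qed
    then show ?thesis using fl[of "a + (1 - 3 * \<delta> / r) *\<^sub>R (z - a)" "- 3 * \<delta>"] by simp
  qed
  have De: "(e i has_derivative (\<lambda>b. e i x * (\<beta> * (fst i \<bullet> b)))) (at x)" for i x
    unfolding e_def l_def by (auto intro!: derivative_eq_intros)
  have DZ: "(Z has_derivative (\<lambda>b. \<Sum>i\<in>I. e i x * (\<beta> * (fst i \<bullet> b)))) (at x)" for x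
    unfolding Z_def[abs_def] by (intro has_derivative_sum De)
  have Df: "(f has_derivative (\<lambda>b. Q x \<bullet> b)) (at x)" for x
  proof -
    have "(f has_derivative (\<lambda>b. (\<Sum>i\<in>I. e i x * (\<beta> * (fst i \<bullet> b))) * inverse (Z x) / \<beta>)) (at x)"
      unfolding f_def[abs_def] using Zpos[of x] \<beta>
      by (auto intro!: derivative_eq_intros DZ simp: field_simps)
    moreover have "(\<Sum>i\<in>I. e i x * (\<beta> * (fst i \<bullet> b))) * inverse (Z x) / \<beta> = Q x \<bullet> b" for b
    proof -
      have "(\<Sum>i\<in>I. e i x * (\<beta> * (fst i \<bullet> b))) = \<beta> * (\<Sum>i\<in>I. e i x * (fst i \<bullet> b))"
        by (simp add: sum_distrib_left mult_ac)
      moreover have "Q x \<bullet> b = (\<Sum>i\<in>I. e i x * (fst i \<bullet> b)) / Z x"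
        by (simp add: Q_def w_def inner_sum_left sum_divide_distrib)
      ultimately show ?thesis using \<beta> Zpos[of x] by (simp add: field_simps)
    qed
    ultimately show ?thesis by simp
  qed
  have Dw: "(\<omega> has_derivative (\<lambda>b. c x * (Q x \<bullet> b))) (at x)" for x
  proof -
    have "((\<lambda>x. - f x / \<delta> - 1) has_derivative (\<lambda>b. - (Q x \<bullet> b) / \<delta>)) (at x)"
      using \<open>0 < \<delta>\<close> by (auto intro!: derivative_eq_intros Df)
    moreover have "(h has_derivative (\<lambda>t. h' (- f x / \<delta> - 1) * t)) (at (- f x / \<delta> - 1))"
      using h(2)[of "- f x / \<delta> - 1"] by (simp add: has_field_derivative_def)
    ultimately have "((\<lambda>x. h (- f x / \<delta> - 1)) has_derivative (\<lambda>b. h' (- f x / \<delta> - 1) * (- (Q x \<bullet> b) / \<delta>))) (at x)"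
      by (rule has_derivative_compose[where g=h])
    then show ?thesis unfolding \<omega>_def[abs_def] c_def by (simp add: field_simps)
  qed
  have cZ: "Ck_on k UNIV Z" for k
  proof -
    have "Ck_on k UNIV (\<lambda>x. \<beta> * (fst i \<bullet> x + - snd i))" for i :: "'a \<times> real"
      by (intro Ck_on_mult Ck_on_add Ck_on_const open_UNIV Ck_on_linear bounded_linear_inner_right)
    then have "Ck_on k UNIV (\<lambda>x. exp (\<beta> * (fst i \<bullet> x + - snd i)))" for i :: "'a \<times> real"
      by (rule Ck_on_compose[OF open_UNIV Cinf_on_exp[THEN spec]]) auto
    then have "Ck_on k UNIV (\<lambda>x. \<Sum>i\<in>I. exp (\<beta> * (fst i \<bullet> x + - snd i)))"
      by (intro Ck_on_sum open_UNIV)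
    then show ?thesis by (simp add: Z_def[abs_def] e_def l_def)
  qed
  have cw: "Cinf_on UNIV \<omega>"
  proof
    fix k
    have "Ck_on k UNIV (\<lambda>x. ln (Z x))"
      by (rule Ck_on_compose[OF open_UNIV Cinf_on_ln[THEN spec] cZ]) (use Zpos in auto)
    then have "Ck_on k UNIV (\<lambda>x. - (1 / (\<beta> * \<delta>)) * ln (Z x) + - 1)"
      by (intro Ck_on_mult Ck_on_add Ck_on_const open_UNIV)
    then have "Ck_on k UNIV (\<lambda>x. h (- (1 / (\<beta> * \<delta>)) * ln (Z x) + - 1))"
      by (rule Ck_on_compose[OF open_UNIV h(1)[THEN spec]]) auto
    then show "Ck_on k UNIV \<omega>" by (simp add: \<omega>_def[abs_def] f_def)
  qed
  let ?K = "{x. \<forall>i\<in>I. fst i \<bullet> x - snd i \<le> - \<delta>}"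
  have Keq: "?K = (\<Inter>i\<in>I. {x. fst i \<bullet> x \<le> snd i - \<delta>})" by (auto simp: algebra_simps)
  have clK: "closed ?K" unfolding Keq by (intro closed_INT ballI closed_halfspace_le)
  have "bounded ?K" using I(4) assms(2) by (rule bounded_subset[rotated])
  have "{x. \<omega> x \<noteq> 0} \<subseteq> ?K"
  proof safe
    fix x i assume "\<omega> x \<noteq> 0" and i: "i \<in> I"
    then have "- f x / \<delta> - 1 > 0" using h(6)[of "- f x / \<delta> - 1"] by (auto simp: \<omega>_def not_less[symmetric])
    then have "f x \<le> - \<delta>" using \<open>0 < \<delta>\<close> by (simp add: field_simps)
    then show "fst i \<bullet> x - snd i \<le> - \<delta>" using lf[OF i, of x] by (simp add: l_def)
  qed
  then have cl1: "closure {x. \<omega> x \<noteq> 0} \<subseteq> ?K" using clK by (rule closure_minimal)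
  then have cl2: "compact (closure {x. \<omega> x \<noteq> 0})"
    using bounded_subset[OF \<open>bounded ?K\<close> cl1] by (simp add: compact_eq_bounded_closed)
  have Qn: "norm (Q x) \<le> 1" for x
  proof -
    have "norm (Q x) \<le> (\<Sum>i\<in>I. norm (w i x *\<^sub>R fst i))" unfolding Q_def by (rule norm_sum)
    also have "\<dots> = (\<Sum>i\<in>I. w i x)" using I(3) wnn by (intro sum.cong) auto
    finally show ?thesis using wsum by simp
  qed
  have cb: "\<bar>c x\<bar> \<le> H / \<delta>" for x
    using h(3) \<open>0 < \<delta>\<close> by (simp add: c_def divide_right_mono)
  have sub: "Q x \<bullet> (y - x) \<le> 3 * \<delta>" if "x \<in> \<Omega>" "y \<in> \<Omega>" "c x \<noteq> 0" for x y
  proof -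
    have "h' (- f x / \<delta> - 1) \<noteq> 0" using that(3) by (auto simp: c_def)
    then have "- f x / \<delta> - 1 \<le> 1" using h(5) by force
    then have fx: "f x \<ge> - 2 * \<delta>" using \<open>0 < \<delta>\<close> by (simp add: field_simps)
    have "exp (\<Sum>i\<in>I. w i x * (\<beta> * (fst i \<bullet> (y - x)))) \<le> (\<Sum>i\<in>I. w i x * exp (\<beta> * (fst i \<bullet> (y - x))))"
      by (rule sum_convex_exp_ge) (use wnn wsum in auto)
    also have "\<dots> = (\<Sum>i\<in>I. e i y / Z x)"
    proof (rule sum.cong)
      fix i assume "i \<in> I"
      have "e i x * exp (\<beta> * (fst i \<bullet> (y - x))) = e i y"
        by (simp add: e_def l_def inner_diff_right exp_add[symmetric] algebra_simps)
      then show "w i x * exp (\<beta> * (fst i \<bullet> (y - x))) = e i y / Z x" by (simp add: w_def)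
    qed simp
    also have "\<dots> = Z y / Z x" by (simp add: Z_def sum_divide_distrib)
    also have "(\<Sum>i\<in>I. w i x * (\<beta> * (fst i \<bullet> (y - x)))) = \<beta> * (Q x \<bullet> (y - x))"
      by (simp add: Q_def inner_sum_left sum_distrib_left mult_ac)
    finally have "\<beta> * (Q x \<bullet> (y - x)) \<le> ln (Z y / Z x)"
      using Zpos[of x] Zpos[of y] by (simp add: ln_ge_iff)
    also have "\<dots> = \<beta> * (f y - f x)"
      using Zpos[of x] Zpos[of y] \<beta> by (simp add: f_def ln_div field_simps)
    finally have "Q x \<bullet> (y - x) \<le> f y - f x" using \<beta> by simp
    then show ?thesis using fO[OF that(2)] fx by simp
  qed
  have "\<omega> x = 1 \<and> c x = 0" if "f x \<le> - 2 * \<delta>" for x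
  proof -
    have "- f x / \<delta> - 1 \<ge> 1" using that \<open>0 < \<delta>\<close> by (simp add: field_simps)
    moreover have "h' 1 = 0"
    proof -
      have "\<forall>y. \<bar>1 - y\<bar> < 1 \<longrightarrow> h y \<le> h 1" using h(7)[of 1] h(9) by simp
      then show ?thesis using DERIV_local_max[OF h(2)[of 1], of 1] by simp
    qed
    ultimately show ?thesis
      using h(5)[of "- f x / \<delta> - 1"] h(7) by (cases "- f x / \<delta> - 1 = 1") (auto simp: \<omega>_def c_def)
  qed
  then have 1: "\<forall>z\<in>\<Omega>. \<omega> (a + (1 - 3 * \<delta> / r) *\<^sub>R (z - a)) = 1 \<and> c (a + (1 - 3 * \<delta> / r) *\<^sub>R (z - a)) = 0"
    using fdeep by blast
  have 2: "\<forall>x. 0 \<le> \<omega> x \<and> \<omega> x \<le> 1 \<and> (\<omega> has_derivative (\<lambda>b. c x * (Q x \<bullet> b))) (at x) \<and>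
      norm (Q x) \<le> 1 \<and> \<bar>c x\<bar> \<le> H / \<delta>"
    using Dw Qn cb h(8,9) by (simp add: \<omega>_def)
  have tf: "test_function \<Omega> \<omega>"
    using cw cl2 subset_trans[OF cl1 I(4)] by (simp add: test_function_iff)
  show "\<exists>\<omega> c Q. test_function \<Omega> \<omega> \<and>
    (\<forall>x. 0 \<le> \<omega> x \<and> \<omega> x \<le> 1 \<and> (\<omega> has_derivative (\<lambda>b. c x * (Q x \<bullet> b))) (at x) \<and>
      norm (Q x) \<le> 1 \<and> \<bar>c x\<bar> \<le> H / \<delta>) \<and>
    (\<forall>z\<in>\<Omega>. \<omega> (a + (1 - 3 * \<delta> / r) *\<^sub>R (z - a)) = 1 \<and> c (a + (1 - 3 * \<delta> / r) *\<^sub>R (z - a)) = 0) \<and>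
    (\<forall>x\<in>\<Omega>. \<forall>y\<in>\<Omega>. c x \<noteq> 0 \<longrightarrow> Q x \<bullet> (y - x) \<le> 3 * \<delta>)"
    by (intro exI[of _ \<omega>] exI[of _ c] exI[of _ Q] conjI tf 1 2 ballI impI sub)
  qed
qed

text \<open>A homothety centred at a point of a convex set maps the set into itself and scales the measure by
  a power of \<open>1 - s\<close>, so that at most a fraction \<open>DIM('a) s\<close> of the measure is left over.\<close>

lemma measure_convex_boundary_layer:
  fixes \<Omega> :: "'a::euclidean_space set"
  assumes "open \<Omega>" "bounded \<Omega>" "convex \<Omega>" "a \<in> \<Omega>" "0 < s" "s < 1"
  defines "A \<equiv> (\<lambda>z. a + (1 - s) *\<^sub>R (z - a)) ` \<Omega>"
  shows "open A" "A \<subseteq> \<Omega>" "measure lebesgue (\<Omega> - A) \<le> real DIM('a) * s * measure lebesgue \<Omega>"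
proof -
  have A: "A = (\<lambda>z. (1 - s) *\<^sub>R z + s *\<^sub>R a) ` \<Omega>"
    unfolding A_def by (intro image_cong) (auto simp: algebra_simps)
  have "A = (+) (s *\<^sub>R a) ` (*\<^sub>R) (1 - s) ` \<Omega>" unfolding A image_image by (simp add: add.commute)
  then show op: "open A" using assms(1,6) by (simp add: open_translation open_scaling)
  show sub: "A \<subseteq> \<Omega>"
    unfolding A using assms convexD_alt[of \<Omega> _ a s] by (auto simp: add.commute algebra_simps)
  have fin: "\<Omega> \<in> lmeasurable" using assms(1,2) by (simp add: lmeasurable_open)
  have "A \<in> lmeasurable" using op sub assms(2) bounded_subset lmeasurable_open by blast
  have mA: "measure lebesgue A = (1 - s) ^ DIM('a) * measure lebesgue \<Omega>"
    unfolding A using measure_lebesgue_affine[of "1 - s" "s *\<^sub>R a" \<Omega>] assms(6) by simp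
  have "measure lebesgue (\<Omega> - A) = measure lebesgue \<Omega> - measure lebesgue A"
    using fin \<open>A \<in> lmeasurable\<close> sub by (simp add: measurable_measure_Diff)
  also have "\<dots> = (1 - (1 - s) ^ DIM('a)) * measure lebesgue \<Omega>" by (simp add: mA algebra_simps)
  also have "\<dots> \<le> real DIM('a) * s * measure lebesgue \<Omega>"
    using Bernoulli_inequality[of "- s" "DIM('a)"] assms(6) by (intro mult_right_mono) auto
  finally show "measure lebesgue (\<Omega> - A) \<le> real DIM('a) * s * measure lebesgue \<Omega>" .
qed


text \<open>A field that is orthogonal to every outer normal is, uniformly, almost orthogonal to the
  approximate normals provided by \<open>convex_cutoff\<close>.\<close>

lemma almost_normal_uniform:
  fixes \<Omega> :: "'a::euclidean_space set" and v :: "'a \<times> real \<Rightarrow> 'a"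
  assumes "open \<Omega>" "bounded \<Omega>" and cont: "continuous_on (closure \<Omega> \<times> {0..T}) v"
    and normal: "\<And>x t q. x \<in> frontier \<Omega> \<Longrightarrow> t \<in> {0..T} \<Longrightarrow> \<forall>y\<in>\<Omega>. q \<bullet> (y - x) \<le> 0 \<Longrightarrow> v (x, t) \<bullet> q = 0"
    and "\<epsilon> > 0"
  shows "\<exists>d>0. \<forall>x\<in>\<Omega>. \<forall>t\<in>{0..T}. \<forall>q. norm q \<le> 1 \<and> (\<forall>y\<in>\<Omega>. q \<bullet> (y - x) \<le> d) \<longrightarrow> \<bar>v (x, t) \<bullet> q\<bar> < \<epsilon>"
proof (rule ccontr)
  assume "\<not> ?thesis"
  then have "\<forall>d>0. \<exists>x\<in>\<Omega>. \<exists>t\<in>{0..T}. \<exists>q. norm q \<le> 1 \<and> (\<forall>y\<in>\<Omega>. q \<bullet> (y - x) \<le> d) \<and> \<epsilon> \<le> \<bar>v (x, t) \<bullet> q\<bar>"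
    by (metis (no_types, lifting) not_less)
  note neg = this[rule_format]
  have "\<forall>k::nat. \<exists>w. fst w \<in> \<Omega> \<times> {0..T} \<and> norm (snd w) \<le> 1 \<and>
      (\<forall>y\<in>\<Omega>. snd w \<bullet> (y - fst (fst w)) \<le> inverse (real (Suc k))) \<and> \<epsilon> \<le> \<bar>v (fst w) \<bullet> snd w\<bar>"
  proof
    fix k :: nat
    have "0 < inverse (real (Suc k))" by simp
    from neg[OF this] obtain x t q where "x \<in> \<Omega>" "t \<in> {0..T}" "norm q \<le> 1"
      "\<forall>y\<in>\<Omega>. q \<bullet> (y - x) \<le> inverse (real (Suc k))" "\<epsilon> \<le> \<bar>v (x, t) \<bullet> q\<bar>"
      by (elim bexE exE conjE)
    then show "\<exists>w. fst w \<in> \<Omega> \<times> {0..T} \<and> norm (snd w) \<le> 1 \<and>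
      (\<forall>y\<in>\<Omega>. snd w \<bullet> (y - fst (fst w)) \<le> inverse (real (Suc k))) \<and> \<epsilon> \<le> \<bar>v (fst w) \<bullet> snd w\<bar>"
      by (intro exI[of _ "((x, t), q)"]) simp
  qed
  then obtain w where w: "\<forall>k. fst (w k) \<in> \<Omega> \<times> {0..T} \<and> norm (snd (w k)) \<le> 1 \<and>
      (\<forall>y\<in>\<Omega>. snd (w k) \<bullet> (y - fst (fst (w k))) \<le> inverse (real (Suc k))) \<and> \<epsilon> \<le> \<bar>v (fst (w k)) \<bullet> snd (w k)\<bar>"
    by (drule_tac choice, elim exE)
  let ?K = "(closure \<Omega> \<times> {0..T}) \<times> cball (0::'a) 1"
  have "compact ?K" using assms(2) by (intro compact_Times) auto
  moreover have "w k \<in> ?K" for k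
  proof -
    have "fst (w k) \<in> \<Omega> \<times> {0..T}" "norm (snd (w k)) \<le> 1" using w by auto
    then show ?thesis using closure_subset[of \<Omega>] by (cases "w k") auto
  qed
  ultimately obtain l r where l: "l \<in> ?K" "strict_mono r" "(w \<circ> r) \<longlonglongrightarrow> l"
    unfolding compact_def by metis
  obtain x t q where lq: "l = ((x, t), q)" by (metis surj_pair)
  have xt: "(x, t) \<in> closure \<Omega> \<times> {0..T}" using l(1) lq by auto
  have t1: "(\<lambda>k. fst (w (r k))) \<longlonglongrightarrow> (x, t)" "(\<lambda>k. snd (w (r k))) \<longlonglongrightarrow> q"
    using tendsto_fst[OF l(3)] tendsto_snd[OF l(3)] by (simp_all add: lq o_def)
  have "q \<bullet> (y - x) \<le> 0" if "y \<in> \<Omega>" for y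
  proof (rule LIMSEQ_le)
    show "(\<lambda>k. snd (w (r k)) \<bullet> (y - fst (fst (w (r k))))) \<longlonglongrightarrow> q \<bullet> (y - x)"
      using tendsto_fst[OF t1(1)] t1(2) by (intro tendsto_intros) auto
    show "(\<lambda>k. inverse (real (Suc (r k)))) \<longlonglongrightarrow> 0"
      using LIMSEQ_subseq_LIMSEQ[OF LIMSEQ_inverse_real_of_nat l(2)] by (simp add: o_def)
    show "\<exists>N. \<forall>k\<ge>N. snd (w (r k)) \<bullet> (y - fst (fst (w (r k)))) \<le> inverse (real (Suc (r k)))"
      using w that by blast
  qed
  then have q: "\<forall>y\<in>\<Omega>. q \<bullet> (y - x) \<le> 0" by blast
  have "v (x, t) \<bullet> q = 0"
  proof (cases "x \<in> \<Omega>")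
    case True
    then obtain e where e: "e > 0" "ball x e \<subseteq> \<Omega>" using assms(1) open_contains_ball by blast
    have "q = 0"
    proof (rule ccontr)
      assume "q \<noteq> 0"
      define s where "s = e / (2 * norm q)"
      have "s > 0" using e \<open>q \<noteq> 0\<close> by (simp add: s_def)
      have "x + s *\<^sub>R q \<in> ball x e" using e \<open>q \<noteq> 0\<close> by (simp add: dist_norm s_def)
      then have "q \<bullet> ((x + s *\<^sub>R q) - x) \<le> 0" using q e by blast
      then have "s * (q \<bullet> q) \<le> 0" by simp
      moreover have "s * (q \<bullet> q) > 0" using \<open>s > 0\<close> \<open>q \<noteq> 0\<close> by (intro mult_pos_pos) simp_all
      ultimately show False by linarith
    qed
    then show ?thesis by simp
  next
    case False
    then have "x \<in> frontier \<Omega>" using xt assms(1) by (simp add: frontier_def interior_open)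
    then show ?thesis using normal q xt by auto
  qed
  moreover have "(\<lambda>k. \<bar>v (fst (w (r k))) \<bullet> snd (w (r k))\<bar>) \<longlonglongrightarrow> \<bar>v (x, t) \<bullet> q\<bar>"
  proof -
    have "fst (w (r k)) \<in> closure \<Omega> \<times> {0..T}" for k
      using w closure_subset[of \<Omega>] by (metis mem_Times_iff subsetD)
    then have "(\<lambda>k. v (fst (w (r k)))) \<longlonglongrightarrow> v (x, t)"
      by (intro continuous_on_tendsto_compose[OF cont t1(1) xt] always_eventually) blast
    then show ?thesis using t1(2) by (intro tendsto_intros)
  qed
  ultimately have "\<epsilon> \<le> 0"
    using w by (intro LIMSEQ_le_const[of "\<lambda>k. \<bar>v (fst (w (r k))) \<bullet> snd (w (r k))\<bar>" 0 \<epsilon>]) auto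
  then show False using \<open>\<epsilon> > 0\<close> by simp
qed


lemma integrable_lebesgue_on_bounded:
  fixes f :: "'a::euclidean_space \<Rightarrow> 'b::euclidean_space"
  assumes "S \<in> lmeasurable" "f \<in> borel_measurable (lebesgue_on S)" "AE x in lebesgue_on S. norm (f x) \<le> B"
  shows "integrable (lebesgue_on S) f"
  using finite_measure.integrable_const_bound[OF finite_measure_lebesgue_on[OF assms(1)] assms(3,2)] .

text \<open>The gradients of the cutoffs blow up like \<open>1/\<delta>\<close> on a layer of width \<open>\<delta>\<close>; their product with a
  field that is tangential to the boundary tends to zero in mean.\<close>

lemma cutoffs_with_vanishing_flux:
  fixes \<Omega> :: "'a::euclidean_space set" and v :: "'a \<times> real \<Rightarrow> 'a"
  assumes "open \<Omega>" "bounded \<Omega>" "convex \<Omega>" "\<Omega> \<noteq> {}" "0 < T"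
    and cont: "continuous_on (closure \<Omega> \<times> {0..T}) v"
    and normal: "\<And>x t q. x \<in> frontier \<Omega> \<Longrightarrow> t \<in> {0..T} \<Longrightarrow> \<forall>y\<in>\<Omega>. q \<bullet> (y - x) \<le> 0 \<Longrightarrow> v (x, t) \<bullet> q = 0"
  shows "\<exists>\<omega> G. (\<forall>k::nat. test_function \<Omega> (\<omega> k) \<and>
       (\<forall>x. 0 \<le> \<omega> k x \<and> \<omega> k x \<le> 1 \<and> (\<omega> k has_derivative (\<lambda>b. G k x \<bullet> b)) (at x))) \<and>
     (\<forall>x\<in>\<Omega>. (\<lambda>k. \<omega> k x) \<longlonglongrightarrow> 1) \<and>
     (\<lambda>k. integral\<^sup>L (lebesgue_on (\<Omega> \<times> {0<..<T})) (\<lambda>z. \<bar>v z \<bullet> G k (fst z)\<bar>)) \<longlonglongrightarrow> 0"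
proof -
  let ?S = "\<Omega> \<times> {0<..<T}"
  let ?M = "lebesgue_on ?S"
  obtain a r where a: "a \<in> \<Omega>" "r > 0" "ball a r \<subseteq> \<Omega>"
    using assms(1,4) open_contains_ball by blast
  obtain H where H: "H \<ge> 0" "\<forall>\<delta>. 0 < \<delta> \<and> 3 * \<delta> < r \<longrightarrow> (\<exists>\<omega> c Q.
    test_function \<Omega> \<omega> \<and>
    (\<forall>x. 0 \<le> \<omega> x \<and> \<omega> x \<le> 1 \<and> (\<omega> has_derivative (\<lambda>b. c x * (Q x \<bullet> b))) (at x) \<and>
      norm (Q x) \<le> 1 \<and> \<bar>c x\<bar> \<le> H / \<delta>) \<and>
    (\<forall>z\<in>\<Omega>. \<omega> (a + (1 - 3 * \<delta> / r) *\<^sub>R (z - a)) = 1 \<and> c (a + (1 - 3 * \<delta> / r) *\<^sub>R (z - a)) = 0) \<and>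
    (\<forall>x\<in>\<Omega>. \<forall>y\<in>\<Omega>. c x \<noteq> 0 \<longrightarrow> Q x \<bullet> (y - x) \<le> 3 * \<delta>))"
    using convex_cutoff[OF assms(1-3) a(3)] by (elim exE conjE)
  \<comment> \<open>The cutoff parameter is \<open>\<delta> = r s / 3\<close>, so that the homothety factor becomes \<open>1 - s\<close>.\<close>
  define s where "s k = inverse (real (Suc (Suc k)))" for k
  have s: "0 < s k" "s k < 1" for k by (auto simp: s_def inverse_less_1_iff)
  have s0: "s \<longlonglongrightarrow> 0"
    unfolding s_def using LIMSEQ_Suc[OF LIMSEQ_inverse_real_of_nat] by simp
  have d: "0 < r * s k / 3 \<and> 3 * (r * s k / 3) < r" "3 * (r * s k / 3) / r = s k" for k
    using s[of k] a(2) by auto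
  have "\<forall>k. \<exists>\<omega> c Q. test_function \<Omega> \<omega> \<and>
    (\<forall>x. 0 \<le> \<omega> x \<and> \<omega> x \<le> 1 \<and> (\<omega> has_derivative (\<lambda>b. c x * (Q x \<bullet> b))) (at x) \<and>
      norm (Q x) \<le> 1 \<and> \<bar>c x\<bar> \<le> H / (r * s k / 3)) \<and>
    (\<forall>z\<in>\<Omega>. \<omega> (a + (1 - s k) *\<^sub>R (z - a)) = 1 \<and> c (a + (1 - s k) *\<^sub>R (z - a)) = 0) \<and>
    (\<forall>x\<in>\<Omega>. \<forall>y\<in>\<Omega>. c x \<noteq> 0 \<longrightarrow> Q x \<bullet> (y - x) \<le> 3 * (r * s k / 3))"
    (is "\<forall>k. \<exists>\<omega> c Q. ?P k \<omega> c Q")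
    using H(2)[rule_format, OF d(1)] unfolding d(2) by (rule allI)
  then obtain \<omega> c Q where P: "\<And>k. ?P k (\<omega> k) (c k) (Q k)"
    by (drule_tac choice, elim exE, drule_tac choice, elim exE, drule_tac choice, elim exE, blast)
  have \<omega>: "test_function \<Omega> (\<omega> k)"
    "0 \<le> \<omega> k x" "\<omega> k x \<le> 1" "(\<omega> k has_derivative (\<lambda>b. (c k x *\<^sub>R Q k x) \<bullet> b)) (at x)"
    "norm (Q k x) \<le> 1" "\<bar>c k x\<bar> \<le> H * 3 / (r * s k)" for k x
    using P[of k] by simp_all
  have \<omega>a: "\<omega> k (a + (1 - s k) *\<^sub>R (z - a)) = 1" "c k (a + (1 - s k) *\<^sub>R (z - a)) = 0" if "z \<in> \<Omega>" for k z
    using P[of k] that by simp_all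
  have Qn: "Q k x \<bullet> (y - x) \<le> r * s k" if "x \<in> \<Omega>" "y \<in> \<Omega>" "c k x \<noteq> 0" for k x y
    using P[of k] that by simp
  define G where "G k x = c k x *\<^sub>R Q k x" for k x
  have lim: "(\<lambda>k. \<omega> k x) \<longlonglongrightarrow> 1" if "x \<in> \<Omega>" for x
  proof -
    have "(\<lambda>k. a + (x - a) /\<^sub>R (1 - s k)) \<longlonglongrightarrow> a + (x - a) /\<^sub>R (1 - 0)"
      using s0 by (intro tendsto_intros) auto
    then have "eventually (\<lambda>k. a + (x - a) /\<^sub>R (1 - s k) \<in> \<Omega>) sequentially"
      using topological_tendstoD[of _ x _ \<Omega>] assms(1) that by simp
    then have "eventually (\<lambda>k. \<omega> k x = 1) sequentially"
    proof (rule eventually_mono)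
      fix k assume "a + (x - a) /\<^sub>R (1 - s k) \<in> \<Omega>"
      from \<omega>a(1)[OF this, of k] show "\<omega> k x = 1" using s[of k] by simp
    qed
    then show ?thesis by (rule tendsto_eventually)
  qed
  have opS: "open ?S" "bounded ?S" "convex ?S"
    using assms by (auto intro: open_Times bounded_Times convex_Times)
  have Sm: "?S \<in> lmeasurable" using opS by (simp add: lmeasurable_open)
  have Ssub: "?S \<subseteq> closure \<Omega> \<times> {0..T}" using closure_subset[of \<Omega>] by auto
  \<comment> \<open>The homothetic copy of the cylinder lies in the region where the cutoff is constant.\<close>
  define A where "A k = (\<lambda>z. (a, T/2) + (1 - s k) *\<^sub>R (z - (a, T/2))) ` ?S" for k
  define C where "C = real DIM('a \<times> real) * measure lebesgue ?S * (H * 3 / r)"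
  have C: "C \<ge> 0" using H(1) a(2) by (simp add: C_def)
  have A: "open (A k)" "A k \<subseteq> ?S"
    "measure lebesgue (?S - A k) \<le> real DIM('a \<times> real) * s k * measure lebesgue ?S" for k
    unfolding A_def using measure_convex_boundary_layer[OF opS, of "(a, T/2)" "s k"] a(1) assms(5) s[of k] by auto
  have GA: "G k (fst z) = 0" if "z \<in> A k" for k z
  proof -
    from that[unfolded A_def] obtain y where "z = (a, T/2) + (1 - s k) *\<^sub>R (y - (a, T/2))" "y \<in> ?S"
      by (rule imageE)
    then have "fst z = a + (1 - s k) *\<^sub>R (fst y - a)" "fst y \<in> \<Omega>" by auto
    then show ?thesis using \<omega>a(2)[of "fst y" k] by (simp add: G_def)
  qed
  have "(\<lambda>k. integral\<^sup>L ?M (\<lambda>z. \<bar>v z \<bullet> G k (fst z)\<bar>)) \<longlonglongrightarrow> 0"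
  proof (rule LIMSEQ_I)
    fix e :: real assume "e > 0"
    define \<epsilon> where "\<epsilon> = e / (C + 1)"
    have "\<epsilon> > 0" using \<open>e > 0\<close> C by (simp add: \<epsilon>_def)
    obtain d where d: "d > 0" "\<forall>x\<in>\<Omega>. \<forall>t\<in>{0..T}. \<forall>q. norm q \<le> 1 \<and> (\<forall>y\<in>\<Omega>. q \<bullet> (y - x) \<le> d) \<longrightarrow> \<bar>v (x, t) \<bullet> q\<bar> < \<epsilon>"
      using almost_normal_uniform[OF assms(1,2) cont normal \<open>\<epsilon> > 0\<close>] by blast
    have "(\<lambda>k. r * s k) \<longlonglongrightarrow> 0" using tendsto_mult_right_zero[OF s0] by simp
    then have "eventually (\<lambda>k. r * s k < d) sequentially" using d(1) order_tendstoD(2) by blast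
    then obtain N where N: "\<And>k. k \<ge> N \<Longrightarrow> r * s k < d" by (auto simp: eventually_sequentially)
    have "norm (integral\<^sup>L ?M (\<lambda>z. \<bar>v z \<bullet> G k (fst z)\<bar>) - 0) < e" if "k \<ge> N" for k
    proof -
      let ?B = "H * 3 / (r * s k) * \<epsilon>"
      have "\<bar>v z \<bullet> G k (fst z)\<bar> \<le> ?B * indicator (?S - A k) z" if "z \<in> ?S" for z
      proof (cases "z \<in> A k \<or> c k (fst z) = 0")
        case True
        then have "G k (fst z) = 0" using GA[of z k] by (elim disjE) (simp_all add: G_def)
        moreover have "?B \<ge> 0" using H(1) a(2) s[of k] \<open>\<epsilon> > 0\<close> by simp
        ultimately show ?thesis by (simp add: indicator_def)
      next
        case False
        have z: "fst z \<in> \<Omega>" "snd z \<in> {0..T}" using that by auto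
        have "norm (Q k (fst z)) \<le> 1 \<and> (\<forall>y\<in>\<Omega>. Q k (fst z) \<bullet> (y - fst z) \<le> d)"
          using Qn[OF z(1), of _ k] False \<omega>(5)[of k "fst z"] N[OF \<open>k \<ge> N\<close>] by fastforce
        then have "\<bar>v (fst z, snd z) \<bullet> Q k (fst z)\<bar> < \<epsilon>" using d(2) z by blast
        then have "\<bar>c k (fst z)\<bar> * \<bar>v z \<bullet> Q k (fst z)\<bar> \<le> ?B"
          using \<omega>(6)[of k "fst z"] H(1) a(2) s[of k] by (intro mult_mono) auto
        then show ?thesis using False that by (simp add: G_def abs_mult)
      qed
      note bound = this
      have Am: "?S - A k \<in> sets lebesgue" using Sm A(1)[of k] by auto
      have int: "integrable ?M (\<lambda>z. ?B * indicator (?S - A k) z)"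
        using Am by (intro integrable_lebesgue_on_bounded[OF Sm, of _ "\<bar>?B\<bar>"] borel_measurable_times
          borel_measurable_const measurable_restrict_space1 borel_measurable_indicator) (auto simp: indicator_def)
      have "integral\<^sup>L ?M (\<lambda>z. \<bar>v z \<bullet> G k (fst z)\<bar>) \<le> integral\<^sup>L ?M (\<lambda>z. ?B * indicator (?S - A k) z)"
        using bound H(1) a(2) s[of k] \<open>\<epsilon> > 0\<close>
        by (intro integral_mono' int) (simp_all add: space_restrict_space)
      also have "\<dots> = ?B * measure lebesgue (?S - A k)"
      proof -
        have "(?S - A k) \<inter> ?S = ?S - A k" by blast
        then show ?thesis
          using Sm A(1)[of k] by (simp add: measure_restrict_space integral_restrict_space)
      qed
      also have "\<dots> \<le> ?B * (real DIM('a \<times> real) * s k * measure lebesgue ?S)"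
        using A(3)[of k] H(1) a(2) s[of k] \<open>\<epsilon> > 0\<close> by (intro mult_left_mono) auto
      also have "\<dots> = C * \<epsilon>" using s[of k] a(2) by (simp add: C_def)
      also have "\<dots> < e" using \<open>e > 0\<close> C by (simp add: \<epsilon>_def field_simps)
      finally have "integral\<^sup>L ?M (\<lambda>z. \<bar>v z \<bullet> G k (fst z)\<bar>) < e" .
      moreover have "integral\<^sup>L ?M (\<lambda>z. \<bar>v z \<bullet> G k (fst z)\<bar>) \<ge> 0" by (rule integral_nonneg_AE) simp
      ultimately show ?thesis by simp
    qed
    then show "\<exists>no. \<forall>n\<ge>no. norm (integral\<^sup>L ?M (\<lambda>z. \<bar>v z \<bullet> G n (fst z)\<bar>) - 0) < e" by blast
  qed
  then show ?thesis
    using \<omega>(1-3) \<omega>(4)[folded G_def] lim by (intro exI[of _ \<omega>] exI[of _ G]) simp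
qed

section \<open>Test functions and uniqueness of weak derivatives\<close>

text \<open>The factor \<open>f\<close> may be arbitrary outside \<open>U\<close>, where \<open>\<omega>\<close> vanishes.\<close>

lemma test_function_cutoff_mult:
  assumes "test_function S \<omega>"
    and f: "open U" "S \<subseteq> U" "Cinf_on U f"
  shows "test_function S (\<lambda>x. \<omega> x * f x)"
proof -
  let ?K = "closure {x. \<omega> x \<noteq> 0}"
  have \<omega>: "Cinf_on UNIV \<omega>" "compact ?K" "?K \<subseteq> S"
    using assms(1) by (simp_all add: test_function_iff)
  have 1: "Ck_on k U (\<lambda>x. \<omega> x * f x)" for k
    using \<omega>(1) f by (intro Ck_on_mult) (auto intro: Ck_on_subset)
  have 2: "Ck_on k (- ?K) (\<lambda>x. \<omega> x * f x)" for k
  proof (rule Ck_on_cong)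
    show "Ck_on k (- ?K) (\<lambda>x. 0)" by (rule Ck_on_const)
    show "0 = \<omega> x * f x" if "x \<in> - ?K" for x
      using that closure_subset[of "{x. \<omega> x \<noteq> 0}"] by auto
  qed auto
  have "Ck_on k UNIV (\<lambda>x. \<omega> x * f x)" for k
  proof (rule Ck_on_local)
    fix x
    show "\<exists>V. open V \<and> x \<in> V \<and> Ck_on k V (\<lambda>x. \<omega> x * f x)"
    proof (cases "x \<in> U")
      case True then show ?thesis using 1[of k] f(1) by blast
    next
      case False
      then have "x \<in> - ?K" using \<omega>(3) f(2) by blast
      then show ?thesis using 2[of k] open_Compl[OF closed_closure] by blast
    qed
  qed
  moreover have "closure {x. \<omega> x * f x \<noteq> 0} \<subseteq> ?K" by (rule closure_mono) auto
  ultimately show ?thesis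
    unfolding test_function_iff
    using \<omega>(2,3) by (auto dest: bounded_subset simp: compact_eq_bounded_closed)
qed

lemma convex_cutoff_sequence:
  fixes S :: "'a::euclidean_space set"
  assumes "open S" "bounded S" "convex S" "S \<noteq> {}"
  shows "\<exists>\<omega>. (\<forall>k::nat. test_function S (\<omega> k) \<and> (\<forall>x. 0 \<le> \<omega> k x \<and> \<omega> k x \<le> 1)) \<and>
     (\<forall>x\<in>S. (\<lambda>k. \<omega> k x) \<longlonglongrightarrow> 1)"
proof -
  define v where "v = (\<lambda>_ :: 'a \<times> real. 0 :: 'a)"
  have "\<exists>\<omega> G. (\<forall>k::nat. test_function S (\<omega> k) \<and>
       (\<forall>x. 0 \<le> \<omega> k x \<and> \<omega> k x \<le> 1 \<and> (\<omega> k has_derivative (\<lambda>b. G k x \<bullet> b)) (at x))) \<and>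
     (\<forall>x\<in>S. (\<lambda>k. \<omega> k x) \<longlonglongrightarrow> 1) \<and>
     (\<lambda>k. integral\<^sup>L (lebesgue_on (S \<times> {0<..<1})) (\<lambda>z. \<bar>v z \<bullet> G k (fst z)\<bar>)) \<longlonglongrightarrow> 0"
    by (rule cutoffs_with_vanishing_flux[OF assms]) (auto simp: v_def)
  then show ?thesis by (elim exE conjE, intro exI conjI) simp_all
qed

lemma AE_lebesgue_on_iff:
  "S \<in> sets lebesgue \<Longrightarrow> (AE x in lebesgue_on S. P x) \<longleftrightarrow> (AE x in lebesgue. x \<in> S \<longrightarrow> P x)"
  by (simp add: AE_restrict_space_iff)

lemma set_integral_lebesgue_on:
  fixes f :: "'a::euclidean_space \<Rightarrow> 'b::euclidean_space"
  shows "S \<in> sets lebesgue \<Longrightarrow> (LINT x:S|lebesgue. f x) = integral\<^sup>L (lebesgue_on S) f"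
  by (simp add: set_lebesgue_integral_def integral_restrict_space)

text \<open>A measurable function is almost everywhere a limit of continuous functions; these are truncated at
  \<open>\<plusminus>B\<close> and replaced by polynomials with the Weierstrass theorem.\<close>

lemma bounded_measurable_approx_by_polynomials:
  fixes f :: "'a::euclidean_space \<Rightarrow> real"
  assumes "open S" "bounded S" "f \<in> borel_measurable (lebesgue_on S)"
    and B: "AE x in lebesgue_on S. \<bar>f x\<bar> \<le> B" "0 \<le> B"
  shows "\<exists>p. (\<forall>n::nat. Cinf_on UNIV (p n) \<and> (\<forall>x\<in>S. \<bar>p n x\<bar> \<le> B + 1)) \<and>
     (AE x in lebesgue_on S. (\<lambda>n. p n x) \<longlonglongrightarrow> f x)"
proof -
  have S: "S \<in> sets lebesgue" using assms(1) by auto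
  have "f measurable_on S" using assms(3) S by (simp add: measurable_on_iff_borel_measurable)
  then obtain N g where g: "negligible N" "\<And>n. continuous_on UNIV (g n)"
     "\<And>x. x \<notin> N \<Longrightarrow> (\<lambda>n. g n x) \<longlonglongrightarrow> (if x \<in> S then f x else 0)"
    unfolding measurable_on_def by blast
  define c where "c n x = max (- B) (min B (g n x))" for n x
  have c: "continuous_on (closure S) (c n)" for n
    unfolding c_def[abs_def] using continuous_on_subset[OF g(2)]
    by (intro continuous_on_max continuous_on_min continuous_on_const) auto
  have "\<exists>p. real_polynomial_function p \<and> (\<forall>x\<in>closure S. \<bar>c n x - p x\<bar> < inverse (real (Suc n)))" for n
    using Stone_Weierstrass_real_polynomial_function[OF _ c, of "inverse (real (Suc n))"] assms(2)
    by (metis compact_closure inverse_positive_iff_positive of_nat_0_less_iff zero_less_Suc)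
  then obtain p where p: "\<And>n. real_polynomial_function (p n)"
      "\<And>n x. x \<in> closure S \<Longrightarrow> \<bar>c n x - p n x\<bar> < inverse (real (Suc n))"
    by metis
  have "\<bar>p n x\<bar> \<le> B + 1" if "x \<in> S" for n x
  proof -
    have "\<bar>c n x\<bar> \<le> B" using B(2) by (auto simp: c_def)
    moreover have "inverse (real (Suc n)) \<le> 1" by (simp add: inverse_le_1_iff)
    moreover have "\<bar>c n x - p n x\<bar> < inverse (real (Suc n))" using p(2) that closure_subset by blast
    ultimately show ?thesis by linarith
  qed
  moreover have "AE x in lebesgue_on S. (\<lambda>n. p n x) \<longlonglongrightarrow> f x"
  proof -
    have "AE x in lebesgue. x \<notin> N" using g(1) by (intro AE_not_in) (simp add: negligible_iff_null_sets)
    moreover have "AE x in lebesgue. x \<in> S \<longrightarrow> \<bar>f x\<bar> \<le> B" using B(1) S by (simp add: AE_lebesgue_on_iff)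
    ultimately have "AE x in lebesgue. x \<in> S \<longrightarrow> (\<lambda>n. p n x) \<longlonglongrightarrow> f x"
    proof eventually_elim
      case (elim x)
      show ?case
      proof
        assume x: "x \<in> S"
        have "(\<lambda>n. c n x) \<longlonglongrightarrow> max (- B) (min B (f x))"
          unfolding c_def using g(3)[OF elim(1)] x by (intro tendsto_intros) auto
        moreover have "max (- B) (min B (f x)) = f x" using elim(2) x by auto
        ultimately have c: "(\<lambda>n. c n x) \<longlonglongrightarrow> f x" by simp
        have "(\<lambda>n. c n x - p n x) \<longlonglongrightarrow> 0"
        proof (rule Lim_null_comparison[OF _ LIMSEQ_inverse_real_of_nat], rule always_eventually, rule allI)
          show "norm (c n x - p n x) \<le> inverse (real (Suc n))" for n
            using p(2)[of x n] x closure_subset[of S] by (auto intro: less_imp_le)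
        qed
        from tendsto_diff[OF c this] show "(\<lambda>n. p n x) \<longlonglongrightarrow> f x" by simp
      qed
    qed
    then show ?thesis using S by (simp add: AE_lebesgue_on_iff)
  qed
  ultimately show ?thesis using Cinf_on_real_polynomial_function[OF p(1)] by (intro exI[of _ p]) blast
qed

lemma bounded_measurable_approx_by_test_functions:
  fixes f :: "'a::euclidean_space \<Rightarrow> real"
  assumes S: "open S" "bounded S" "convex S" "S \<noteq> {}" and f: "f \<in> borel_measurable (lebesgue_on S)"
    and B: "AE x in lebesgue_on S. \<bar>f x\<bar> \<le> B" "0 \<le> B"
  shows "\<exists>\<phi>. (\<forall>n::nat. test_function S (\<phi> n) \<and> (\<forall>x\<in>S. \<bar>\<phi> n x\<bar> \<le> B + 1)) \<and>
     (AE x in lebesgue_on S. (\<lambda>n. \<phi> n x) \<longlonglongrightarrow> f x)"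
proof -
  obtain p where p: "\<forall>n::nat. Cinf_on UNIV (p n) \<and> (\<forall>x\<in>S. \<bar>p n x\<bar> \<le> B + 1)"
     "AE x in lebesgue_on S. (\<lambda>n. p n x) \<longlonglongrightarrow> f x"
    using bounded_measurable_approx_by_polynomials[OF S(1,2) f B] by (elim exE conjE)
  obtain \<omega> where \<omega>: "\<forall>k::nat. test_function S (\<omega> k) \<and> (\<forall>x. 0 \<le> \<omega> k x \<and> \<omega> k x \<le> 1)"
     "\<forall>x\<in>S. (\<lambda>k. \<omega> k x) \<longlonglongrightarrow> 1"
    using convex_cutoff_sequence[OF S] by (elim exE conjE)
  define \<phi> where "\<phi> n x = \<omega> n x * p n x" for n x
  have "test_function S (\<phi> n)" for n
    unfolding \<phi>_def using \<omega>(1) p(1)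
    by (intro test_function_cutoff_mult[where U=UNIV]) simp_all
  moreover have "\<bar>\<phi> n x\<bar> \<le> B + 1" if "x \<in> S" for n x
  proof -
    have "\<bar>\<omega> n x\<bar> * \<bar>p n x\<bar> \<le> 1 * (B + 1)" using \<omega>(1) p(1) that by (intro mult_mono) auto
    then show ?thesis by (simp add: \<phi>_def abs_mult)
  qed
  moreover have "AE x in lebesgue_on S. (\<lambda>n. \<phi> n x) \<longlonglongrightarrow> f x"
    using p(2) AE_space
  proof eventually_elim
    case (elim x)
    then have "(\<lambda>n. \<omega> n x * p n x) \<longlonglongrightarrow> 1 * f x"
      using \<omega>(2) by (intro tendsto_mult) (auto simp: space_restrict_space)
    then show ?case by (simp add: \<phi>_def)
  qed
  ultimately show ?thesis by (intro exI[of _ \<phi>]) blast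
qed

lemma locally_integrable_imp_measurable:
  fixes f :: "'a::euclidean_space \<Rightarrow> 'b::euclidean_space"
  assumes "open S" "locally_integrable_on f S"
  shows "f \<in> borel_measurable (lebesgue_on S)"
proof -
  have "\<exists>C. (\<forall>n::nat. compact (C n) \<and> C n \<subseteq> S \<and> C n \<subseteq> interior (C (Suc n))) \<and> \<Union> (range C) = S"
  proof (rule open_Union_compact_subsets[OF assms(1)])
    fix C :: "nat \<Rightarrow> 'a set"
    assume "\<And>n. compact (C n)" "\<And>n. C n \<subseteq> S" "\<And>n. C n \<subseteq> interior (C (Suc n))" "\<Union> (range C) = S"
    then show ?thesis by (intro exI[of _ C]) simp
  qed
  then obtain C where "\<forall>n::nat. compact (C n) \<and> C n \<subseteq> S \<and> C n \<subseteq> interior (C (Suc n))"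
    and CS: "\<Union> (range C) = S" by (elim exE conjE)
  then have C: "compact (C n)" "C n \<subseteq> S" "C n \<subseteq> interior (C (Suc n))" for n by simp_all
  have "(\<lambda>x. if x \<in> S then f x else 0) \<in> borel_measurable lebesgue"
  proof (rule borel_measurable_LIMSEQ_metric)
    show "(\<lambda>x. indicator (C n) x *\<^sub>R f x) \<in> borel_measurable lebesgue" for n
    proof -
      have "set_integrable lebesgue (C n) f"
        using assms(2) C(1,2)[of n] by (simp add: locally_integrable_on_def)
      then show ?thesis unfolding set_integrable_def by (rule borel_measurable_integrable)
    qed
    have "incseq C" by (rule incseq_SucI) (rule subset_trans[OF C(3) interior_subset])
    show "(\<lambda>n. indicator (C n) x *\<^sub>R f x) \<longlonglongrightarrow> (if x \<in> S then f x else 0)" for x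
    proof (cases "x \<in> S")
      case True
      then obtain m where "x \<in> C m" using CS by blast
      then have "eventually (\<lambda>n. indicator (C n) x *\<^sub>R f x = f x) sequentially"
        using incseqD[OF \<open>incseq C\<close>] by (auto simp: eventually_sequentially indicator_def intro!: exI[of _ m])
      then show ?thesis using True by (simp add: tendsto_eventually)
    next
      case False
      then have "x \<notin> C n" for n using C(2)[of n] by auto
      then show ?thesis using False by simp
    qed
  qed
  then show ?thesis using assms(1) by (simp add: borel_measurable_if_lebesgue_on borel_measurable_if)
qed

lemma bounded_measurable_imp_locally_integrable:
  fixes f :: "'a::euclidean_space \<Rightarrow> 'b::euclidean_space"
  assumes "S \<in> lmeasurable" "f \<in> borel_measurable (lebesgue_on S)" "AE x in lebesgue_on S. norm (f x) \<le> B"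
  shows "locally_integrable_on f S"
  unfolding locally_integrable_on_def
proof safe
  fix K assume "compact K" "K \<subseteq> S"
  have "S \<inter> space lebesgue \<in> sets lebesgue" using assms(1) by simp
  then have "set_integrable lebesgue S f"
    unfolding set_integrable_def using integrable_lebesgue_on_bounded[OF assms]
    by (rule integrable_restrict_space[THEN iffD1])
  then show "set_integrable lebesgue K f"
    using \<open>compact K\<close> \<open>K \<subseteq> S\<close> by (rule set_integrable_subset[OF _ lmeasurable_compact[THEN fmeasurableD]])
qed

lemma test_function_support:
  assumes "test_function S \<phi>"
  shows "\<exists>K B. compact K \<and> K \<subseteq> S \<and> (\<forall>x. x \<notin> K \<longrightarrow> \<phi> x = 0) \<and> (\<forall>x. \<bar>\<phi> x\<bar> \<le> B)"
proof -
  let ?K = "closure {x. \<phi> x \<noteq> 0}"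
  have K: "compact ?K" "?K \<subseteq> S" and c: "continuous_on UNIV \<phi>"
    using assms Cinf_on_continuous unfolding test_function_iff by blast+
  have "compact (\<phi> ` ?K)" using K c by (blast intro: compact_continuous_image continuous_on_subset)
  then obtain B where B: "\<forall>x\<in>?K. \<bar>\<phi> x\<bar> \<le> B"
    using compact_imp_bounded bounded_real by (metis imageI)
  have z: "\<phi> x = 0" if "x \<notin> ?K" for x using that closure_subset[of "{x. \<phi> x \<noteq> 0}"] by auto
  have "\<bar>\<phi> x\<bar> \<le> \<bar>B\<bar>" for x
  proof (cases "x \<in> ?K")
    case True
    then have "\<bar>\<phi> x\<bar> \<le> B" using B by (rule bspec[rotated])
    then show ?thesis by linarith
  next
    case False
    then show ?thesis using z[OF False] by simp
  qed
  then show ?thesis by (intro exI[of _ ?K] exI[of _ "\<bar>B\<bar>"] conjI K allI impI z)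
qed

lemma test_function_continuous: "test_function S \<phi> \<Longrightarrow> continuous_on UNIV \<phi>"
  unfolding test_function_iff using Cinf_on_continuous by blast

lemma test_function_deriv:
  assumes "test_function S \<phi>"
  shows "test_function S (\<lambda>x. frechet_derivative \<phi> (at x) b)"
proof -
  let ?K = "closure {x. \<phi> x \<noteq> 0}"
  have "frechet_derivative \<phi> (at x) b = 0" if "x \<notin> ?K" for x
  proof -
    have "(\<phi> has_derivative (\<lambda>_. 0)) (at x)"
      by (rule has_derivative_transform_within_open[of "\<lambda>_. 0" _ _ _ "- ?K"])
        (use that closure_subset[of "{x. \<phi> x \<noteq> 0}"] in auto)
    from frechet_derivative_at[OF this] show ?thesis by (metis (full_types))
  qed
  then have "{x. frechet_derivative \<phi> (at x) b \<noteq> 0} \<subseteq> ?K" by auto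
  then have "closure {x. frechet_derivative \<phi> (at x) b \<noteq> 0} \<subseteq> ?K" by (simp add: closure_minimal)
  then show ?thesis
    using assms Cinf_on_deriv[of UNIV \<phi> b] unfolding test_function_iff
    by (auto dest: bounded_subset simp: compact_eq_bounded_closed)
qed

lemma test_function_integrable:
  fixes g :: "'a::euclidean_space \<Rightarrow> 'b::euclidean_space"
  assumes "open S" "locally_integrable_on g S" "test_function S \<phi>"
  shows "integrable (lebesgue_on S) (\<lambda>x. \<phi> x *\<^sub>R g x)"
proof -
  obtain K B where K: "compact K" "K \<subseteq> S" "\<forall>x. x \<notin> K \<longrightarrow> \<phi> x = 0" "\<forall>x. \<bar>\<phi> x\<bar> \<le> B"
    using test_function_support[OF assms(3)] by (elim exE conjE)
  have g: "integrable lebesgue (\<lambda>x. indicator K x *\<^sub>R g x)"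
    using assms(2) K(1,2) by (simp add: locally_integrable_on_def set_integrable_def)
  have \<phi>: "\<phi> \<in> borel_measurable lebesgue"
    using test_function_continuous[OF assms(3)] by (simp add: borel_measurable_continuous_onI measurable_completion)
  have "integrable lebesgue (\<lambda>x. \<phi> x *\<^sub>R (indicator K x *\<^sub>R g x))"
  proof (rule Bochner_Integration.integrable_bound)
    show "integrable lebesgue (\<lambda>x. B *\<^sub>R (indicator K x *\<^sub>R g x))"
      using g by (rule integrable_scaleR_right)
    show "AE x in lebesgue. norm (\<phi> x *\<^sub>R (indicator K x *\<^sub>R g x)) \<le> norm (B *\<^sub>R (indicator K x *\<^sub>R g x))"
    proof (rule AE_I2)
      fix x
      have "\<bar>\<phi> x\<bar> \<le> \<bar>B\<bar>" using K(4)[rule_format, of x] by linarith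
      then show "norm (\<phi> x *\<^sub>R (indicator K x *\<^sub>R g x)) \<le> norm (B *\<^sub>R (indicator K x *\<^sub>R g x))"
        by (simp only: norm_scaleR real_norm_def mult_right_mono norm_ge_zero mult_nonneg_nonneg abs_ge_zero)
    qed
    show "(\<lambda>x. \<phi> x *\<^sub>R (indicator K x *\<^sub>R g x)) \<in> borel_measurable lebesgue"
      by (rule borel_measurable_scaleR[OF \<phi> borel_measurable_integrable[OF g]])
  qed
  moreover have "(\<lambda>x. \<phi> x *\<^sub>R (indicator K x *\<^sub>R g x)) = (\<lambda>x. indicator S x *\<^sub>R (\<phi> x *\<^sub>R g x))"
    using K(2,3) by (auto simp: indicator_def fun_eq_iff)
  ultimately show ?thesis using assms(1) by (simp add: integrable_restrict_space)
qed

text \<open>The fundamental lemma of the calculus of variations, obtained by testing with smooth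
  approximations of the sign of \<open>d\<close>.\<close>

lemma zero_of_zero_against_test_functions:
  fixes d :: "'a::euclidean_space \<Rightarrow> real"
  assumes S: "open S" "bounded S" "convex S" "S \<noteq> {}" and d: "locally_integrable_on d S"
    and zero: "\<And>\<phi>. test_function S \<phi> \<Longrightarrow> integral\<^sup>L (lebesgue_on S) (\<lambda>x. \<phi> x * d x) = 0"
  shows "AE x in lebesgue_on S. d x = 0"
proof -
  let ?M = "lebesgue_on S"
  have dm: "d \<in> borel_measurable ?M" by (rule locally_integrable_imp_measurable[OF S(1) d])
  have sm: "(\<lambda>x. sgn (d x)) \<in> borel_measurable ?M"
    using dm by (simp add: sgn_if[abs_def]) measurable
  obtain p where p: "\<forall>n::nat. Cinf_on UNIV (p n) \<and> (\<forall>x\<in>S. \<bar>p n x\<bar> \<le> 1 + 1)"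
     "AE x in ?M. (\<lambda>n. p n x) \<longlonglongrightarrow> sgn (d x)"
    using bounded_measurable_approx_by_polynomials[OF S(1,2) sm, of 1] by (auto simp: abs_sgn_eq)
  obtain \<omega> where \<omega>: "\<forall>k::nat. test_function S (\<omega> k) \<and> (\<forall>x. 0 \<le> \<omega> k x \<and> \<omega> k x \<le> 1)"
     "\<forall>x\<in>S. (\<lambda>k. \<omega> k x) \<longlonglongrightarrow> 1"
    using convex_cutoff_sequence[OF S] by (elim exE conjE)
  have "AE x in ?M. \<omega> k x * \<bar>d x\<bar> = 0" for k
  proof -
    have t: "test_function S (\<lambda>x. \<omega> k x * f x)" if "Cinf_on UNIV f" for f
      using \<omega>(1) that by (intro test_function_cutoff_mult[where U=UNIV]) simp_all
    have "test_function S (\<lambda>x. \<omega> k x * 1)" by (rule t) (simp add: Ck_on_const)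
    then have i: "integrable ?M (\<lambda>x. \<omega> k x * d x)"
      using test_function_integrable[OF S(1) d] by simp
    have i': "integrable ?M (\<lambda>x. \<omega> k x * p n x * d x)" for n
      using test_function_integrable[OF S(1) d t[of "p n"]] p(1) by simp
    have "(\<lambda>n. integral\<^sup>L ?M (\<lambda>x. \<omega> k x * p n x * d x)) \<longlonglongrightarrow> integral\<^sup>L ?M (\<lambda>x. \<omega> k x * \<bar>d x\<bar>)"
    proof (rule integral_dominated_convergence[where w="\<lambda>x. 2 * norm (\<omega> k x * d x)"])
      have "(\<lambda>x. \<bar>\<omega> k x * d x\<bar>) \<in> borel_measurable ?M"
        using borel_measurable_integrable[OF i] by measurable
      then show "(\<lambda>x. \<omega> k x * \<bar>d x\<bar>) \<in> borel_measurable ?M"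
        using \<omega>(1) by (simp add: abs_mult)
      show "AE x in ?M. (\<lambda>n. \<omega> k x * p n x * d x) \<longlonglongrightarrow> \<omega> k x * \<bar>d x\<bar>"
        using p(2)
      proof eventually_elim
        case (elim x)
        then have "(\<lambda>n. \<omega> k x * p n x * d x) \<longlonglongrightarrow> \<omega> k x * sgn (d x) * d x"
          by (intro tendsto_intros)
        then show ?case by (simp add: abs_sgn mult_ac)
      qed
      show "AE x in ?M. norm (\<omega> k x * p n x * d x) \<le> 2 * norm (\<omega> k x * d x)" for n
      proof (rule AE_I2)
        fix x assume "x \<in> space ?M"
        then have "\<bar>p n x\<bar> \<le> 2" using p(1) by (simp add: space_restrict_space)
        from mult_right_mono[OF this, of "\<bar>\<omega> k x * d x\<bar>"]
        show "norm (\<omega> k x * p n x * d x) \<le> 2 * norm (\<omega> k x * d x)" by (simp add: abs_mult mult_ac)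
      qed
    qed (use i i' in auto)
    moreover have "integral\<^sup>L ?M (\<lambda>x. \<omega> k x * p n x * d x) = 0" for n
      using zero[OF t[of "p n"]] p(1) by simp
    ultimately have "integral\<^sup>L ?M (\<lambda>x. \<omega> k x * \<bar>d x\<bar>) = 0" by (simp add: LIMSEQ_const_iff)
    moreover have "integrable ?M (\<lambda>x. \<omega> k x * \<bar>d x\<bar>)"
      using integrable_norm[OF i] \<omega>(1) by (simp add: abs_mult)
    ultimately show ?thesis
      using integral_nonneg_eq_0_iff_AE[of ?M "\<lambda>x. \<omega> k x * \<bar>d x\<bar>"] \<omega>(1) by simp
  qed
  then have "AE x in ?M. \<forall>k. \<omega> k x * \<bar>d x\<bar> = 0" by (simp only: AE_all_countable simp_thms)
  then show ?thesis using AE_space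
  proof eventually_elim
    case (elim x)
    then have "(\<lambda>k. \<omega> k x) \<longlonglongrightarrow> 1" using \<omega>(2) by (simp add: space_restrict_space)
    then have "(\<lambda>k. \<omega> k x * \<bar>d x\<bar>) \<longlonglongrightarrow> 1 * \<bar>d x\<bar>" by (intro tendsto_intros)
    then show ?case using elim(1) by (simp add: LIMSEQ_const_iff)
  qed
qed

lemma has_weak_deriv_unique:
  fixes f :: "'a::euclidean_space \<Rightarrow> 'b::euclidean_space"
  assumes S: "open S" "bounded S" "convex S" "S \<noteq> {}"
    and g: "has_weak_deriv S b f g" and h: "has_weak_deriv S b f h"
  shows "AE x in lebesgue_on S. g x = h x"
proof -
  let ?M = "lebesgue_on S"
  have Sm: "S \<in> sets lebesgue" using S(1) by auto
  have lg: "locally_integrable_on g S" and lh: "locally_integrable_on h S"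
    using g h by (auto simp: has_weak_deriv_def)
  have "AE x in ?M. (g x - h x) \<bullet> c = 0" for c
  proof (rule zero_of_zero_against_test_functions[OF S])
    show "locally_integrable_on (\<lambda>x. (g x - h x) \<bullet> c) S"
      unfolding locally_integrable_on_def
    proof safe
      fix K assume "compact K" "K \<subseteq> S"
      then have "integrable lebesgue (\<lambda>x. (indicator K x *\<^sub>R g x - indicator K x *\<^sub>R h x) \<bullet> c)"
        using lg lh unfolding locally_integrable_on_def set_integrable_def
        by (intro integrable_inner_left Bochner_Integration.integrable_diff) auto
      then show "set_integrable lebesgue K (\<lambda>x. (g x - h x) \<bullet> c)"
        unfolding set_integrable_def by (simp add: inner_diff_left algebra_simps)
    qed
    fix \<phi> assume \<phi>: "test_function S \<phi>"
    have ig: "integrable ?M (\<lambda>x. \<phi> x *\<^sub>R g x)" and ih: "integrable ?M (\<lambda>x. \<phi> x *\<^sub>R h x)"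
      using test_function_integrable[OF S(1) _ \<phi>] lg lh by blast+
    have "integral\<^sup>L ?M (\<lambda>x. \<phi> x *\<^sub>R g x) = integral\<^sup>L ?M (\<lambda>x. \<phi> x *\<^sub>R h x)"
    proof -
      have "- integral\<^sup>L ?M (\<lambda>x. \<phi> x *\<^sub>R g x) = (LINT x:S|lebesgue. frechet_derivative \<phi> (at x) b *\<^sub>R f x)"
        using g \<phi> by (simp add: has_weak_deriv_def set_integral_lebesgue_on[OF Sm])
      also have "\<dots> = - integral\<^sup>L ?M (\<lambda>x. \<phi> x *\<^sub>R h x)"
        using h \<phi> by (simp add: has_weak_deriv_def set_integral_lebesgue_on[OF Sm])
      finally show ?thesis by simp
    qed
    then have "integral\<^sup>L ?M (\<lambda>x. (\<phi> x *\<^sub>R g x - \<phi> x *\<^sub>R h x) \<bullet> c) = 0"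
      using ig ih by (subst integral_inner_left) auto
    then show "integral\<^sup>L ?M (\<lambda>x. \<phi> x * ((g x - h x) \<bullet> c)) = 0"
      by (simp add: inner_diff_left algebra_simps)
  qed
  then have "AE x in ?M. \<forall>c\<in>Basis. (g x - h x) \<bullet> c = 0" by (simp add: AE_finite_all)
  then show ?thesis
  proof eventually_elim
    case (elim x)
    then have "g x - h x = 0" by (subst euclidean_all_zero_iff[symmetric]) simp
    then show ?case by simp
  qed
qed

section \<open>Bounded functions and Sobolev functions\<close>

lemma Linf_norm_bound_AE: "Linf_norm S f \<le> ereal B \<Longrightarrow> AE x in lebesgue_on S. norm (f x) \<le> B"
proof -
  assume *: "Linf_norm S f \<le> ereal B"
  have "AE x in lebesgue_on S. ereal (norm (f x)) \<le> Linf_norm S f"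
    unfolding Linf_norm_def by (rule esssup_AE)
  then show ?thesis
  proof eventually_elim
    case (elim x)
    then have "ereal (norm (f x)) \<le> ereal B" using * by (rule order_trans)
    then show ?case by simp
  qed
qed

lemma Linf_norm_leI:
  assumes "f \<in> borel_measurable (lebesgue_on S)" "AE x in lebesgue_on S. norm (f x) \<le> B"
  shows "Linf_norm S f \<le> ereal B"
  unfolding Linf_norm_def using assms by (intro esssup_I) auto

lemma Linf_iff:
  "f \<in> Linf S \<longleftrightarrow> f \<in> borel_measurable (lebesgue_on S) \<and> (\<exists>B. AE x in lebesgue_on S. norm (f x) \<le> B)"
proof safe
  assume f: "f \<in> Linf S"
  then show "f \<in> borel_measurable (lebesgue_on S)" by (simp add: Linf_def)
  have "Linf_norm S f \<noteq> \<infinity>" using f by (simp add: Linf_def)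
  then have "Linf_norm S f \<le> ereal (max 0 (real_of_ereal (Linf_norm S f)))"
    by (cases "Linf_norm S f") auto
  then show "\<exists>B. AE x in lebesgue_on S. norm (f x) \<le> B" using Linf_norm_bound_AE by blast
next
  fix B assume "f \<in> borel_measurable (lebesgue_on S)" "AE x in lebesgue_on S. norm (f x) \<le> B"
  then show "f \<in> Linf S" using Linf_norm_leI[of f S B] by (auto simp: Linf_def)
qed

lemma Linf_norm_nonneg:
  assumes "open S" "S \<noteq> {}"
  shows "0 \<le> Linf_norm S f"
proof (rule ccontr)
  assume "\<not> ?thesis"
  then have neg: "Linf_norm S f < 0" by simp
  have "AE x in lebesgue_on S. ereal (norm (f x)) \<le> Linf_norm S f"
    unfolding Linf_norm_def by (rule esssup_AE)
  then have "AE x in lebesgue_on S. False"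
  proof eventually_elim
    case (elim x)
    then have "ereal (norm (f x)) < 0" using neg by (rule le_less_trans)
    then show ?case by simp
  qed
  then have "AE x in lebesgue. x \<notin> S" using assms(1) by (simp add: AE_lebesgue_on_iff)
  then have "negligible S"
    using assms(1) by (simp add: AE_iff_null_sets negligible_iff_null_sets)
  then show False using assms open_not_negligible by blast
qed

text \<open>The derivative chosen by \<open>weak_deriv\<close> need not be the bounded one that membership in the Sobolev
  space provides, but a finite norm bounds the chosen one directly.\<close>

lemma weak_deriv_bound_of_W1inf_norm:
  assumes "open S" "S \<noteq> {}" "W1inf_norm S f \<le> ereal M" "b \<in> Basis"
  shows "AE x in lebesgue_on S. norm (weak_deriv S b f x) \<le> M"
proof (rule Linf_norm_bound_AE)
  have "Linf_norm S (weak_deriv S b f) \<le> (\<Sum>b\<in>Basis. Linf_norm S (weak_deriv S b f))"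
    using assms(4) Linf_norm_nonneg[OF assms(1,2)]
    by (subst sum.remove[OF finite_Basis assms(4)]) (auto intro!: add_increasing2 sum_nonneg)
  also have "\<dots> \<le> W1inf_norm S f"
    unfolding W1inf_norm_def using Linf_norm_nonneg[OF assms(1,2), of f] by (simp add: ereal_le_add_self2)
  finally show "Linf_norm S (weak_deriv S b f) \<le> ereal M" using assms(3) by order
qed

lemma has_weak_deriv_weak_deriv:
  assumes "has_weak_deriv S b f g"
  shows "has_weak_deriv S b f (weak_deriv S b f)"
  unfolding weak_deriv_def using someI[of "has_weak_deriv S b f", OF assms] .

lemma weak_deriv_AE_eq:
  assumes "open S" "bounded S" "convex S" "S \<noteq> {}" "has_weak_deriv S b f g"
  shows "AE x in lebesgue_on S. weak_deriv S b f x = g x"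
  using has_weak_deriv_unique[OF assms(1-4) has_weak_deriv_weak_deriv[OF assms(5)] assms(5)] .

text \<open>By uniqueness the chosen weak derivative inherits the bound of the one given by membership.\<close>

lemma sobolev_weak_deriv:
  assumes S: "open S" "bounded S" "convex S" "S \<noteq> {}" and f: "f \<in> sobolev_W1inf S" and b: "b \<in> Basis"
  shows "has_weak_deriv S b f (weak_deriv S b f)" "weak_deriv S b f \<in> Linf S"
proof -
  obtain g where g: "g \<in> Linf S" "has_weak_deriv S b f g"
    using f b by (auto simp: sobolev_W1inf_def)
  show hw: "has_weak_deriv S b f (weak_deriv S b f)" by (rule has_weak_deriv_weak_deriv[OF g(2)])
  obtain B where "AE x in lebesgue_on S. norm (g x) \<le> B" using g(1) by (auto simp: Linf_iff)
  with weak_deriv_AE_eq[OF S g(2)] have "AE x in lebesgue_on S. norm (weak_deriv S b f x) \<le> B"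
    by eventually_elim simp
  moreover have "weak_deriv S b f \<in> borel_measurable (lebesgue_on S)"
    using hw S(1) by (intro locally_integrable_imp_measurable) (auto simp: has_weak_deriv_def)
  ultimately show "weak_deriv S b f \<in> Linf S" by (auto simp: Linf_iff)
qed

section \<open>Outer normals of a smooth convex domain\<close>

lemma frechet_derivative_eq_grad:
  fixes f :: "real^'n \<Rightarrow> real"
  assumes "f differentiable (at x)"
  shows "frechet_derivative f (at x) h = grad f x \<bullet> h"
proof -
  have lin: "linear (frechet_derivative f (at x))" by (rule linear_frechet_derivative[OF assms])
  have "frechet_derivative f (at x) h = frechet_derivative f (at x) (\<Sum>i\<in>UNIV. h $ i *\<^sub>R axis i 1)"
    using basis_expansion[of h] by (simp add: scalar_mult_eq_scaleR)
  also have "\<dots> = (\<Sum>i\<in>UNIV. h $ i * frechet_derivative f (at x) (axis i 1))"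
    by (simp add: linear_sum[OF lin] linear_scale[OF lin])
  also have "\<dots> = grad f x \<bullet> h" by (simp add: grad_def inner_vec_def mult.commute)
  finally show ?thesis .
qed

text \<open>Every vector of the normal cone of \<open>\<Omega>\<close> at a boundary point is a multiple of the outer normal:
  a direction that decreases the defining function points into \<open>\<Omega>\<close>.\<close>

lemma normal_cone_subset_span_outer_normal:
  fixes \<Omega> :: "(real^'n) set"
  assumes dom: "smooth_bounded_convex_domain \<Omega>" and x: "x \<in> frontier \<Omega>"
    and q: "\<forall>y\<in>\<Omega>. q \<bullet> (y - x) \<le> 0"
  shows "\<exists>c. q = c *\<^sub>R outer_normal \<Omega> x"
proof -
  have "\<exists>\<nu>. \<exists>U \<rho>. defining_function \<Omega> x U \<rho> \<and> \<nu> = grad \<rho> x /\<^sub>R norm (grad \<rho> x)"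
    using dom x unfolding smooth_bounded_convex_domain_def by blast
  then have "\<exists>U \<rho>. defining_function \<Omega> x U \<rho> \<and> outer_normal \<Omega> x = grad \<rho> x /\<^sub>R norm (grad \<rho> x)"
    unfolding outer_normal_def by (rule someI_ex)
  then obtain U \<rho> where d: "defining_function \<Omega> x U \<rho>"
    and n: "outer_normal \<Omega> x = grad \<rho> x /\<^sub>R norm (grad \<rho> x)" by blast
  define g where "g = grad \<rho> x"
  have U: "open U" "x \<in> U" "g \<noteq> 0" "\<Omega> \<inter> U = {y\<in>U. \<rho> y < 0}" and sm: "smooth_on U \<rho>"
    using d by (auto simp: defining_function_def g_def)
  have diff: "\<rho> differentiable (at x)"
    using sm U(2) Cinf_on_differentiable unfolding smooth_on_def by blast
  have D: "(\<rho> has_derivative (\<lambda>h. g \<bullet> h)) (at x)"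
    using diff frechet_derivative_eq_grad[OF diff] unfolding g_def
    by (metis (no_types, lifting) ext frechet_derivative_works)
  have "open \<Omega>" using dom by (simp add: smooth_bounded_convex_domain_def)
  then have "x \<notin> \<Omega>" using x by (simp add: frontier_def interior_open)
  then have "x \<notin> {y\<in>U. \<rho> y < 0}" unfolding U(4)[symmetric] by simp
  then have "\<rho> x \<ge> 0" using U(2) by simp
  moreover have "\<rho> x \<le> 0"
  proof (rule ccontr)
    assume "\<not> \<rho> x \<le> 0"
    then have "eventually (\<lambda>y. \<rho> y > 0) (nhds x)"
      using order_tendstoD(1)[of \<rho> "\<rho> x" "nhds x" 0] differentiable_imp_continuous_within[OF diff]
      by (simp add: continuous_within tendsto_at_iff_tendsto_nhds)
    moreover have "eventually (\<lambda>y. y \<in> U) (nhds x)" using U by (simp add: eventually_nhds_in_open)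
    ultimately have "eventually (\<lambda>y. y \<in> U \<and> \<rho> y > 0) (nhds x)" by eventually_elim simp
    then obtain V where V: "open V" "x \<in> V" "\<forall>y\<in>V. y \<in> U \<and> \<rho> y > 0" unfolding eventually_nhds by blast
    have "x \<in> closure \<Omega>" using x by (simp add: frontier_def)
    then have "\<Omega> \<inter> V \<noteq> {}" using V open_Int_closure_eq_empty[of V \<Omega>] by blast
    then obtain y where y: "y \<in> \<Omega>" "y \<in> V" by blast
    then have "y \<in> {y\<in>U. \<rho> y < 0}" unfolding U(4)[symmetric] using V(3) by simp
    then show False using V(3) y(2) by force
  qed
  ultimately have \<rho>0: "\<rho> x = 0" by simp
  have inward: "q \<bullet> e \<le> 0" if "g \<bullet> e < 0" for e
  proof -
    have "((\<lambda>t. \<rho> (x + t *\<^sub>R e)) has_real_derivative (g \<bullet> e)) (at 0)"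
      using has_real_derivative_along_line[of \<rho> x 0 e] diff frechet_derivative_eq_grad[OF diff, of e]
      by (simp add: g_def)
    from DERIV_neg_dec_right[OF this that]
    obtain d where d: "d > 0" "\<forall>h>0. h < d \<longrightarrow> \<rho> (x + h *\<^sub>R e) < \<rho> x" by auto
    have "((\<lambda>t. x + t *\<^sub>R e) \<longlongrightarrow> x + 0 *\<^sub>R e) (at_right 0)" by (intro tendsto_intros)
    then have "eventually (\<lambda>t. x + t *\<^sub>R e \<in> U) (at_right 0)"
      using topological_tendstoD[OF _ U(1)] U(2) by auto
    moreover have "eventually (\<lambda>t. 0 < t \<and> t < d) (at_right (0::real))"
      using d(1) by (auto simp: eventually_at_right_field)
    ultimately have "eventually (\<lambda>t. x + t *\<^sub>R e \<in> U \<and> 0 < t \<and> t < d) (at_right (0::real))"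
      by eventually_elim simp
    then obtain t where t: "x + t *\<^sub>R e \<in> U" "0 < t" "t < d"
      using eventually_happens'[OF trivial_limit_at_right_real] by blast
    then have "\<rho> (x + t *\<^sub>R e) < 0" using d(2) \<rho>0 by auto
    then have "x + t *\<^sub>R e \<in> \<Omega>" using t(1) U(4) by blast
    then have "q \<bullet> ((x + t *\<^sub>R e) - x) \<le> 0" using q by blast
    then show ?thesis using t(2) by (simp add: mult_le_0_iff)
  qed
  \<comment> \<open>The component of \<open>q\<close> orthogonal to \<open>g\<close>, tilted inwards by \<open>-e g\<close>, is an admissible direction.\<close>
  define p where "p = q - ((q \<bullet> g) / (g \<bullet> g)) *\<^sub>R g"
  have gg: "g \<bullet> g > 0" using U(3) by simp
  have gp: "g \<bullet> p = 0" using gg by (simp add: p_def inner_diff_right inner_commute)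
  have qp: "q \<bullet> p = p \<bullet> p"
  proof -
    have "p \<bullet> p = q \<bullet> p - ((q \<bullet> g) / (g \<bullet> g)) * (g \<bullet> p)"
      unfolding p_def by (simp add: inner_diff_left)
    then show ?thesis using gp by simp
  qed
  have le: "p \<bullet> p \<le> e * (q \<bullet> g)" if "e > 0" for e
  proof -
    have "g \<bullet> (p - e *\<^sub>R g) < 0" using gp gg that by (simp add: inner_diff_right)
    from inward[OF this] show ?thesis using qp by (simp add: inner_diff_right)
  qed
  have "p \<bullet> p \<le> 0"
  proof (rule field_le_epsilon)
    fix e :: real assume "e > 0"
    then have "p \<bullet> p \<le> e / (\<bar>q \<bullet> g\<bar> + 1) * (q \<bullet> g)" by (intro le) (simp add: add_nonneg_pos)
    also have "\<dots> \<le> e / (\<bar>q \<bullet> g\<bar> + 1) * (\<bar>q \<bullet> g\<bar> + 1)"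
      using \<open>e > 0\<close> by (intro mult_left_mono) auto
    also have "\<dots> = e" by (simp add: add_nonneg_pos less_imp_neq[symmetric])
    finally show "p \<bullet> p \<le> 0 + e" by simp
  qed
  then have "p \<bullet> p = 0" using inner_ge_zero[of p] by linarith
  then have "p = 0" by simp
  define c where "c = (q \<bullet> g) / (g \<bullet> g)"
  have "q = c *\<^sub>R g" using \<open>p = 0\<close> by (simp add: p_def c_def)
  moreover have "g = norm g *\<^sub>R outer_normal \<Omega> x" using U(3) by (simp add: n g_def[symmetric])
  from arg_cong[OF this, of "\<lambda>w. c *\<^sub>R w"]
  have "c *\<^sub>R g = (c * norm g) *\<^sub>R outer_normal \<Omega> x" by (simp only: scaleR_scaleR)
  ultimately show ?thesis by (metis (no_types))
qed

section \<open>The weak form of \<open>u\<^sub>t = div v\<^sub>t\<close>\<close>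

lemma has_weak_deriv_component:
  fixes v :: "'a::euclidean_space \<Rightarrow> real^'n"
  assumes "open S" "has_weak_deriv S b v g" "test_function S \<phi>"
  shows "integrable (lebesgue_on S) (\<lambda>z. \<phi> z * g z $ i)"
    and "integral\<^sup>L (lebesgue_on S) (\<lambda>z. \<phi> z * g z $ i) =
       - integral\<^sup>L (lebesgue_on S) (\<lambda>z. frechet_derivative \<phi> (at z) b * v z $ i)"
    and "integrable (lebesgue_on S) (\<lambda>z. \<phi> z * v z $ i)"
proof -
  let ?M = "lebesgue_on S"
  have Sm: "S \<in> sets lebesgue" using assms(1) by auto
  have l: "locally_integrable_on v S" "locally_integrable_on g S"
    and eq: "integral\<^sup>L ?M (\<lambda>z. frechet_derivative \<phi> (at z) b *\<^sub>R v z) = - integral\<^sup>L ?M (\<lambda>z. \<phi> z *\<^sub>R g z)"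
    using assms(2,3) by (auto simp: has_weak_deriv_def set_integral_lebesgue_on[OF Sm])
  have i: "integrable ?M (\<lambda>z. \<phi> z *\<^sub>R g z)" "integrable ?M (\<lambda>z. \<phi> z *\<^sub>R v z)"
    "integrable ?M (\<lambda>z. frechet_derivative \<phi> (at z) b *\<^sub>R v z)"
    using test_function_integrable[OF assms(1)] l assms(3) test_function_deriv[OF assms(3)] by blast+
  have c: "(r *\<^sub>R w) \<bullet> axis i 1 = r * w $ i" for r and w :: "real^'n"
    by (simp add: inner_axis)
  show "integrable ?M (\<lambda>z. \<phi> z * g z $ i)" "integrable ?M (\<lambda>z. \<phi> z * v z $ i)"
    unfolding c[symmetric] by (intro integrable_inner_left i)+
  have "integral\<^sup>L ?M (\<lambda>z. \<phi> z *\<^sub>R g z) \<bullet> axis i 1 = integral\<^sup>L ?M (\<lambda>z. \<phi> z * g z $ i)"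
    unfolding c[symmetric] by (rule integral_inner_left[symmetric]) (rule i(1))
  moreover have "integral\<^sup>L ?M (\<lambda>z. frechet_derivative \<phi> (at z) b *\<^sub>R v z) \<bullet> axis i 1 =
      integral\<^sup>L ?M (\<lambda>z. frechet_derivative \<phi> (at z) b * v z $ i)"
    unfolding c[symmetric] by (rule integral_inner_left[symmetric]) (rule i(3))
  ultimately show "integral\<^sup>L ?M (\<lambda>z. \<phi> z * g z $ i) =
       - integral\<^sup>L ?M (\<lambda>z. frechet_derivative \<phi> (at z) b * v z $ i)"
    unfolding eq by simp
qed

text \<open>Since the derivatives of a test function commute, \<open>\<integral> v\<^sub>t \<bullet> D\<Psi> = - \<integral> v \<bullet> D\<Psi>\<^sub>t = \<integral> div v \<Psi>\<^sub>t\<close>.\<close>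

lemma flux_equation_test_functions:
  fixes v :: "(real^'n) \<times> real \<Rightarrow> real^'n" and u :: "(real^'n) \<times> real \<Rightarrow> real"
  assumes "open S" and u: "locally_integrable_on u S"
    and t: "has_weak_deriv S (0, 1) v (Dt S v)"
    and x: "\<And>i. has_weak_deriv S (axis i 1, 0) v (weak_deriv S (axis i 1, 0) v)"
    and div: "AE z in lebesgue_on S. divx S v z = u z"
    and \<Psi>: "test_function S \<Psi>"
  shows "(\<Sum>i\<in>UNIV. integral\<^sup>L (lebesgue_on S) (\<lambda>z. frechet_derivative \<Psi> (at z) (axis i 1, 0) * Dt S v z $ i)) =
    integral\<^sup>L (lebesgue_on S) (\<lambda>z. frechet_derivative \<Psi> (at z) (0, 1) * u z)"
proof -
  let ?M = "lebesgue_on S"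
  let ?e = "\<lambda>i::'n. (axis i 1, 0) :: (real^'n) \<times> real"
  let ?D = "\<lambda>b z. frechet_derivative \<Psi> (at z) b"
  let ?w = "\<lambda>i. weak_deriv S (?e i) v"
  have C: "Cinf_on UNIV \<Psi>" using \<Psi> by (simp add: test_function_iff)
  have "integral\<^sup>L ?M (\<lambda>z. ?D (?e i) z * Dt S v z $ i) = integral\<^sup>L ?M (\<lambda>z. ?D (0, 1) z * ?w i z $ i)" for i
    using has_weak_deriv_component(2)[OF assms(1) t test_function_deriv[OF \<Psi>, of "?e i"], of i]
      has_weak_deriv_component(2)[OF assms(1) x test_function_deriv[OF \<Psi>, of "(0, 1)"], of i i]
      mixed_derivatives_commute[OF open_UNIV C UNIV_I, of "?e i" _ "(0, 1)"] by simp
  then have "(\<Sum>i\<in>UNIV. integral\<^sup>L ?M (\<lambda>z. ?D (?e i) z * Dt S v z $ i)) =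
      (\<Sum>i\<in>UNIV. integral\<^sup>L ?M (\<lambda>z. ?D (0, 1) z * ?w i z $ i))" by simp
  also have "\<dots> = integral\<^sup>L ?M (\<lambda>z. \<Sum>i\<in>UNIV. ?D (0, 1) z * ?w i z $ i)"
    using has_weak_deriv_component(1)[OF assms(1) x test_function_deriv[OF \<Psi>, of "(0, 1)"]]
    by (subst Bochner_Integration.integral_sum) auto
  also have "\<dots> = integral\<^sup>L ?M (\<lambda>z. ?D (0, 1) z * u z)"
  proof (rule integral_cong_AE)
    show "(\<lambda>z. \<Sum>i\<in>UNIV. ?D (0, 1) z * ?w i z $ i) \<in> borel_measurable ?M"
      using has_weak_deriv_component(1)[OF assms(1) x test_function_deriv[OF \<Psi>, of "(0, 1)"]]
      by (intro borel_measurable_sum borel_measurable_integrable)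
    show "(\<lambda>z. ?D (0, 1) z * u z) \<in> borel_measurable ?M"
      using test_function_integrable[OF assms(1) u test_function_deriv[OF \<Psi>, of "(0, 1)"]] by simp
    show "AE z in ?M. (\<Sum>i\<in>UNIV. ?D (0, 1) z * ?w i z $ i) = ?D (0, 1) z * u z"
      using div by eventually_elim (simp add: divx_def sum_distrib_left[symmetric])
  qed
  finally show ?thesis .
qed

lemma product_test_function:
  fixes \<Omega> :: "'a::euclidean_space set"
  assumes \<omega>: "test_function \<Omega> \<omega>"
    and \<theta>: "Cinf_on UNIV \<theta>" "\<And>t::real. \<theta> t \<noteq> 0 \<Longrightarrow> t \<in> {\<alpha>..\<beta>}" "{\<alpha>..\<beta>} \<subseteq> I"
    and \<zeta>: "open U" "\<Omega> \<times> I \<subseteq> U" "Cinf_on U \<zeta>"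
  shows "test_function (\<Omega> \<times> I) (\<lambda>z. \<omega> (fst z) * \<theta> (snd z) * \<zeta> z)"
proof (rule test_function_cutoff_mult[OF _ \<zeta>])
  have \<omega>': "Cinf_on UNIV \<omega>" "compact (closure {x. \<omega> x \<noteq> 0})" "closure {x. \<omega> x \<noteq> 0} \<subseteq> \<Omega>"
    using \<omega> by (simp_all add: test_function_iff)
  have "Ck_on k UNIV (\<lambda>z::'a\<times>real. \<omega> (fst z))" "Ck_on k UNIV (\<lambda>z::'a\<times>real. \<theta> (snd z))" for k
    using \<omega>'(1) \<theta>(1) by (auto intro!: Ck_on_compose_linear[OF open_UNIV bounded_linear_fst, of k UNIV \<omega>]
      Ck_on_compose_linear[OF open_UNIV bounded_linear_snd, of k UNIV \<theta>])
  then have "Cinf_on UNIV (\<lambda>z::'a\<times>real. \<omega> (fst z) * \<theta> (snd z))" by (auto intro!: Ck_on_mult)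
  moreover
  let ?K = "closure {x. \<omega> x \<noteq> 0} \<times> {\<alpha>..\<beta>}"
  have cK: "compact ?K" using \<omega>'(2) by (intro compact_Times) auto
  have sub: "{z. \<omega> (fst z) * \<theta> (snd z) \<noteq> 0} \<subseteq> ?K"
    using \<theta>(2) closure_subset[of "{x. \<omega> x \<noteq> 0}"] by fastforce
  then have cl: "closure {z. \<omega> (fst z) * \<theta> (snd z) \<noteq> 0} \<subseteq> ?K"
    using cK by (simp add: closure_minimal compact_imp_closed)
  then have "closure {z. \<omega> (fst z) * \<theta> (snd z) \<noteq> 0} \<subseteq> \<Omega> \<times> I" using \<omega>'(3) \<theta>(3) by blast
  moreover have "compact (closure {z. \<omega> (fst z) * \<theta> (snd z) \<noteq> 0})"
    using bounded_subset[OF compact_imp_bounded[OF cK] cl] by (simp add: compact_eq_bounded_closed)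
  ultimately show "test_function (\<Omega> \<times> I) (\<lambda>z. \<omega> (fst z) * \<theta> (snd z))" by (simp add: test_function_iff)
qed

lemma product_test_function_derivative:
  fixes \<omega> :: "'a::euclidean_space \<Rightarrow> real"
  assumes "(\<omega> has_derivative (\<lambda>b. G \<bullet> b)) (at (fst z))"
    and "(\<theta> has_real_derivative \<theta>') (at (snd z))" and "\<zeta> differentiable (at z)"
  shows "frechet_derivative (\<lambda>z. \<omega> (fst z) * \<theta> (snd z) * \<zeta> z) (at z) b =
     (G \<bullet> fst b) * \<theta> (snd z) * \<zeta> z + \<omega> (fst z) * (\<theta>' * snd b) * \<zeta> z +
      \<omega> (fst z) * \<theta> (snd z) * frechet_derivative \<zeta> (at z) b"
proof -
  have 1: "((\<lambda>z. \<omega> (fst z)) has_derivative (\<lambda>b. G \<bullet> fst b)) (at z)"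
    by (rule has_derivative_compose[where g=\<omega>, OF has_derivative_fst[OF has_derivative_ident] assms(1)])
  have "(\<theta> has_derivative (\<lambda>b. \<theta>' * b)) (at (snd z))" using assms(2) by (simp add: has_field_derivative_def)
  then have 2: "((\<lambda>z. \<theta> (snd z)) has_derivative (\<lambda>b. \<theta>' * snd b)) (at z)"
    by (rule has_derivative_compose[where g=\<theta>, OF has_derivative_snd[OF has_derivative_ident]])
  have 3: "(\<zeta> has_derivative frechet_derivative \<zeta> (at z)) (at z)"
    using assms(3) frechet_derivative_works by blast
  have "((\<lambda>z. \<omega> (fst z) * \<theta> (snd z) * \<zeta> z) has_derivative
     (\<lambda>b. \<omega> (fst z) * \<theta> (snd z) * frechet_derivative \<zeta> (at z) b +
       (\<omega> (fst z) * (\<theta>' * snd b) + (G \<bullet> fst b) * \<theta> (snd z)) * \<zeta> z)) (at z)"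
    by (intro has_derivative_mult 1 2 3)
  from frechet_derivative_at[OF this, symmetric] show ?thesis by (simp add: algebra_simps)
qed

text \<open>The cutoff \<open>\<omega>\<close> costs only the term with \<open>v \<bullet> D\<omega>\<close>; the time derivative has been moved from
  \<open>v\<^sub>t \<bullet> D\<omega>\<close> to the test function.\<close>

lemma flux_equation_cutoff:
  fixes v :: "(real^'n) \<times> real \<Rightarrow> real^'n" and u :: "(real^'n) \<times> real \<Rightarrow> real" and \<Omega> :: "(real^'n) set" and T :: real
  assumes S_def: "S = \<Omega> \<times> {0<..<T}" and "open \<Omega>" and u: "locally_integrable_on u S"
    and t: "has_weak_deriv S (0, 1) v (Dt S v)"
    and x: "\<And>i. has_weak_deriv S (axis i 1, 0) v (weak_deriv S (axis i 1, 0) v)"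
    and div: "AE z in lebesgue_on S. divx S v z = u z"
    and \<omega>: "test_function \<Omega> \<omega>" "\<And>x. (\<omega> has_derivative (\<lambda>b. G x \<bullet> b)) (at x)"
    and \<theta>: "Cinf_on UNIV \<theta>" "\<And>t::real. \<theta> t \<noteq> 0 \<Longrightarrow> t \<in> {\<alpha>..\<beta>}" "{\<alpha>..\<beta>} \<subseteq> {0<..<T}"
      "\<And>t. (\<theta> has_real_derivative \<theta>' t) (at t)"
    and \<zeta>: "open U" "S \<subseteq> U" "Cinf_on U \<zeta>"
  shows "integral\<^sup>L (lebesgue_on S) (\<lambda>z. \<omega> (fst z) * (\<theta> (snd z) * (Dt S v z \<bullet> classical_Dx \<zeta> z) -
        u z * (\<theta>' (snd z) * \<zeta> z + \<theta> (snd z) * classical_Dt \<zeta> z))) =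
     integral\<^sup>L (lebesgue_on S) (\<lambda>z. (\<theta>' (snd z) * \<zeta> z + \<theta> (snd z) * classical_Dt \<zeta> z) * (v z \<bullet> G (fst z)))"
proof -
  let ?M = "lebesgue_on S"
  let ?e = "\<lambda>i::'n. (axis i 1, 0) :: (real^'n) \<times> real"
  have opS: "open S" unfolding S_def using assms(2) by (auto intro: open_Times)
  define \<Psi> where "\<Psi> z = \<omega> (fst z) * \<theta> (snd z) * \<zeta> z" for z
  define \<phi> where "\<phi> i z = frechet_derivative \<omega> (at (fst z)) (axis i 1) * \<theta> (snd z) * \<zeta> z" for i z
  have \<Psi>: "test_function S \<Psi>"
    unfolding \<Psi>_def[abs_def] S_def
    by (rule product_test_function[OF \<omega>(1) \<theta>(1-3) \<zeta>(1) _ \<zeta>(3)]) (use \<zeta>(2) in \<open>auto simp: S_def\<close>)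
  have Gi: "frechet_derivative \<omega> (at x) b = G x \<bullet> b" for x b
    using frechet_derivative_at[OF \<omega>(2)[of x], symmetric] by simp
  have \<phi>: "test_function S (\<phi> i)" for i
    unfolding \<phi>_def[abs_def] S_def
    by (rule product_test_function[OF test_function_deriv[OF \<omega>(1)] \<theta>(1-3) \<zeta>(1) _ \<zeta>(3)]) (use \<zeta>(2) in \<open>auto simp: S_def\<close>)
  have \<zeta>d: "\<zeta> differentiable (at z)" if "z \<in> S" for z
    using Cinf_on_differentiable[OF \<zeta>(3)] \<zeta>(2) that by blast
  have D\<Psi>: "frechet_derivative \<Psi> (at z) b = (G (fst z) \<bullet> fst b) * \<theta> (snd z) * \<zeta> z +
      \<omega> (fst z) * (\<theta>' (snd z) * snd b) * \<zeta> z + \<omega> (fst z) * \<theta> (snd z) * frechet_derivative \<zeta> (at z) b"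
    if "z \<in> S" for z b
    unfolding \<Psi>_def[abs_def] by (rule product_test_function_derivative[OF \<omega>(2) \<theta>(4) \<zeta>d[OF that]])
  have D\<phi>: "frechet_derivative (\<phi> i) (at z) (0, 1) =
      G (fst z) $ i * (\<theta>' (snd z) * \<zeta> z + \<theta> (snd z) * classical_Dt \<zeta> z)" if "z \<in> S" for z i
  proof -
    have d: "(\<lambda>x. frechet_derivative \<omega> (at x) (axis i 1)) differentiable (at (fst z))"
      using test_function_deriv[OF \<omega>(1), of "axis i 1"]
      unfolding test_function_iff by (blast intro: Cinf_on_differentiable)
    have "((\<lambda>x. frechet_derivative \<omega> (at x) (axis i 1)) has_derivative
        (\<lambda>b. grad (\<lambda>x. frechet_derivative \<omega> (at x) (axis i 1)) (fst z) \<bullet> b)) (at (fst z))"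
      using d frechet_derivative_eq_grad[OF d] by (metis (no_types, lifting) ext frechet_derivative_works)
    from product_test_function_derivative[OF this \<theta>(4) \<zeta>d[OF that], of "(0, 1)"]
    show ?thesis unfolding \<phi>_def[abs_def]
      by (simp add: Gi inner_axis classical_Dt_def algebra_simps)
  qed
  note a = has_weak_deriv_component[OF opS t test_function_deriv[OF \<Psi>]]
  note b = has_weak_deriv_component[OF opS t \<phi>]
  note c = has_weak_deriv_component(3)[OF opS t test_function_deriv[OF \<phi>]]
  have e: "integrable ?M (\<lambda>z. frechet_derivative \<Psi> (at z) (0, 1) * u z)"
    using test_function_integrable[OF opS u test_function_deriv[OF \<Psi>]] by simp
  let ?a = "\<lambda>i z. frechet_derivative \<Psi> (at z) (?e i) * Dt S v z $ i"
  let ?b = "\<lambda>i z. \<phi> i z * Dt S v z $ i"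
  let ?c = "\<lambda>i z. frechet_derivative (\<phi> i) (at z) (0, 1) * v z $ i"
  have "integral\<^sup>L ?M (\<lambda>z. \<omega> (fst z) * (\<theta> (snd z) * (Dt S v z \<bullet> classical_Dx \<zeta> z) -
        u z * (\<theta>' (snd z) * \<zeta> z + \<theta> (snd z) * classical_Dt \<zeta> z))) =
      integral\<^sup>L ?M (\<lambda>z. (\<Sum>i\<in>UNIV. ?a i z) - (\<Sum>i\<in>UNIV. ?b i z) - frechet_derivative \<Psi> (at z) (0, 1) * u z)"
  proof (rule Bochner_Integration.integral_cong[OF refl])
    fix z assume "z \<in> space ?M"
    then have z: "z \<in> S" by (simp add: space_restrict_space)
    have "(\<Sum>i\<in>UNIV. ?a i z) - (\<Sum>i\<in>UNIV. ?b i z) = (\<Sum>i\<in>UNIV. \<omega> (fst z) * \<theta> (snd z) * (Dt S v z $ i * classical_Dx \<zeta> z $ i))"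
      unfolding sum_subtractf[symmetric] D\<Psi>[OF z] \<phi>_def Gi
      by (intro sum.cong) (auto simp: inner_axis classical_Dx_def algebra_simps)
    also have "\<dots> = \<omega> (fst z) * \<theta> (snd z) * (Dt S v z \<bullet> classical_Dx \<zeta> z)"
      by (simp add: inner_vec_def sum_distrib_left)
    finally show "\<omega> (fst z) * (\<theta> (snd z) * (Dt S v z \<bullet> classical_Dx \<zeta> z) -
        u z * (\<theta>' (snd z) * \<zeta> z + \<theta> (snd z) * classical_Dt \<zeta> z)) =
        (\<Sum>i\<in>UNIV. ?a i z) - (\<Sum>i\<in>UNIV. ?b i z) - frechet_derivative \<Psi> (at z) (0, 1) * u z"
      unfolding D\<Psi>[OF z] by (simp add: classical_Dt_def algebra_simps)
  qed
  also have "\<dots> = (\<Sum>i\<in>UNIV. integral\<^sup>L ?M (?a i)) - (\<Sum>i\<in>UNIV. integral\<^sup>L ?M (?b i)) -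
      integral\<^sup>L ?M (\<lambda>z. frechet_derivative \<Psi> (at z) (0, 1) * u z)"
    using a(1) b(1) e by simp
  also have "\<dots> = - (\<Sum>i\<in>UNIV. integral\<^sup>L ?M (?b i))"
    using flux_equation_test_functions[OF opS u t x div \<Psi>] by simp
  also have "\<dots> = (\<Sum>i\<in>UNIV. integral\<^sup>L ?M (?c i))"
    using b(2) by (simp add: sum_negf)
  also have "\<dots> = integral\<^sup>L ?M (\<lambda>z. \<Sum>i\<in>UNIV. ?c i z)"
    using c by (subst Bochner_Integration.integral_sum) auto
  also have "\<dots> = integral\<^sup>L ?M (\<lambda>z. (\<theta>' (snd z) * \<zeta> z + \<theta> (snd z) * classical_Dt \<zeta> z) * (v z \<bullet> G (fst z)))"
  proof (rule Bochner_Integration.integral_cong[OF refl])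
    fix z assume "z \<in> space ?M"
    then have z: "z \<in> S" by (simp add: space_restrict_space)
    show "(\<Sum>i\<in>UNIV. ?c i z) = (\<theta>' (snd z) * \<zeta> z + \<theta> (snd z) * classical_Dt \<zeta> z) * (v z \<bullet> G (fst z))"
      unfolding D\<phi>[OF z] inner_vec_def sum_distrib_left by (intro sum.cong) (simp_all add: mult_ac)
  qed
  finally show ?thesis .
qed


lemma AE_lebesgue_on_I:
  "S \<subseteq> K \<Longrightarrow> \<forall>z\<in>K. P z \<Longrightarrow> AE z in lebesgue_on S. P z"
  by (rule AE_I2) (auto simp: space_restrict_space)

lemma continuous_on_compact_norm_bound:
  assumes "compact K" "continuous_on K f"
  shows "\<exists>B\<ge>0. \<forall>x\<in>K. norm (f x) \<le> B"
proof -
  obtain B where "\<forall>y\<in>f ` K. norm y \<le> B"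
    using compact_imp_bounded[OF compact_continuous_image[OF assms(2,1)]] by (auto simp: bounded_iff)
  then have "\<forall>x\<in>K. norm (f x) \<le> \<bar>B\<bar>" by fastforce
  then show ?thesis by (intro exI[of _ "\<bar>B\<bar>"]) simp
qed

lemma closure_cylinder_Times:
  fixes \<Omega> :: "'a::euclidean_space set"
  shows "0 < T \<Longrightarrow> closure (\<Omega> \<times> {0<..<T::real}) = closure \<Omega> \<times> {0..T}"
  by (simp add: closure_Times)

lemma classical_derivatives_continuous:
  fixes \<zeta> :: "(real^'n) \<times> real \<Rightarrow> real"
  assumes "Cinf_on U \<zeta>"
  shows "continuous_on U (classical_Dt \<zeta>)" "continuous_on U (classical_Dx \<zeta>)"
  unfolding classical_Dt_def[abs_def] classical_Dx_def[abs_def]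
  by (auto intro!: continuous_on_vec_lambda Cinf_on_continuous Cinf_on_deriv[OF assms])

text \<open>Letting the cutoffs in space tend to \<open>1\<close> removes them, because \<open>v\<close> is tangential.\<close>

lemma flux_equation_cutoff_free:
  fixes v :: "(real^'n) \<times> real \<Rightarrow> real^'n" and u :: "(real^'n) \<times> real \<Rightarrow> real" and \<Omega> :: "(real^'n) set" and T :: real
  assumes S_def: "S = \<Omega> \<times> {0<..<T}" and dom: "open \<Omega>" "bounded \<Omega>" "convex \<Omega>" "\<Omega> \<noteq> {}" "0 < T"
    and u: "continuous_on (closure \<Omega> \<times> {0..T}) u" and v: "continuous_on (closure \<Omega> \<times> {0..T}) v"
    and normal: "\<And>x t q. x \<in> frontier \<Omega> \<Longrightarrow> t \<in> {0..T} \<Longrightarrow> \<forall>y\<in>\<Omega>. q \<bullet> (y - x) \<le> 0 \<Longrightarrow> v (x, t) \<bullet> q = 0"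
    and t: "has_weak_deriv S (0, 1) v (Dt S v)" and tb: "Dt S v \<in> Linf S"
    and x: "\<And>i. has_weak_deriv S (axis i 1, 0) v (weak_deriv S (axis i 1, 0) v)"
    and div: "AE z in lebesgue_on S. divx S v z = u z"
    and \<theta>: "Cinf_on UNIV \<theta>" "\<And>t::real. \<theta> t \<noteq> 0 \<Longrightarrow> t \<in> {\<alpha>..\<beta>}" "{\<alpha>..\<beta>} \<subseteq> {0<..<T}"
      "\<And>t. (\<theta> has_real_derivative \<theta>' t) (at t)" "continuous_on UNIV \<theta>'"
    and \<zeta>: "open U" "closure S \<subseteq> U" "Cinf_on U \<zeta>"
  shows "integral\<^sup>L (lebesgue_on S) (\<lambda>z. \<theta> (snd z) * (Dt S v z \<bullet> classical_Dx \<zeta> z) -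
        u z * (\<theta>' (snd z) * \<zeta> z + \<theta> (snd z) * classical_Dt \<zeta> z)) = 0"
proof -
  let ?M = "lebesgue_on S"
  let ?K = "closure \<Omega> \<times> {0..T}"
  define P :: "(real^'n) \<times> real \<Rightarrow> real" where "P z = \<theta>' (snd z) * \<zeta> z + \<theta> (snd z) * classical_Dt \<zeta> z" for z
  define R :: "(real^'n) \<times> real \<Rightarrow> real" where "R z = \<theta> (snd z) * (Dt S v z \<bullet> classical_Dx \<zeta> z) - u z * P z" for z
  have clS: "closure S = ?K" unfolding S_def using closure_cylinder_Times dom(5) by blast
  have opS: "open S" and bS: "bounded S" unfolding S_def using dom by (auto intro: open_Times bounded_Times)
  have Sm: "S \<in> lmeasurable" using opS bS by (simp add: lmeasurable_open)
  have Ss: "S \<in> sets lebesgue" using opS by auto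
  have SK: "S \<subseteq> ?K" using closure_subset[of S] clS by simp
  have KU: "?K \<subseteq> U" using \<zeta>(2) clS by simp
  have cK: "compact ?K" using dom(2) by (intro compact_Times) auto
  have meas: "f \<in> borel_measurable ?M" if "continuous_on ?K f" for f :: "(real^'n) \<times> real \<Rightarrow> 'b::euclidean_space"
    by (rule continuous_imp_measurable_on_sets_lebesgue[OF continuous_on_subset[OF that SK] Ss])
  have c\<theta>: "continuous_on ?K (\<lambda>z. \<theta> (snd z))" "continuous_on ?K (\<lambda>z. \<theta>' (snd z))"
    using continuous_on_compose2[OF Cinf_on_continuous[OF \<theta>(1)] continuous_on_snd[OF continuous_on_id]]
      continuous_on_compose2[OF \<theta>(5) continuous_on_snd[OF continuous_on_id]] by auto
  have c\<zeta>: "continuous_on ?K \<zeta>" "continuous_on ?K (classical_Dt \<zeta>)" "continuous_on ?K (classical_Dx \<zeta>)"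
    using continuous_on_subset[OF _ KU] Cinf_on_continuous[OF \<zeta>(3)] classical_derivatives_continuous[OF \<zeta>(3)] by blast+
  have cP: "continuous_on ?K P" unfolding P_def[abs_def] by (intro continuous_intros c\<theta> c\<zeta>)
  obtain B1 where B1: "B1 \<ge> 0" "\<forall>z\<in>?K. norm (\<theta> (snd z)) \<le> B1"
    using continuous_on_compact_norm_bound[OF cK c\<theta>(1)] by blast
  obtain B2 where B2: "AE z in ?M. norm (Dt S v z) \<le> B2" and tm: "Dt S v \<in> borel_measurable ?M"
    using tb by (auto simp: Linf_iff)
  obtain B3 where B3: "B3 \<ge> 0" "\<forall>z\<in>?K. norm (classical_Dx \<zeta> z) \<le> B3"
    using continuous_on_compact_norm_bound[OF cK c\<zeta>(3)] by blast
  obtain B4 where B4: "B4 \<ge> 0" "\<forall>z\<in>?K. norm (u z) \<le> B4"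
    using continuous_on_compact_norm_bound[OF cK u] by blast
  obtain C where C: "C \<ge> 0" "\<forall>z\<in>?K. norm (P z) \<le> C"
    using continuous_on_compact_norm_bound[OF cK cP] by blast
  obtain B5 where B5: "B5 \<ge> 0" "\<forall>z\<in>?K. norm (v z) \<le> B5"
    using continuous_on_compact_norm_bound[OF cK v] by blast
  have Rm: "R \<in> borel_measurable ?M"
    unfolding R_def[abs_def] using meas[OF c\<theta>(1)] tm meas[OF c\<zeta>(3)] meas[OF u] meas[OF cP]
    by measurable
  have Rb: "AE z in ?M. norm (R z) \<le> B1 * (B2 * B3) + B4 * C"
    using B2 AE_space
  proof eventually_elim
    case (elim z)
    then have z: "z \<in> ?K" using SK by (auto simp: space_restrict_space)
    have "\<bar>Dt S v z \<bullet> classical_Dx \<zeta> z\<bar> \<le> norm (Dt S v z) * norm (classical_Dx \<zeta> z)"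
      by (rule Cauchy_Schwarz_ineq2)
    also have "\<dots> \<le> B2 * B3" using elim(1) B3 z order_trans[OF norm_ge_zero elim(1)] by (intro mult_mono) auto
    finally have "\<bar>\<theta> (snd z) * (Dt S v z \<bullet> classical_Dx \<zeta> z)\<bar> \<le> B1 * (B2 * B3)"
      unfolding abs_mult using B1 z by (intro mult_mono) auto
    moreover have "\<bar>u z * P z\<bar> \<le> B4 * C" unfolding abs_mult using B4 C z by (intro mult_mono) auto
    ultimately show ?case unfolding R_def real_norm_def by linarith
  qed
  have Ri: "integrable ?M R" by (rule integrable_lebesgue_on_bounded[OF Sm Rm Rb])
  obtain \<omega> G where \<omega>: "\<forall>k::nat. test_function \<Omega> (\<omega> k) \<and>
       (\<forall>x. 0 \<le> \<omega> k x \<and> \<omega> k x \<le> 1 \<and> (\<omega> k has_derivative (\<lambda>b. G k x \<bullet> b)) (at x))"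
     "\<forall>x\<in>\<Omega>. (\<lambda>k. \<omega> k x) \<longlonglongrightarrow> 1"
     "(\<lambda>k. integral\<^sup>L ?M (\<lambda>z. \<bar>v z \<bullet> G k (fst z)\<bar>)) \<longlonglongrightarrow> 0"
  proof -
    have "\<exists>\<omega> G. (\<forall>k::nat. test_function \<Omega> (\<omega> k) \<and>
       (\<forall>x. 0 \<le> \<omega> k x \<and> \<omega> k x \<le> 1 \<and> (\<omega> k has_derivative (\<lambda>b. G k x \<bullet> b)) (at x))) \<and>
     (\<forall>x\<in>\<Omega>. (\<lambda>k. \<omega> k x) \<longlonglongrightarrow> 1) \<and>
     (\<lambda>k. integral\<^sup>L ?M (\<lambda>z. \<bar>v z \<bullet> G k (fst z)\<bar>)) \<longlonglongrightarrow> 0"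
      unfolding S_def by (rule cutoffs_with_vanishing_flux[OF dom v]) (rule normal)
    then show ?thesis by (elim exE conjE) (rule that)
  qed
  have lu: "locally_integrable_on u S"
    by (rule bounded_measurable_imp_locally_integrable[OF Sm meas[OF u], of B4])
      (rule AE_lebesgue_on_I[OF SK B4(2)])
  have eq: "integral\<^sup>L ?M (\<lambda>z. \<omega> k (fst z) * R z) = integral\<^sup>L ?M (\<lambda>z. P z * (v z \<bullet> G k (fst z)))" for k
    unfolding R_def P_def
    by (rule flux_equation_cutoff[OF S_def dom(1) lu t x div _ _ \<theta>(1-4) \<zeta>(1) _ \<zeta>(3)])
      (use \<omega>(1) SK KU in auto)
  have "(\<lambda>k. integral\<^sup>L ?M (\<lambda>z. P z * (v z \<bullet> G k (fst z)))) \<longlonglongrightarrow> 0"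
  proof (rule Lim_null_comparison)
    have "(\<lambda>k. C * integral\<^sup>L ?M (\<lambda>z. \<bar>v z \<bullet> G k (fst z)\<bar>)) \<longlonglongrightarrow> C * 0"
      using \<omega>(3) by (intro tendsto_intros)
    then show "(\<lambda>k. C * integral\<^sup>L ?M (\<lambda>z. \<bar>v z \<bullet> G k (fst z)\<bar>)) \<longlonglongrightarrow> 0" by simp
    show "\<forall>\<^sub>F k in sequentially. norm (integral\<^sup>L ?M (\<lambda>z. P z * (v z \<bullet> G k (fst z)))) \<le>
        C * integral\<^sup>L ?M (\<lambda>z. \<bar>v z \<bullet> G k (fst z)\<bar>)"
    proof (rule always_eventually, rule allI)
      fix k
      have tk: "test_function \<Omega> (\<omega> k)" using \<omega>(1) by blast
      have Geq: "G k x = (\<chi> i. frechet_derivative (\<omega> k) (at x) (axis i 1))" for x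
      proof -
        have "(\<omega> k has_derivative (\<lambda>b. G k x \<bullet> b)) (at x)" using \<omega>(1) by blast
        from frechet_derivative_at[OF this, symmetric] show ?thesis by (simp add: vec_eq_iff inner_axis)
      qed
      have cG: "continuous_on UNIV (G k)" unfolding Geq[abs_def]
        by (intro continuous_on_vec_lambda test_function_continuous[OF test_function_deriv[OF tk]])
      have cG': "continuous_on ?K (\<lambda>z. G k (fst z))"
        using continuous_on_compose2[OF cG continuous_on_fst[OF continuous_on_id]] by auto
      have cvG: "continuous_on ?K (\<lambda>z. v z \<bullet> G k (fst z))" by (intro continuous_intros v cG')
      obtain B where B: "\<forall>z\<in>?K. norm (v z \<bullet> G k (fst z)) \<le> B"
        using continuous_on_compact_norm_bound[OF cK cvG] by blast
      have i: "integrable ?M (\<lambda>z. v z \<bullet> G k (fst z))"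
        by (rule integrable_lebesgue_on_bounded[OF Sm meas[OF cvG], of B])
          (rule AE_lebesgue_on_I[OF SK B])
      have "norm (integral\<^sup>L ?M (\<lambda>z. P z * (v z \<bullet> G k (fst z)))) \<le> integral\<^sup>L ?M (\<lambda>z. norm (P z * (v z \<bullet> G k (fst z))))"
        by (rule integral_norm_bound)
      also have "\<dots> \<le> integral\<^sup>L ?M (\<lambda>z. C * \<bar>v z \<bullet> G k (fst z)\<bar>)"
      proof (rule integral_mono')
        show "integrable ?M (\<lambda>z. C * \<bar>v z \<bullet> G k (fst z)\<bar>)" using i by simp
        show "norm (P z * (v z \<bullet> G k (fst z))) \<le> C * \<bar>v z \<bullet> G k (fst z)\<bar>" if "z \<in> space ?M" for z
        proof -
          have "z \<in> ?K" using that SK by (auto simp: space_restrict_space)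
          then have "\<bar>P z\<bar> \<le> C" using C(2) by auto
          then show ?thesis unfolding real_norm_def abs_mult by (rule mult_right_mono) simp
        qed
        show "0 \<le> C * \<bar>v z \<bullet> G k (fst z)\<bar>" for z using C(1) by simp
      qed
      finally show "norm (integral\<^sup>L ?M (\<lambda>z. P z * (v z \<bullet> G k (fst z)))) \<le>
        C * integral\<^sup>L ?M (\<lambda>z. \<bar>v z \<bullet> G k (fst z)\<bar>)" by simp
    qed
  qed
  moreover have "(\<lambda>k. integral\<^sup>L ?M (\<lambda>z. \<omega> k (fst z) * R z)) \<longlonglongrightarrow> integral\<^sup>L ?M R"
  proof (rule integral_dominated_convergence[where w="\<lambda>z. norm (R z)"])
    show "integrable ?M (\<lambda>z. norm (R z))" using Ri by simp
    show "(\<lambda>z. \<omega> k (fst z) * R z) \<in> borel_measurable ?M" for k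
    proof -
      have "continuous_on UNIV (\<omega> k)" using \<omega>(1) test_function_continuous by blast
      then have "continuous_on ?K (\<lambda>z. \<omega> k (fst z))"
        using continuous_on_compose2[OF _ continuous_on_fst[OF continuous_on_id]] by auto
      from meas[OF this] Rm show ?thesis by (rule borel_measurable_times)
    qed
    show "AE z in ?M. (\<lambda>k. \<omega> k (fst z) * R z) \<longlonglongrightarrow> R z"
    proof (rule AE_I2)
      fix z assume "z \<in> space ?M"
      then have "fst z \<in> \<Omega>" by (auto simp: space_restrict_space S_def)
      then have "(\<lambda>k. \<omega> k (fst z) * R z) \<longlonglongrightarrow> 1 * R z" using \<omega>(2) by (intro tendsto_intros) auto
      then show "(\<lambda>k. \<omega> k (fst z) * R z) \<longlonglongrightarrow> R z" by simp
    qed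
    show "AE z in ?M. norm (\<omega> k (fst z) * R z) \<le> norm (R z)" for k
    proof (rule AE_I2)
      fix z :: "(real^'n) \<times> real"
      have "\<bar>\<omega> k (fst z)\<bar> \<le> 1" using \<omega>(1) by auto
      from mult_right_mono[OF this, of "\<bar>R z\<bar>"] show "norm (\<omega> k (fst z) * R z) \<le> norm (R z)"
        by (simp add: abs_mult)
    qed
  qed (rule Rm)
  ultimately have "integral\<^sup>L ?M R = 0" unfolding eq using LIMSEQ_unique by blast
  then show ?thesis unfolding R_def[abs_def] P_def .
qed

section \<open>Concentration at a fixed time\<close>

lemma integral_product_on_cylinder:
  fixes \<Omega> :: "'a::euclidean_space set" and T :: real and a :: "'a \<Rightarrow> real" and b :: "real \<Rightarrow> real"
  assumes "open \<Omega>" "bounded \<Omega>" "continuous_on (closure \<Omega>) a" "continuous_on {0..T} b"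
  shows "integral\<^sup>L (lebesgue_on (\<Omega> \<times> {0<..<T})) (\<lambda>z. b (snd z) * a (fst z)) =
    integral\<^sup>L (lebesgue_on \<Omega>) a * (LINT t|lborel. b t * indicator {0..T} t)"
proof -
  let ?S = "\<Omega> \<times> {0<..<T}"
  define A where "A x = indicator \<Omega> x *\<^sub>R a x" for x
  define B where "B t = indicator {0<..<T} t *\<^sub>R b t" for t
  have Am: "A \<in> borel_measurable borel" unfolding A_def[abs_def]
    using assms(1) continuous_on_subset[OF assms(3) closure_subset]
    by (intro borel_measurable_continuous_on_indicator) auto
  have Bm: "B \<in> borel_measurable borel" unfolding B_def[abs_def]
    by (intro borel_measurable_continuous_on_indicator continuous_on_subset[OF assms(4)]) auto
  have fm: "(\<lambda>z. A (fst z) * B (snd z)) \<in> borel_measurable (lborel \<Otimes>\<^sub>M lborel)"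
    using Am Bm by measurable
  then have fm': "(\<lambda>z. A (fst z) * B (snd z)) \<in> borel_measurable (lborel :: ('a \<times> real) measure)"
    by (simp add: lborel_prod)
  have opS: "open ?S" "bounded ?S" using assms by (auto intro: open_Times bounded_Times)
  have Sm: "?S \<in> lmeasurable" using opS by (simp add: lmeasurable_open)
  have eq: "A (fst z) * B (snd z) = indicator ?S z *\<^sub>R (b (snd z) * a (fst z))" for z
    by (simp add: A_def B_def indicator_def mem_Times_iff)
  have "continuous_on (closure \<Omega> \<times> {0..T}) (\<lambda>z. b (snd z) * a (fst z))"
    by (intro continuous_intros continuous_on_compose2[OF assms(4) continuous_on_snd[OF continuous_on_id]]
      continuous_on_compose2[OF assms(3) continuous_on_fst[OF continuous_on_id]]) auto
  moreover have "compact (closure \<Omega> \<times> {0..T})" using assms(2) by (intro compact_Times) auto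
  ultimately obtain C where C: "\<forall>z\<in>closure \<Omega> \<times> {0..T}. norm (b (snd z) * a (fst z)) \<le> C"
    using continuous_on_compact_norm_bound by blast
  have SK: "?S \<subseteq> closure \<Omega> \<times> {0..T}" using closure_subset[of \<Omega>] by auto
  have "continuous_on ?S (\<lambda>z. b (snd z) * a (fst z))"
    by (rule continuous_on_subset[OF _ SK]) fact
  then have "(\<lambda>z. b (snd z) * a (fst z)) \<in> borel_measurable (lebesgue_on ?S)"
    using opS by (intro continuous_imp_measurable_on_sets_lebesgue) auto
  then have "integrable (lebesgue_on ?S) (\<lambda>z. b (snd z) * a (fst z))"
    by (rule integrable_lebesgue_on_bounded[OF Sm, of _ C])
      (rule AE_lebesgue_on_I[OF SK C])
  then have "integrable lebesgue (\<lambda>z. A (fst z) * B (snd z))"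
    unfolding eq using Sm by (subst integrable_restrict_space[symmetric]) auto
  then have int: "integrable (lborel \<Otimes>\<^sub>M lborel) (\<lambda>z. A (fst z) * B (snd z))"
    unfolding lborel_prod by (simp add: integrable_completion[OF fm'])
  have "integral\<^sup>L (lebesgue_on ?S) (\<lambda>z. b (snd z) * a (fst z)) = integral\<^sup>L lebesgue (\<lambda>z. A (fst z) * B (snd z))"
    unfolding eq using Sm by (subst integral_restrict_space) auto
  also have "\<dots> = integral\<^sup>L (lborel \<Otimes>\<^sub>M lborel) (\<lambda>z. A (fst z) * B (snd z))"
    unfolding lborel_prod by (rule integral_completion[OF fm'])
  also have "\<dots> = (\<integral>x. (\<integral>t. A x * B t \<partial>lborel) \<partial>lborel)"
    using lborel_pair.integral_fst'[OF int] by simp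
  also have "\<dots> = integral\<^sup>L lborel A * integral\<^sup>L lborel B" by simp
  also have "integral\<^sup>L lborel A = integral\<^sup>L lebesgue A"
    using Am by (subst integral_completion) auto
  also have "integral\<^sup>L lebesgue A = integral\<^sup>L (lebesgue_on \<Omega>) a"
    unfolding A_def[abs_def] using assms(1) by (subst integral_restrict_space) auto
  also have "integral\<^sup>L lborel B = (LINT t|lborel. b t * indicator {0..T} t)"
  proof (rule integral_cong_AE)
    show "B \<in> borel_measurable lborel" using Bm by simp
    have "(\<lambda>t. indicator {0..T} t *\<^sub>R b t) \<in> borel_measurable borel"
      by (intro borel_measurable_continuous_on_indicator assms(4)) auto
    then show "(\<lambda>t. b t * indicator {0..T} t) \<in> borel_measurable lborel" by (simp add: mult.commute)
    have "AE t in lborel. t \<noteq> 0" "AE t in lborel. t \<noteq> T" by (rule AE_lborel_singleton)+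
    then show "AE t in lborel. B t = b t * indicator {0..T} t"
      by eventually_elim (auto simp: B_def indicator_def)
  qed
  finally show ?thesis .
qed

text \<open>Averages over shrinking time intervals around \<open>t0\<close> converge to the time slice at \<open>t0\<close>.\<close>

lemma time_average_limit:
  fixes \<Omega> :: "'a::euclidean_space set" and T :: real and F :: "'a \<times> real \<Rightarrow> real"
  assumes dom: "open \<Omega>" "bounded \<Omega>" and F: "continuous_on (closure \<Omega> \<times> {0..T}) F" and t0: "t0 \<in> {0..T}"
    and b: "\<And>k. continuous_on {0..T} (b k)" "\<And>k t. 0 \<le> b k t"
    and mass: "\<forall>\<^sub>F k in sequentially. (LINT t|lborel. b k t * indicator {0..T} t) = 1"
    and conc: "\<forall>\<^sub>F k in sequentially. \<forall>t. b k t \<noteq> 0 \<longrightarrow> \<bar>t - t0\<bar> \<le> r k" and r: "r \<longlonglongrightarrow> 0"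
  shows "(\<lambda>k. integral\<^sup>L (lebesgue_on (\<Omega> \<times> {0<..<T})) (\<lambda>z. b k (snd z) * F z))
      \<longlonglongrightarrow> integral\<^sup>L (lebesgue_on \<Omega>) (\<lambda>x. F (x, t0))"
proof (rule LIMSEQ_I)
  let ?S = "\<Omega> \<times> {0<..<T}" let ?M = "lebesgue_on ?S" let ?K = "closure \<Omega> \<times> {0..T}"
  fix e :: real assume "e > 0"
  define m where "m = measure lebesgue \<Omega>"
  define \<epsilon> where "\<epsilon> = e / (m + 1)"
  have m: "m \<ge> 0" by (simp add: m_def)
  have \<epsilon>: "\<epsilon> > 0" using \<open>e > 0\<close> m by (simp add: \<epsilon>_def)
  have cK: "compact ?K" using dom(2) by (intro compact_Times) auto
  have opS: "open ?S" "bounded ?S" using dom by (auto intro: open_Times bounded_Times)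
  have Sm: "?S \<in> lmeasurable" using opS by (simp add: lmeasurable_open)
  have SK: "?S \<subseteq> ?K" using closure_subset[of \<Omega>] by auto
  have "uniformly_continuous_on ?K F" by (rule compact_uniformly_continuous[OF F cK])
  then obtain d where d: "d > 0" "\<forall>z\<in>?K. \<forall>y\<in>?K. dist y z < d \<longrightarrow> dist (F y) (F z) < \<epsilon>"
    unfolding uniformly_continuous_on_def using \<epsilon> by meson
  have "\<forall>\<^sub>F k in sequentially. r k < d" using order_tendstoD(2)[OF r] d(1) by blast
  with mass conc have "\<forall>\<^sub>F k in sequentially. norm (integral\<^sup>L ?M (\<lambda>z. b k (snd z) * F z) -
      integral\<^sup>L (lebesgue_on \<Omega>) (\<lambda>x. F (x, t0))) < e"
  proof eventually_elim
    case (elim k)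
    have cF0: "continuous_on (closure \<Omega>) (\<lambda>x. F (x, t0))"
      using t0 by (intro continuous_on_compose2[OF F] continuous_intros) auto
    have int: "integrable ?M f" if cf: "continuous_on ?K f" for f :: "'a \<times> real \<Rightarrow> real"
    proof -
      obtain B where B: "\<forall>z\<in>?K. norm (f z) \<le> B" using continuous_on_compact_norm_bound[OF cK cf] by blast
      have "f \<in> borel_measurable ?M"
        using opS by (intro continuous_imp_measurable_on_sets_lebesgue continuous_on_subset[OF cf SK]) auto
      then show ?thesis
        by (rule integrable_lebesgue_on_bounded[OF Sm, of _ B])
          (rule AE_lebesgue_on_I[OF SK B])
    qed
    have cb: "continuous_on ?K (\<lambda>z. b k (snd z))"
      by (intro continuous_on_compose2[OF b(1)] continuous_intros) auto
    have cF0': "continuous_on ?K (\<lambda>z. F (fst z, t0))"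
      using t0 by (intro continuous_on_compose2[OF F] continuous_intros) auto
    have "integral\<^sup>L (lebesgue_on \<Omega>) (\<lambda>x. F (x, t0)) = integral\<^sup>L ?M (\<lambda>z. b k (snd z) * F (fst z, t0))"
      using integral_product_on_cylinder[OF dom cF0 b(1)[of k]] elim(1) by simp
    then have "integral\<^sup>L ?M (\<lambda>z. b k (snd z) * F z) - integral\<^sup>L (lebesgue_on \<Omega>) (\<lambda>x. F (x, t0)) =
        integral\<^sup>L ?M (\<lambda>z. b k (snd z) * (F z - F (fst z, t0)))"
      using int[of "\<lambda>z. b k (snd z) * F z"] int[of "\<lambda>z. b k (snd z) * F (fst z, t0)"] cb F cF0'
      by (simp add: right_diff_distrib continuous_on_mult)
    also have "norm \<dots> \<le> integral\<^sup>L ?M (\<lambda>z. norm (b k (snd z) * (F z - F (fst z, t0))))"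
      by (rule integral_norm_bound)
    also have "\<dots> \<le> integral\<^sup>L ?M (\<lambda>z. b k (snd z) * \<epsilon>)"
    proof (rule integral_mono')
      show "integrable ?M (\<lambda>z. b k (snd z) * \<epsilon>)" by (intro int continuous_intros cb)
      show "norm (b k (snd z) * (F z - F (fst z, t0))) \<le> b k (snd z) * \<epsilon>" if "z \<in> space ?M" for z
      proof (cases "b k (snd z) = 0")
        case False
        have z: "z \<in> ?K" "(fst z, t0) \<in> ?K" using that SK t0 by (auto simp: space_restrict_space)
        have "dist z (fst z, t0) = \<bar>snd z - t0\<bar>" by (cases z) (simp add: dist_Pair_Pair dist_real_def)
        then have "dist z (fst z, t0) < d" using elim(2) False elim(3) by fastforce
        then have "\<bar>F z - F (fst z, t0)\<bar> \<le> \<epsilon>" using d(2) z by (auto simp: dist_real_def intro: less_imp_le)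
        then show ?thesis using b(2)[of k "snd z"] by (simp add: abs_mult mult_left_mono)
      qed simp
      show "0 \<le> b k (snd z) * \<epsilon>" for z using b(2)[of k "snd z"] \<epsilon> by simp
    qed
    also have "\<dots> = integral\<^sup>L (lebesgue_on \<Omega>) (\<lambda>x. \<epsilon>)"
      using integral_product_on_cylinder[OF dom continuous_on_const b(1)[of k]] elim(1) by simp
    also have "\<dots> = \<epsilon> * m" using dom(1) by (simp add: m_def measure_restrict_space space_restrict_space)
    also have "\<dots> < e" using \<open>e > 0\<close> m by (simp add: \<epsilon>_def field_simps)
    finally show ?case .
  qed
  then show "\<exists>no. \<forall>k\<ge>no. norm (integral\<^sup>L ?M (\<lambda>z. b k (snd z) * F z) -
      integral\<^sup>L (lebesgue_on \<Omega>) (\<lambda>x. F (x, t0))) < e" by (simp add: eventually_sequentially)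
qed


section \<open>The integral identity for a potential of \<open>u\<close>\<close>

lemma Basis_space_time:
  "(axis i 1, 0) \<in> (Basis :: ((real^'n) \<times> real) set)" "(0, 1) \<in> (Basis :: ((real^'n) \<times> real) set)"
  by (auto simp: Basis_prod_def axis_in_Basis_iff)

text \<open>If \<open>div v = u\<close> and \<open>v\<close> is tangential to \<open>\<partial>\<Omega>\<close>, then \<open>u\<close> solves \<open>u\<^sub>t = div v\<^sub>t\<close> with zero flux through
  the boundary, in the integrated form that defines weak solutions. The time cutoffs \<open>\<theta>\<close> tend
  to the indicator of \<open>(0, s)\<close>, and their derivatives concentrate at \<open>0\<close> and \<open>s\<close>.\<close>

lemma flux_identity:
  fixes v :: "(real^'n) \<times> real \<Rightarrow> real^'n" and u \<zeta> :: "(real^'n) \<times> real \<Rightarrow> real" and \<Omega> :: "(real^'n) set"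
  assumes dom: "smooth_bounded_convex_domain \<Omega>" and T: "0 < T"
    and v: "v \<in> W1inf (cylinder \<Omega> T)"
    and vn: "\<forall>t\<in>{0..T}. \<forall>x\<in>frontier \<Omega>. v (x, t) \<bullet> outer_normal \<Omega> x = 0"
    and u: "continuous_on (closure (cylinder \<Omega> T)) u"
    and div: "AE z in lebesgue_on (cylinder \<Omega> T). divx (cylinder \<Omega> T) v z = u z"
    and \<zeta>: "smooth_on (closure (cylinder \<Omega> T)) \<zeta>" and s: "s \<in> {0..T}"
  shows "integral\<^sup>L (lebesgue_on \<Omega>) (\<lambda>x. u (x, s) * \<zeta> (x, s)) +
     integral\<^sup>L (lebesgue_on (cylinder \<Omega> s)) (\<lambda>z. - u z * classical_Dt \<zeta> z +
        Dt (cylinder \<Omega> T) v z \<bullet> classical_Dx \<zeta> z) =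
     integral\<^sup>L (lebesgue_on \<Omega>) (\<lambda>x. u (x, 0) * \<zeta> (x, 0))"
proof (cases "s = 0")
  case True
  have "integral\<^sup>L (lebesgue_on {}) f = 0" for f :: "(real^'n) \<times> real \<Rightarrow> real"
    by (simp add: integral_restrict_space)
  then show ?thesis using True by (simp add: cylinder_def)
next
  case False
  then have s0: "0 < s" "s \<le> T" using s by auto
  define S where "S = \<Omega> \<times> {0<..<T}"
  have cyl: "cylinder \<Omega> T = S" by (simp add: cylinder_def S_def)
  let ?M = "lebesgue_on S" let ?K = "closure \<Omega> \<times> {0..T}"
  have dom': "open \<Omega>" "bounded \<Omega>" "convex \<Omega>" "\<Omega> \<noteq> {}"
    using dom by (auto simp: smooth_bounded_convex_domain_def)
  have clS: "closure S = ?K" unfolding S_def by (rule closure_cylinder_Times[OF T])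
  have opS: "open S" "bounded S" "convex S" "S \<noteq> {}"
    unfolding S_def using dom' T by (auto intro: open_Times bounded_Times convex_Times)
  have Ss: "S \<in> sets lebesgue" using opS by auto
  have Sm: "S \<in> lmeasurable" using opS by (simp add: lmeasurable_open)
  have SK: "S \<subseteq> ?K" using closure_subset[of S] clS by simp
  have cK: "compact ?K" using dom'(2) by (intro compact_Times) auto
  have uc: "continuous_on ?K u" using u by (simp add: cyl clS)
  have vc: "continuous_on ?K v" and vs: "v \<in> sobolev_W1inf S" using v by (auto simp: W1inf_def cyl clS)
  have tw: "has_weak_deriv S (0, 1) v (Dt S v)" "Dt S v \<in> Linf S"
    unfolding Dt_def using sobolev_weak_deriv[OF opS vs Basis_space_time(2)] by blast+
  have xw: "has_weak_deriv S (axis i 1, 0) v (weak_deriv S (axis i 1, 0) v)" for i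
    using sobolev_weak_deriv[OF opS vs Basis_space_time(1)] by blast
  have normal: "v (x, t) \<bullet> q = 0"
    if nx: "x \<in> frontier \<Omega>" and nt: "t \<in> {0..T}" and nq: "\<forall>y\<in>\<Omega>. q \<bullet> (y - x) \<le> 0" for x t q
  proof -
    obtain c where "q = c *\<^sub>R outer_normal \<Omega> x"
      using normal_cone_subset_span_outer_normal[OF dom nx nq] by (elim exE)
    then show ?thesis using vn nx nt by simp
  qed
  obtain U where U: "open U" "closure S \<subseteq> U" "Cinf_on U \<zeta>"
    using \<zeta> unfolding smooth_on_def cyl by (elim exE conjE)
  have KU: "?K \<subseteq> U" using U(2) clS by simp
  have c\<zeta>: "continuous_on ?K \<zeta>" "continuous_on ?K (classical_Dt \<zeta>)" "continuous_on ?K (classical_Dx \<zeta>)"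
    using continuous_on_subset[OF _ KU] Cinf_on_continuous[OF U(3)] classical_derivatives_continuous[OF U(3)] by blast+
  define Y where "Y z = Dt S v z \<bullet> classical_Dx \<zeta> z - u z * classical_Dt \<zeta> z" for z
  define F where "F z = u z * \<zeta> z" for z
  have cF: "continuous_on ?K F" unfolding F_def[abs_def] by (intro continuous_intros uc c\<zeta>)
  have meas: "f \<in> borel_measurable ?M" if "continuous_on ?K f" for f :: "(real^'n) \<times> real \<Rightarrow> 'b::euclidean_space"
    by (rule continuous_imp_measurable_on_sets_lebesgue[OF continuous_on_subset[OF that SK] Ss])
  have int: "integrable ?M f" if cf: "continuous_on ?K f" for f :: "(real^'n) \<times> real \<Rightarrow> real"
  proof -
    obtain B where B: "\<forall>z\<in>?K. norm (f z) \<le> B" using continuous_on_compact_norm_bound[OF cK cf] by blast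
    show ?thesis by (rule integrable_lebesgue_on_bounded[OF Sm meas[OF cf] AE_lebesgue_on_I[OF SK B]])
  qed
  obtain B2 where B2: "AE z in ?M. norm (Dt S v z) \<le> B2" and tm: "Dt S v \<in> borel_measurable ?M"
    using tw(2) by (auto simp: Linf_iff)
  obtain B3 where B3: "B3 \<ge> 0" "\<forall>z\<in>?K. norm (classical_Dx \<zeta> z) \<le> B3"
    using continuous_on_compact_norm_bound[OF cK c\<zeta>(3)] by blast
  have Y1: "integrable ?M (\<lambda>z. Dt S v z \<bullet> classical_Dx \<zeta> z)"
  proof (rule integrable_lebesgue_on_bounded[OF Sm])
    show "(\<lambda>z. Dt S v z \<bullet> classical_Dx \<zeta> z) \<in> borel_measurable ?M"
      using tm meas[OF c\<zeta>(3)] by measurable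
    show "AE z in ?M. norm (Dt S v z \<bullet> classical_Dx \<zeta> z) \<le> B2 * B3"
      using B2 AE_lebesgue_on_I[OF SK B3(2)]
    proof eventually_elim
      case (elim z)
      have "\<bar>Dt S v z \<bullet> classical_Dx \<zeta> z\<bar> \<le> norm (Dt S v z) * norm (classical_Dx \<zeta> z)"
        by (rule Cauchy_Schwarz_ineq2)
      also have "\<dots> \<le> B2 * B3"
        using elim order_trans[OF norm_ge_zero elim(1)] by (intro mult_mono) auto
      finally show ?case by simp
    qed
  qed
  have Yi: "integrable ?M Y" unfolding Y_def[abs_def]
    by (intro Bochner_Integration.integrable_diff Y1 int continuous_intros uc c\<zeta>)
  obtain h h' :: "real \<Rightarrow> real" and H where h: "Cinf_on UNIV h" "0 \<le> H" "continuous_on UNIV h'"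
    "\<forall>t. (h has_real_derivative h' t) (at t) \<and> 0 \<le> h' t \<and> h' t \<le> H \<and> 0 \<le> h t \<and> h t \<le> 1"
    "\<forall>t<0. h' t = 0" "\<forall>t>1. h' t = 0" "\<forall>t\<le>0. h t = 0" "\<forall>t\<ge>1. h t = 1"
    using smooth_step_with_bounded_derivative by (elim exE conjE)
  have hD: "(h has_real_derivative h' t) (at t)" and hb: "0 \<le> h t" "h t \<le> 1" "0 \<le> h' t" for t using h(4) by auto
  define \<kappa> where "\<kappa> k = real (Suc k)" for k
  have \<kappa>: "\<kappa> k > 0" for k by (simp add: \<kappa>_def)
  \<comment> \<open>The smooth step rises on \<open>[1/\<kappa>, 2/\<kappa>]\<close>, and its mirror image falls on \<open>[s - 2/\<kappa>, s - 1/\<kappa>]\<close>.\<close>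
  define \<theta> where "\<theta> k t = h (\<kappa> k * t + - 1) * h (- \<kappa> k * t + (\<kappa> k * s - 1))" for k t
  define b1 where "b1 k t = \<kappa> k * h' (\<kappa> k * t + - 1)" for k t
  define b2 where "b2 k t = \<kappa> k * h' (- \<kappa> k * t + (\<kappa> k * s - 1))" for k t
  define \<theta>' where "\<theta>' k t = b1 k t * h (- \<kappa> k * t + (\<kappa> k * s - 1)) - h (\<kappa> k * t + - 1) * b2 k t" for k t
  have lin: "Ck_on j UNIV (\<lambda>t::real. a * t + c)" for j a c
    by (intro Ck_on_add Ck_on_mult Ck_on_const open_UNIV Ck_on_linear bounded_linear_ident)
  have \<theta>C: "Cinf_on UNIV (\<theta> k)" for k unfolding \<theta>_def[abs_def]
    by (intro allI Ck_on_mult open_UNIV Ck_on_compose[OF open_UNIV h(1)[THEN spec] lin]) auto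
  have \<theta>D: "(\<theta> k has_real_derivative \<theta>' k t) (at t)" for k t
  proof -
    have 1: "((\<lambda>t. h (a * t + c)) has_real_derivative h' (a * t + c) * a) (at t)" for a c
      by (rule DERIV_chain2[OF hD]) (auto intro!: derivative_eq_intros)
    show ?thesis unfolding \<theta>_def[abs_def]
      by (rule DERIV_cong[OF DERIV_mult[OF 1 1]]) (simp add: \<theta>'_def b1_def b2_def)
  qed
  have ch: "continuous_on A (\<lambda>t. h (a * t + c))" "continuous_on A (\<lambda>t. h' (a * t + c))" for A a c
    by (auto intro!: continuous_on_compose2[OF Cinf_on_continuous[OF h(1)]] continuous_on_compose2[OF h(3)] continuous_intros)
  have b1c: "continuous_on A (b1 k)" and b2c: "continuous_on A (b2 k)" for A k
    unfolding b1_def[abs_def] b2_def[abs_def] by (intro continuous_intros ch)+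
  have \<theta>'c: "continuous_on A (\<theta>' k)" for A k
    unfolding \<theta>'_def[abs_def] by (intro continuous_intros ch b1c b2c)
  have \<theta>supp: "t \<in> {1 / \<kappa> k..s - 1 / \<kappa> k}" if "\<theta> k t \<noteq> 0" for k t
  proof -
    have "\<kappa> k * t + - 1 > 0" "- \<kappa> k * t + (\<kappa> k * s - 1) > 0"
      using that h(7) unfolding \<theta>_def by (force simp: not_le[symmetric])+
    then show ?thesis using \<kappa>[of k] by (simp add: field_simps)
  qed
  have supp_in: "{1 / \<kappa> k..s - 1 / \<kappa> k} \<subseteq> {0<..<T}" for k
  proof -
    have p: "1 / \<kappa> k > 0" using \<kappa> by simp
    show ?thesis
    proof
      fix x assume "x \<in> {1 / \<kappa> k..s - 1 / \<kappa> k}"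
      then have "1 / \<kappa> k \<le> x" "x \<le> s - 1 / \<kappa> k" by simp_all
      then have "0 < x" "x < T" using p s0 by linarith+
      then show "x \<in> {0<..<T}" by simp
    qed
  qed
  have key: "integral\<^sup>L ?M (\<lambda>z. \<theta> k (snd z) * Y z) = integral\<^sup>L ?M (\<lambda>z. \<theta>' k (snd z) * F z)" for k
  proof -
    have "integral\<^sup>L ?M (\<lambda>z. \<theta> k (snd z) * (Dt S v z \<bullet> classical_Dx \<zeta> z) -
        u z * (\<theta>' k (snd z) * \<zeta> z + \<theta> k (snd z) * classical_Dt \<zeta> z)) = 0"
      by (rule flux_equation_cutoff_free[OF S_def dom' T uc vc normal tw xw div[unfolded cyl] \<theta>C \<theta>supp supp_in \<theta>D \<theta>'c U])
    moreover have "\<theta> k (snd z) * (Dt S v z \<bullet> classical_Dx \<zeta> z) -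
        u z * (\<theta>' k (snd z) * \<zeta> z + \<theta> k (snd z) * classical_Dt \<zeta> z) =
        \<theta> k (snd z) * Y z - \<theta>' k (snd z) * F z" for z
      by (simp add: Y_def F_def algebra_simps)
    moreover have "integrable ?M (\<lambda>z. \<theta>' k (snd z) * F z)"
      by (intro int continuous_intros cF continuous_on_compose2[OF \<theta>'c[of UNIV]]) auto
    moreover have "integrable ?M (\<lambda>z. \<theta> k (snd z) * Y z)"
    proof (rule Bochner_Integration.integrable_bound[OF Yi])
      have "continuous_on ?K (\<lambda>z. \<theta> k (snd z))"
        by (intro continuous_on_compose2[OF Cinf_on_continuous[OF \<theta>C]] continuous_intros) auto
      from borel_measurable_times[OF meas[OF this] borel_measurable_integrable[OF Yi]]
      show "(\<lambda>z. \<theta> k (snd z) * Y z) \<in> borel_measurable ?M" .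
      have "\<bar>\<theta> k t\<bar> \<le> 1" for t unfolding \<theta>_def abs_mult using hb by (intro mult_le_one) auto
      then show "AE z in ?M. norm (\<theta> k (snd z) * Y z) \<le> norm (Y z)"
        by (intro AE_I2) (simp add: abs_mult mult_left_le_one_le)
    qed
    ultimately show ?thesis by simp
  qed
  have "(\<lambda>k. integral\<^sup>L ?M (\<lambda>z. \<theta> k (snd z) * Y z)) \<longlonglongrightarrow> integral\<^sup>L ?M (\<lambda>z. indicator {..<s} (snd z) * Y z)"
  proof (rule integral_dominated_convergence[where w="\<lambda>z. norm (Y z)"])
    show "integrable ?M (\<lambda>z. norm (Y z))" using Yi by simp
    have "(\<lambda>z::(real^'n)\<times>real. snd z) \<in> borel_measurable borel"
      by (intro borel_measurable_continuous_onI continuous_intros)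
    then have "(\<lambda>z::(real^'n)\<times>real. indicator {..<s} (snd z) :: real) \<in> borel_measurable borel"
      by (rule measurable_compose) simp
    then have "(\<lambda>z::(real^'n)\<times>real. indicator {..<s} (snd z) :: real) \<in> borel_measurable ?M"
      by (intro measurable_restrict_space1 measurable_completion) simp
    from borel_measurable_times[OF this borel_measurable_integrable[OF Yi]]
    show "(\<lambda>z. indicator {..<s} (snd z) * Y z) \<in> borel_measurable ?M" .
    show "(\<lambda>z. \<theta> k (snd z) * Y z) \<in> borel_measurable ?M" for k
    proof -
      have "continuous_on ?K (\<lambda>z. \<theta> k (snd z))"
        by (intro continuous_on_compose2[OF Cinf_on_continuous[OF \<theta>C]] continuous_intros) auto
      from borel_measurable_times[OF meas[OF this] borel_measurable_integrable[OF Yi]] show ?thesis .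
    qed
    have "\<bar>\<theta> k t\<bar> \<le> 1" for k t unfolding \<theta>_def abs_mult using hb by (intro mult_le_one) auto
    then show "AE z in ?M. norm (\<theta> k (snd z) * Y z) \<le> norm (Y z)" for k
      by (intro AE_I2) (simp add: abs_mult mult_left_le_one_le)
    show "AE z in ?M. (\<lambda>k. \<theta> k (snd z) * Y z) \<longlonglongrightarrow> indicator {..<s} (snd z) * Y z"
    proof (rule AE_I2)
      fix z assume "z \<in> space ?M"
      then have z: "0 < snd z" by (auto simp: space_restrict_space S_def)
      have "(\<lambda>k. \<theta> k (snd z)) \<longlonglongrightarrow> indicator {..<s} (snd z)"
      proof (cases "snd z < s")
        case True
        obtain N where N: "real N > 2 / snd z + 2 / (s - snd z)" using reals_Archimedean2 by blast
        have "\<theta> k (snd z) = 1" if "k \<ge> N" for k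
        proof -
          have p: "2 / snd z > 0" "2 / (s - snd z) > 0" using z True by auto
          have "\<kappa> k > 2 / snd z + 2 / (s - snd z)" using N that unfolding \<kappa>_def by linarith
          then have "\<kappa> k > 2 / snd z" "\<kappa> k > 2 / (s - snd z)" using p by linarith+
          then have "\<kappa> k * snd z > 2" "\<kappa> k * (s - snd z) > 2" using z True by (simp_all add: divide_less_eq)
          then have "\<kappa> k * snd z + - 1 \<ge> 1" "- \<kappa> k * snd z + (\<kappa> k * s - 1) \<ge> 1" by (auto simp: algebra_simps)
          then show ?thesis using h(8) unfolding \<theta>_def by simp
        qed
        then show ?thesis using True by (intro tendsto_eventually) (auto simp: eventually_sequentially intro!: exI[of _ N])
      next
        case False
        have "\<theta> k (snd z) = 0" for k
        proof (rule ccontr)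
          assume "\<theta> k (snd z) \<noteq> 0"
          from \<theta>supp[OF this] have "snd z \<le> s - 1 / \<kappa> k" by simp
          moreover have "1 / \<kappa> k > 0" using \<kappa> by simp
          ultimately show False using False by linarith
        qed
        then show ?thesis using False by simp
      qed
      then show "(\<lambda>k. \<theta> k (snd z) * Y z) \<longlonglongrightarrow> indicator {..<s} (snd z) * Y z"
        by (intro tendsto_intros)
    qed
  qed
  moreover have "(\<lambda>k. integral\<^sup>L ?M (\<lambda>z. \<theta>' k (snd z) * F z)) \<longlonglongrightarrow>
      integral\<^sup>L (lebesgue_on \<Omega>) (\<lambda>x. F (x, 0)) - integral\<^sup>L (lebesgue_on \<Omega>) (\<lambda>x. F (x, s))"
  proof (rule Lim_transform_eventually)
    have b1n: "1 \<le> \<kappa> k * t \<and> \<kappa> k * t \<le> 2" if b: "b1 k t \<noteq> 0" for k t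
    proof -
      have "h' (\<kappa> k * t + - 1) \<noteq> 0" using b by (auto simp: b1_def)
      then have "\<not> \<kappa> k * t + - 1 < 0" "\<not> \<kappa> k * t + - 1 > 1" using h(5,6) by blast+
      then show ?thesis by linarith
    qed
    have b2n: "1 \<le> \<kappa> k * (s - t) \<and> \<kappa> k * (s - t) \<le> 2" if b: "b2 k t \<noteq> 0" for k t
    proof -
      have "h' (- \<kappa> k * t + (\<kappa> k * s - 1)) \<noteq> 0" using b by (auto simp: b2_def)
      then have "\<not> - \<kappa> k * t + (\<kappa> k * s - 1) < 0" "\<not> - \<kappa> k * t + (\<kappa> k * s - 1) > 1" using h(5,6) by blast+
      then show ?thesis unfolding right_diff_distrib by linarith
    qed
    obtain N where N: "real N > 4 / s" using reals_Archimedean2 by blast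
    have big: "\<kappa> k * s > 4" if "k \<ge> N" for k
    proof -
      have "\<kappa> k > 4 / s" using N that unfolding \<kappa>_def by linarith
      then show ?thesis using s0 by (simp add: divide_less_eq)
    qed
    have r: "(\<lambda>k. 2 / \<kappa> k) \<longlonglongrightarrow> 0"
      unfolding \<kappa>_def using LIMSEQ_Suc[OF lim_const_over_n] by simp
    have mass1: "(LINT t|lborel. b1 k t * indicator {0..T} t) = 1" if "k \<ge> N" for k
    proof -
      have "\<kappa> k * s \<le> \<kappa> k * T" using s0 \<kappa>[of k] by simp
      then have "\<kappa> k * T + - 1 \<ge> 1" using big[OF that] by linarith
      then have "h (\<kappa> k * T + - 1) - h (\<kappa> k * 0 + - 1) = 1" using h(7,8) by simp
      moreover have "(LINT t|lborel. b1 k t * indicator {0..T} t) = h (\<kappa> k * T + - 1) - h (\<kappa> k * 0 + - 1)"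
      proof (rule integral_FTC_Icc_real)
        show "((\<lambda>t. h (\<kappa> k * t + - 1)) has_real_derivative b1 k t) (at t)" for t
          by (rule DERIV_cong[OF DERIV_chain2[OF hD]]) (auto intro!: derivative_eq_intros simp: b1_def)
        show "isCont (b1 k) t" for t using b1c[of UNIV k] by (simp add: continuous_on_eq_continuous_at)
      qed (use T in simp)
      ultimately show ?thesis by simp
    qed
    have mass2: "(LINT t|lborel. b2 k t * indicator {0..T} t) = 1" if "k \<ge> N" for k
    proof -
      have "\<kappa> k * s \<le> \<kappa> k * T" using s0 \<kappa>[of k] by simp
      then have "- \<kappa> k * T + (\<kappa> k * s - 1) \<le> 0" by linarith
      moreover have "- \<kappa> k * 0 + (\<kappa> k * s - 1) \<ge> 1" using big[OF that] by linarith
      ultimately have "- h (- \<kappa> k * T + (\<kappa> k * s - 1)) - (- h (- \<kappa> k * 0 + (\<kappa> k * s - 1))) = 1" using h(7,8) by simp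
      moreover have "(LINT t|lborel. b2 k t * indicator {0..T} t) =
          - h (- \<kappa> k * T + (\<kappa> k * s - 1)) - (- h (- \<kappa> k * 0 + (\<kappa> k * s - 1)))"
      proof (rule integral_FTC_Icc_real)
        show "((\<lambda>t. - h (- \<kappa> k * t + (\<kappa> k * s - 1))) has_real_derivative b2 k t) (at t)" for t
          by (rule DERIV_cong[OF DERIV_minus[OF DERIV_chain2[OF hD]]]) (auto intro!: derivative_eq_intros simp: b2_def)
        show "isCont (b2 k) t" for t using b2c[of UNIV k] by (simp add: continuous_on_eq_continuous_at)
      qed (use T in simp)
      ultimately show ?thesis by simp
    qed
    have 1: "(\<lambda>k. integral\<^sup>L (lebesgue_on (\<Omega> \<times> {0<..<T})) (\<lambda>z. b1 k (snd z) * F z)) \<longlonglongrightarrow>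
        integral\<^sup>L (lebesgue_on \<Omega>) (\<lambda>x. F (x, 0))"
    proof (rule time_average_limit[OF dom'(1,2) cF _ b1c _ _ _ r])
      show "0 \<le> b1 k t" for k t using \<kappa>[of k] hb(3) by (simp add: b1_def)
      show "\<forall>\<^sub>F k in sequentially. (LINT t|lborel. b1 k t * indicator {0..T} t) = 1"
        using mass1 by (auto simp: eventually_sequentially)
      show "\<forall>\<^sub>F k in sequentially. \<forall>t. b1 k t \<noteq> 0 \<longrightarrow> \<bar>t - 0\<bar> \<le> 2 / \<kappa> k"
      proof (intro always_eventually allI impI)
        fix k t assume "b1 k t \<noteq> 0"
        from b1n[OF this] have b: "1 \<le> \<kappa> k * t" "\<kappa> k * t \<le> 2" by auto
        then have "0 < t" using \<kappa>[of k] by (metis less_le_trans zero_less_mult_pos zero_less_one)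
        then show "\<bar>t - 0\<bar> \<le> 2 / \<kappa> k" using b \<kappa>[of k] by (simp add: pos_le_divide_eq mult.commute)
      qed
    qed (use T in simp)
    have 2: "(\<lambda>k. integral\<^sup>L (lebesgue_on (\<Omega> \<times> {0<..<T})) (\<lambda>z. b2 k (snd z) * F z)) \<longlonglongrightarrow>
        integral\<^sup>L (lebesgue_on \<Omega>) (\<lambda>x. F (x, s))"
    proof (rule time_average_limit[OF dom'(1,2) cF s b2c _ _ _ r])
      show "0 \<le> b2 k t" for k t using \<kappa>[of k] hb(3) by (simp add: b2_def)
      show "\<forall>\<^sub>F k in sequentially. (LINT t|lborel. b2 k t * indicator {0..T} t) = 1"
        using mass2 by (auto simp: eventually_sequentially)
      show "\<forall>\<^sub>F k in sequentially. \<forall>t. b2 k t \<noteq> 0 \<longrightarrow> \<bar>t - s\<bar> \<le> 2 / \<kappa> k"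
      proof (intro always_eventually allI impI)
        fix k t assume "b2 k t \<noteq> 0"
        from b2n[OF this] have b: "1 \<le> \<kappa> k * (s - t)" "\<kappa> k * (s - t) \<le> 2" by auto
        then have "0 < s - t" using \<kappa>[of k] by (metis less_le_trans zero_less_mult_pos zero_less_one)
        then have "\<bar>t - s\<bar> = s - t" by simp
        then show "\<bar>t - s\<bar> \<le> 2 / \<kappa> k" using b \<kappa>[of k] by (simp add: pos_le_divide_eq mult.commute)
      qed
    qed
    show "(\<lambda>k. integral\<^sup>L ?M (\<lambda>z. b1 k (snd z) * F z) - integral\<^sup>L ?M (\<lambda>z. b2 k (snd z) * F z)) \<longlonglongrightarrow>
      integral\<^sup>L (lebesgue_on \<Omega>) (\<lambda>x. F (x, 0)) - integral\<^sup>L (lebesgue_on \<Omega>) (\<lambda>x. F (x, s))"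
      using tendsto_diff[OF 1 2] by (simp add: S_def)
    \<comment> \<open>For \<open>\<kappa> s > 4\<close> each of the two steps is \<open>1\<close> where the other one varies.\<close>
    have split: "\<theta>' k t = b1 k t - b2 k t" if "k \<ge> N" for k t
    proof -
      have "b1 k t * h (- \<kappa> k * t + (\<kappa> k * s - 1)) = b1 k t"
      proof (cases "b1 k t = 0")
        case False
        then have "- \<kappa> k * t + (\<kappa> k * s - 1) \<ge> 1" using b1n[of k t] big[OF that] by auto
        then show ?thesis using h(8) by simp
      qed simp
      moreover have "h (\<kappa> k * t + - 1) * b2 k t = b2 k t"
      proof (cases "b2 k t = 0")
        case False
        then have "\<kappa> k * t + - 1 \<ge> 1" using b2n[of k t] big[OF that] by (auto simp: algebra_simps)
        then show ?thesis using h(8) by simp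
      qed simp
      ultimately show ?thesis unfolding \<theta>'_def by (simp only:)
    qed
    have "integral\<^sup>L ?M (\<lambda>z. b1 k (snd z) * F z) - integral\<^sup>L ?M (\<lambda>z. b2 k (snd z) * F z) =
        integral\<^sup>L ?M (\<lambda>z. \<theta>' k (snd z) * F z)" if "k \<ge> N" for k
    proof -
      have "integrable ?M (\<lambda>z. b1 k (snd z) * F z)" "integrable ?M (\<lambda>z. b2 k (snd z) * F z)"
        by (intro int continuous_intros cF continuous_on_compose2[OF b1c[of UNIV]] continuous_on_compose2[OF b2c[of UNIV]]; simp)+
      then show ?thesis unfolding split[OF that] by (simp add: left_diff_distrib)
    qed
    then show "\<forall>\<^sub>F k in sequentially. integral\<^sup>L ?M (\<lambda>z. b1 k (snd z) * F z) - integral\<^sup>L ?M (\<lambda>z. b2 k (snd z) * F z) =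
        integral\<^sup>L ?M (\<lambda>z. \<theta>' k (snd z) * F z)" by (auto simp: eventually_sequentially)
  qed
  ultimately have eq: "integral\<^sup>L ?M (\<lambda>z. indicator {..<s} (snd z) * Y z) =
      integral\<^sup>L (lebesgue_on \<Omega>) (\<lambda>x. F (x, 0)) - integral\<^sup>L (lebesgue_on \<Omega>) (\<lambda>x. F (x, s))"
    unfolding key using LIMSEQ_unique by blast
  have cs: "cylinder \<Omega> s \<in> sets lebesgue"
  proof -
    have "open (cylinder \<Omega> s)" unfolding cylinder_def using dom'(1) by (simp add: open_Times)
    then show ?thesis by auto
  qed
  have "integral\<^sup>L ?M (\<lambda>z. indicator {..<s} (snd z) * Y z) = integral\<^sup>L (lebesgue_on (cylinder \<Omega> s)) Y"
  proof -
    have eqz: "indicator S z *\<^sub>R (indicator {..<s} (snd z) * Y z) = indicator (cylinder \<Omega> s) z *\<^sub>R Y z" for z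
      using s0 by (auto simp: S_def cylinder_def indicator_def mem_Times_iff)
    have "integral\<^sup>L ?M (\<lambda>z. indicator {..<s} (snd z) * Y z) =
        integral\<^sup>L lebesgue (\<lambda>z. indicator S z *\<^sub>R (indicator {..<s} (snd z) * Y z))"
      using Ss by (subst integral_restrict_space) auto
    also have "\<dots> = integral\<^sup>L (lebesgue_on (cylinder \<Omega> s)) Y"
      unfolding eqz using cs by (subst integral_restrict_space) auto
    finally show ?thesis .
  qed
  then have "integral\<^sup>L (lebesgue_on (cylinder \<Omega> s)) Y =
      integral\<^sup>L (lebesgue_on \<Omega>) (\<lambda>x. F (x, 0)) - integral\<^sup>L (lebesgue_on \<Omega>) (\<lambda>x. F (x, s))"
    using eq by simp
  moreover have "Y = (\<lambda>z. - u z * classical_Dt \<zeta> z + Dt (cylinder \<Omega> T) v z \<bullet> classical_Dx \<zeta> z)"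
    by (simp add: fun_eq_iff Y_def cyl)
  ultimately show ?thesis by (simp only: F_def)
qed

section \<open>Strong convergence of gradients by almost maximal energy\<close>

text \<open>By \<open>gap\<close>, the distance \<open>N w u\<close> of nearby elements is small unless \<open>F w\<close> is noticeably larger than \<open>F u\<close>.
  The term \<open>u k\<close> almost maximizes \<open>F\<close> on the part of \<open>A k\<close> in a ball that contains all later terms, which
  excludes this for them.\<close>

lemma nested_almost_maximizers:
  fixes d N :: "'x \<Rightarrow> 'x \<Rightarrow> real" and F :: "'x \<Rightarrow> real" and A :: "nat \<Rightarrow> 'x set" and e :: "nat \<Rightarrow> real"
  assumes refl: "\<And>u. u \<in> X \<Longrightarrow> d u u = 0"
    and tri: "\<And>u w y. u \<in> X \<Longrightarrow> w \<in> X \<Longrightarrow> y \<in> X \<Longrightarrow> d u y \<le> d u w + d w y"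
    and bdd: "\<And>u. u \<in> X \<Longrightarrow> F u \<le> B"
    and gap: "\<And>u \<epsilon>. u \<in> X \<Longrightarrow> 0 < \<epsilon> \<Longrightarrow> \<exists>r>0. \<forall>w\<in>X. d u w < r \<longrightarrow> N w u \<le> F w - F u + \<epsilon>"
    and AX: "\<And>k. A k \<subseteq> X" and Adec: "\<And>k. A (Suc k) \<subseteq> A k"
    and dense: "\<And>k u \<delta>. u \<in> X \<Longrightarrow> 0 < \<delta> \<Longrightarrow> \<exists>w\<in>A k. d u w < \<delta>"
    and \<phi>: "\<phi> \<in> X" and \<eta>: "0 < \<eta>" and e: "\<And>k. 0 < e k"
  shows "\<exists>u :: nat \<Rightarrow> 'x. (\<forall>k. u k \<in> A k \<and> d \<phi> (u k) < \<eta>) \<and>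
    (\<forall>k m. k \<le> m \<longrightarrow> N (u m) (u k) \<le> e k \<and> d (u k) (u m) < (1/2) ^ k)"
proof -
  define step where "step k x y \<longleftrightarrow> fst y \<in> A k \<and> 0 < snd y \<and> snd y \<le> (1/2) ^ k \<and>
     d (fst x) (fst y) + snd y \<le> snd x \<and>
     (\<forall>w\<in>A k. d (fst x) w < snd x \<longrightarrow> F w \<le> F (fst y) + e k / 2) \<and>
     (\<forall>w\<in>X. d (fst y) w < snd y \<longrightarrow> N w (fst y) \<le> F w - F (fst y) + e k / 2)" for k and x y :: "'x \<times> real"
  have step_ex: "\<exists>y. step k x y" if x: "fst x \<in> X" "0 < snd x" for k x
  proof -
    let ?V = "F ` {w\<in>A k. d (fst x) w < snd x}"
    have ne: "?V \<noteq> {}" using dense[OF x, of k] by blast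
    have bd: "bdd_above ?V" using bdd AX by (intro bdd_aboveI[of _ B]) auto
    have "Sup ?V - e k / 2 < Sup ?V" using e[of k] by simp
    then obtain y where "y \<in> ?V" "Sup ?V - e k / 2 < y" using less_cSup_iff[OF ne bd] by blast
    then obtain u where u: "u \<in> A k" "d (fst x) u < snd x" "Sup ?V - e k / 2 < F u" by blast
    have max: "F w \<le> F u + e k / 2" if "w \<in> A k" "d (fst x) w < snd x" for w
    proof -
      have "F w \<le> Sup ?V" using that by (intro cSup_upper bd) blast
      then show ?thesis using u(3) by linarith
    qed
    have uX: "u \<in> X" using u(1) AX by blast
    have e2: "0 < e k / 2" using e[of k] by simp
    obtain r where r: "0 < r" "\<forall>w\<in>X. d u w < r \<longrightarrow> N w u \<le> F w - F u + e k / 2"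
      using gap[OF uX e2] by blast
    \<comment> \<open>The new ball must lie in the old one, hence the third bound on its radius.\<close>
    define \<rho> where "\<rho> = min r (min ((1/2) ^ k) (snd x - d (fst x) u))"
    have "step k x (u, \<rho>)"
      unfolding step_def using u r max by (auto simp: \<rho>_def)
    then show ?thesis by blast
  qed
  let ?P = "\<lambda>n x. fst x \<in> X \<and> 0 < snd x \<and> (n = (0::nat) \<longrightarrow> x = (\<phi>, \<eta>))"
  have "\<exists>f. \<forall>n. ?P n (f n) \<and> step n (f n) (f (Suc n))"
  proof (rule dependent_nat_choice)
    show "\<exists>x. ?P 0 x" using \<phi> \<eta> by auto
    fix x n assume "?P n x"
    then obtain y where y: "step n x y" using step_ex by blast
    then have "fst y \<in> X" "0 < snd y" using AX by (auto simp: step_def)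
    with y show "\<exists>y. ?P (Suc n) y \<and> step n x y" by blast
  qed
  then obtain f where f: "\<forall>n. ?P n (f n) \<and> step n (f n) (f (Suc n))" by (elim exE)
  define c where "c n = fst (f n)" for n
  define r where "r n = snd (f n)" for n
  have cX: "c n \<in> X" and rpos: "0 < r n" for n using f by (auto simp: c_def r_def)
  have c0: "c 0 = \<phi>" "r 0 = \<eta>" using f by (auto simp: c_def r_def)
  have st: "c (Suc n) \<in> A n" "r (Suc n) \<le> (1/2) ^ n" "d (c n) (c (Suc n)) + r (Suc n) \<le> r n"
    "\<forall>w\<in>A n. d (c n) w < r n \<longrightarrow> F w \<le> F (c (Suc n)) + e n / 2"
    "\<forall>w\<in>X. d (c (Suc n)) w < r (Suc n) \<longrightarrow> N w (c (Suc n)) \<le> F w - F (c (Suc n)) + e n / 2" for n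
    using f unfolding step_def c_def r_def by blast+
  have nest: "d (c n) (c m) < r n" if "n \<le> m" for n m
    using that
  proof (induction rule: inc_induct)
    case base
    then show ?case using refl[OF cX[of m]] rpos[of m] by simp
  next
    case (step n)
    have "d (c n) (c m) \<le> d (c n) (c (Suc n)) + d (c (Suc n)) (c m)" by (rule tri[OF cX cX cX])
    then show ?case using step.IH st(3)[of n] by linarith
  qed
  have Amono: "A m \<subseteq> A k" if "k \<le> m" for k m
    using lift_Suc_antimono_le[of A, OF Adec that] .
  have "N (c (Suc m)) (c (Suc k)) \<le> e k \<and> d (c (Suc k)) (c (Suc m)) < (1/2) ^ k" if "k \<le> m" for k m
  proof -
    have "c (Suc m) \<in> A k" using st(1) Amono[OF that] by blast
    moreover have "d (c k) (c (Suc m)) < r k" using nest[of k "Suc m"] that by simp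
    ultimately have 1: "F (c (Suc m)) \<le> F (c (Suc k)) + e k / 2" using st(4) by blast
    have 2: "d (c (Suc k)) (c (Suc m)) < r (Suc k)" using nest[of "Suc k" "Suc m"] that by simp
    then have "N (c (Suc m)) (c (Suc k)) \<le> F (c (Suc m)) - F (c (Suc k)) + e k / 2"
      using st(5) cX by blast
    then show ?thesis using 1 2 st(2)[of k] by (intro conjI) linarith+
  qed
  moreover have "c (Suc k) \<in> A k \<and> d \<phi> (c (Suc k)) < \<eta>" for k
    using st(1) nest[of 0 "Suc k"] c0 by simp
  ultimately show ?thesis by (intro exI[of _ "\<lambda>k. c (Suc k)"]) blast
qed

text \<open>A set of measure zero contains no nonempty open set.\<close>

lemma continuous_AE_le_imp_le:
  fixes f :: "'a::euclidean_space \<Rightarrow> real"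
  assumes "open S" "continuous_on (closure S) f" "AE z in lebesgue_on S. f z \<le> c" "z \<in> closure S"
  shows "f z \<le> c"
proof -
  let ?V = "S \<inter> f -` {c<..}"
  have "continuous_on S f" using continuous_on_subset[OF assms(2) closure_subset] .
  then have op: "open ?V" by (rule continuous_open_preimage[OF _ assms(1) open_greaterThan])
  then have Vs: "?V \<in> sets lebesgue" by auto
  have "AE z in lebesgue. z \<in> S \<longrightarrow> f z \<le> c"
    using assms(1,3) by (simp add: AE_lebesgue_on_iff)
  then have "AE z in lebesgue. z \<notin> ?V" by eventually_elim auto
  then have "negligible ?V"
    using AE_iff_null_sets[OF Vs] by (simp only: negligible_iff_null_sets)
  then have "?V = {}" using op open_not_negligible by blast
  have le: "f y \<le> c" if y: "y \<in> S" for y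
  proof (rule ccontr)
    assume "\<not> f y \<le> c"
    then have "y \<in> ?V" using y by simp
    then show False using \<open>?V = {}\<close> by simp
  qed
  show ?thesis by (rule continuous_le_on_closure[OF assms(2,4) le])
qed

text \<open>The uniform distance of \<open>f\<close> and \<open>g\<close> on \<open>K\<close>, used for functions that are continuous on a nonempty compact
  set \<open>K\<close>, where the supremum is finite.\<close>

definition sup_dist :: "'a set \<Rightarrow> ('a \<Rightarrow> real) \<Rightarrow> ('a \<Rightarrow> real) \<Rightarrow> real" where
  "sup_dist K f g = (SUP z\<in>K. \<bar>f z - g z\<bar>)"

lemma sup_dist_upper:
  fixes f g :: "'a::euclidean_space \<Rightarrow> real"
  assumes "compact K" "continuous_on K f" "continuous_on K g" "z \<in> K"
  shows "\<bar>f z - g z\<bar> \<le> sup_dist K f g"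
proof -
  have "continuous_on K (\<lambda>z. f z - g z)" by (intro continuous_intros assms)
  then obtain B where "\<forall>z\<in>K. norm (f z - g z) \<le> B" using continuous_on_compact_norm_bound[OF assms(1)] by blast
  then have "bdd_above ((\<lambda>z. \<bar>f z - g z\<bar>) ` K)" by (intro bdd_aboveI2[of _ _ B]) auto
  then show ?thesis unfolding sup_dist_def by (rule cSUP_upper[OF assms(4)])
qed

lemma sup_dist_least:
  "K \<noteq> {} \<Longrightarrow> (\<And>z. z \<in> K \<Longrightarrow> \<bar>f z - g z\<bar> \<le> c) \<Longrightarrow> sup_dist K f g \<le> c"
  unfolding sup_dist_def by (rule cSUP_least)

lemma Linf_integrable:
  assumes "S \<in> lmeasurable" "f \<in> Linf S"
  shows "integrable (lebesgue_on S) f"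
  using assms(2) integrable_lebesgue_on_bounded[OF assms(1)] by (auto simp: Linf_iff)

lemma Linf_real_mult:
  fixes f g :: "'a::euclidean_space \<Rightarrow> real"
  assumes "f \<in> Linf S" "g \<in> Linf S"
  shows "(\<lambda>z. f z * g z) \<in> Linf S"
proof -
  obtain A B where "AE z in lebesgue_on S. norm (f z) \<le> A" "AE z in lebesgue_on S. norm (g z) \<le> B"
    using assms by (auto simp: Linf_iff)
  then have "AE z in lebesgue_on S. norm (f z * g z) \<le> A * B"
  proof eventually_elim
    case (elim z)
    then show ?case using order_trans[OF norm_ge_zero elim(1)] by (simp add: abs_mult mult_mono)
  qed
  then show ?thesis using assms by (auto simp: Linf_iff)
qed

lemma Linf_diff:
  fixes f g :: "'a::euclidean_space \<Rightarrow> real"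
  assumes "f \<in> Linf S" "g \<in> Linf S"
  shows "(\<lambda>z. f z - g z) \<in> Linf S"
proof -
  obtain A B where "AE z in lebesgue_on S. norm (f z) \<le> A" "AE z in lebesgue_on S. norm (g z) \<le> B"
    using assms by (auto simp: Linf_iff)
  then have "AE z in lebesgue_on S. norm (f z - g z) \<le> A + B"
  proof eventually_elim
    case (elim z)
    then show ?case using norm_triangle_ineq4[of "f z" "g z"] by linarith
  qed
  then show ?thesis using assms by (auto simp: Linf_iff)
qed

text \<open>Weak derivatives depend weakly continuously on a function that varies uniformly under a bound
  for the derivatives; here they are paired with a bounded function \<open>p\<close>.\<close>

lemma weak_deriv_weak_continuity:
  fixes u p :: "'a::euclidean_space \<Rightarrow> real"
  assumes S: "open S" "bounded S" "convex S" "S \<noteq> {}" and b: "b \<in> Basis" and M: "0 \<le> M"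
    and u: "u \<in> sobolev_W1inf S" "AE z in lebesgue_on S. \<bar>weak_deriv S b u z\<bar> \<le> M"
    and p: "p \<in> Linf S" and \<epsilon>: "0 < \<epsilon>"
  shows "\<exists>r>0. \<forall>w. w \<in> sobolev_W1inf S \<and> (AE z in lebesgue_on S. \<bar>weak_deriv S b w z\<bar> \<le> M) \<and>
      (\<forall>z\<in>S. \<bar>w z - u z\<bar> \<le> r) \<longrightarrow>
     \<bar>integral\<^sup>L (lebesgue_on S) (\<lambda>z. (weak_deriv S b w z - weak_deriv S b u z) * p z)\<bar> \<le> \<epsilon>"
proof -
  let ?M = "lebesgue_on S" let ?D = "weak_deriv S b"
  have Sm: "S \<in> lmeasurable" using S by (simp add: lmeasurable_open)
  have Ss: "S \<in> sets lebesgue" using S(1) by auto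
  obtain B0 where "AE z in ?M. norm (p z) \<le> B0" and pm: "p \<in> borel_measurable ?M" using p by (auto simp: Linf_iff)
  then have pb: "AE z in ?M. \<bar>p z\<bar> \<le> \<bar>B0\<bar>" by (auto elim!: eventually_mono)
  obtain \<phi> where \<phi>: "\<forall>n::nat. test_function S (\<phi> n) \<and> (\<forall>x\<in>S. \<bar>\<phi> n x\<bar> \<le> \<bar>B0\<bar> + 1)"
     "AE x in ?M. (\<lambda>n. \<phi> n x) \<longlonglongrightarrow> p x"
    using bounded_measurable_approx_by_test_functions[OF S pm pb abs_ge_zero] by (elim exE conjE)
  have \<phi>m: "\<phi> n \<in> borel_measurable ?M" for n
    using \<phi>(1) test_function_continuous continuous_on_subset[OF _ subset_UNIV]
    by (intro continuous_imp_measurable_on_sets_lebesgue Ss) blast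
  have \<phi>i: "integrable ?M (\<lambda>z. \<bar>\<phi> n z - p z\<bar>)" for n
  proof (rule integrable_lebesgue_on_bounded[OF Sm])
    show "(\<lambda>z. \<bar>\<phi> n z - p z\<bar>) \<in> borel_measurable ?M" using \<phi>m pm by measurable
    show "AE z in ?M. norm \<bar>\<phi> n z - p z\<bar> \<le> 2 * \<bar>B0\<bar> + 1"
      using pb AE_space
    proof eventually_elim
      case (elim z)
      then have "\<bar>\<phi> n z\<bar> \<le> \<bar>B0\<bar> + 1" using \<phi>(1) by (simp add: space_restrict_space)
      then show ?case using elim(1) by simp
    qed
  qed
  have "(\<lambda>n. integral\<^sup>L ?M (\<lambda>z. \<bar>\<phi> n z - p z\<bar>)) \<longlonglongrightarrow> integral\<^sup>L ?M (\<lambda>z. 0)"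
  proof (rule integral_dominated_convergence[where w="\<lambda>z. 2 * \<bar>B0\<bar> + 1"])
    show "integrable ?M (\<lambda>z. 2 * \<bar>B0\<bar> + 1)"
      by (rule integrable_lebesgue_on_bounded[OF Sm, of _ "norm (2 * \<bar>B0\<bar> + 1)"]) auto
    show "AE z in ?M. (\<lambda>n. \<bar>\<phi> n z - p z\<bar>) \<longlonglongrightarrow> 0"
      using \<phi>(2)
    proof eventually_elim
      case (elim z)
      then have "(\<lambda>n. \<bar>\<phi> n z - p z\<bar>) \<longlonglongrightarrow> \<bar>p z - p z\<bar>" by (intro tendsto_intros)
      then show ?case by simp
    qed
    show "AE z in ?M. norm \<bar>\<phi> n z - p z\<bar> \<le> 2 * \<bar>B0\<bar> + 1" for n
      using pb AE_space
    proof eventually_elim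
      case (elim z)
      then have "\<bar>\<phi> n z\<bar> \<le> \<bar>B0\<bar> + 1" using \<phi>(1) by (simp add: space_restrict_space)
      then show ?case using elim(1) by simp
    qed
  qed (use borel_measurable_integrable[OF \<phi>i] in auto)
  then have lim0: "(\<lambda>n. integral\<^sup>L ?M (\<lambda>z. \<bar>\<phi> n z - p z\<bar>)) \<longlonglongrightarrow> 0" by simp
  define \<epsilon>' where "\<epsilon>' = \<epsilon> / (2 * (2 * M + 1))"
  have \<epsilon>': "0 < \<epsilon>'" using \<epsilon> M by (simp add: \<epsilon>'_def)
  have "\<forall>\<^sub>F n in sequentially. integral\<^sup>L ?M (\<lambda>z. \<bar>\<phi> n z - p z\<bar>) < \<epsilon>'"
    using order_tendstoD(2)[OF lim0 \<epsilon>'] .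
  then obtain n where n: "integral\<^sup>L ?M (\<lambda>z. \<bar>\<phi> n z - p z\<bar>) < \<epsilon>'" by (auto simp: eventually_sequentially)
  let ?f = "\<phi> n"
  let ?df = "\<lambda>z. frechet_derivative ?f (at z) b"
  have tf: "test_function S ?f" using \<phi>(1) by blast
  have one: "locally_integrable_on (\<lambda>_. 1::real) S"
    by (rule bounded_measurable_imp_locally_integrable[OF Sm, of _ 1]) auto
  have dfi: "integrable ?M ?df"
    using test_function_integrable[OF S(1) one test_function_deriv[OF tf, of b]] by simp
  define I where "I = integral\<^sup>L ?M (\<lambda>z. \<bar>?df z\<bar>)"
  have I: "0 \<le> I" unfolding I_def by (rule integral_nonneg_AE) simp
  define r where "r = \<epsilon> / (2 * (I + 1))"
  have r: "0 < r" using \<epsilon> I by (simp add: r_def)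
  have "\<bar>integral\<^sup>L ?M (\<lambda>z. (?D w z - ?D u z) * p z)\<bar> \<le> \<epsilon>"
    if w: "w \<in> sobolev_W1inf S" "AE z in ?M. \<bar>?D w z\<bar> \<le> M" "\<forall>z\<in>S. \<bar>w z - u z\<bar> \<le> r" for w
  proof -
    note Dw = sobolev_weak_deriv[OF S w(1) b] and Du = sobolev_weak_deriv[OF S u(1) b]
    have d: "(\<lambda>z. ?D w z - ?D u z) \<in> Linf S" by (rule Linf_diff[OF Dw(2) Du(2)])
    have fL: "?f \<in> Linf S" using \<phi>m \<phi>(1)
      by (auto simp: Linf_iff space_restrict_space intro!: exI[of _ "\<bar>B0\<bar> + 1"] AE_I2)
    have i1: "integrable ?M (\<lambda>z. (?D w z - ?D u z) * ?f z)"
      and i2: "integrable ?M (\<lambda>z. (?D w z - ?D u z) * p z)"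
      by (rule Linf_integrable[OF Sm] Linf_real_mult d fL p)+
    have iw: "integrable ?M (\<lambda>z. ?f z * ?D w z)" and iu: "integrable ?M (\<lambda>z. ?f z * ?D u z)"
      by (rule Linf_integrable[OF Sm] Linf_real_mult Dw(2) Du(2) fL)+
    have jw: "integrable ?M (\<lambda>z. ?df z * w z)" and ju: "integrable ?M (\<lambda>z. ?df z * u z)"
    proof -
      have l: "locally_integrable_on w S" "locally_integrable_on u S"
        using Dw(1) Du(1) by (simp_all add: has_weak_deriv_def)
      show "integrable ?M (\<lambda>z. ?df z * w z)" "integrable ?M (\<lambda>z. ?df z * u z)"
        using test_function_integrable[OF S(1) l(1) test_function_deriv[OF tf, of b]]
          test_function_integrable[OF S(1) l(2) test_function_deriv[OF tf, of b]] by simp_all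
    qed
    have ew: "integral\<^sup>L ?M (\<lambda>z. ?df z * w z) = - integral\<^sup>L ?M (\<lambda>z. ?f z * ?D w z)"
      and eu: "integral\<^sup>L ?M (\<lambda>z. ?df z * u z) = - integral\<^sup>L ?M (\<lambda>z. ?f z * ?D u z)"
      using Dw(1) Du(1) tf by (simp_all add: has_weak_deriv_def set_integral_lebesgue_on[OF Ss])
    have "integral\<^sup>L ?M (\<lambda>z. (?D w z - ?D u z) * ?f z) = integral\<^sup>L ?M (\<lambda>z. ?f z * ?D w z) - integral\<^sup>L ?M (\<lambda>z. ?f z * ?D u z)"
      using iw iu by (subst Bochner_Integration.integral_diff[symmetric]) (auto simp: algebra_simps)
    also have "\<dots> = - integral\<^sup>L ?M (\<lambda>z. ?df z * (w z - u z))"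
      using ew eu jw ju by (simp add: right_diff_distrib)
    finally have e1: "integral\<^sup>L ?M (\<lambda>z. (?D w z - ?D u z) * ?f z) = - integral\<^sup>L ?M (\<lambda>z. ?df z * (w z - u z))" .
    have "\<bar>integral\<^sup>L ?M (\<lambda>z. ?df z * (w z - u z))\<bar> \<le> integral\<^sup>L ?M (\<lambda>z. norm (?df z * (w z - u z)))"
      using integral_norm_bound[of ?M "\<lambda>z. ?df z * (w z - u z)"] by simp
    also have "\<dots> \<le> integral\<^sup>L ?M (\<lambda>z. \<bar>?df z\<bar> * r)"
      using dfi w(3) r by (intro integral_mono') (auto simp: abs_mult space_restrict_space intro!: mult_left_mono)
    also have "\<dots> = I * r" by (simp add: I_def)
    also have "\<dots> \<le> \<epsilon> / 2" using \<epsilon> I by (simp add: r_def field_simps)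
    finally have b1: "\<bar>integral\<^sup>L ?M (\<lambda>z. (?D w z - ?D u z) * ?f z)\<bar> \<le> \<epsilon> / 2" using e1 by simp
    have i3: "integrable ?M (\<lambda>z. (?D w z - ?D u z) * (p z - ?f z))"
      by (rule Linf_integrable[OF Sm] Linf_real_mult d Linf_diff[OF p fL])+
    have "\<bar>integral\<^sup>L ?M (\<lambda>z. (?D w z - ?D u z) * (p z - ?f z))\<bar> \<le> integral\<^sup>L ?M (\<lambda>z. norm ((?D w z - ?D u z) * (p z - ?f z)))"
      using integral_norm_bound[of ?M "\<lambda>z. (?D w z - ?D u z) * (p z - ?f z)"] by simp
    also have "\<dots> \<le> integral\<^sup>L ?M (\<lambda>z. (2 * M) * \<bar>?f z - p z\<bar>)"
    proof (rule integral_mono_AE)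
      show "integrable ?M (\<lambda>z. norm ((?D w z - ?D u z) * (p z - ?f z)))" using i3 by simp
      show "integrable ?M (\<lambda>z. 2 * M * \<bar>?f z - p z\<bar>)" using \<phi>i by simp
      show "AE z in ?M. norm ((?D w z - ?D u z) * (p z - ?f z)) \<le> 2 * M * \<bar>?f z - p z\<bar>"
        using w(2) u(2)
      proof eventually_elim
        case (elim z)
        then have "\<bar>?D w z - ?D u z\<bar> \<le> 2 * M" by linarith
        then have "\<bar>?D w z - ?D u z\<bar> * \<bar>?f z - p z\<bar> \<le> 2 * M * \<bar>?f z - p z\<bar>" by (rule mult_right_mono) simp
        then show ?case by (simp add: abs_mult abs_minus_commute)
      qed
    qed
    also have "\<dots> \<le> 2 * M * \<epsilon>'" using n M by (simp add: mult_left_mono)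
    also have "\<dots> \<le> \<epsilon> / 2" using \<epsilon> M by (simp add: \<epsilon>'_def field_simps)
    finally have b2: "\<bar>integral\<^sup>L ?M (\<lambda>z. (?D w z - ?D u z) * (p z - ?f z))\<bar> \<le> \<epsilon> / 2" .
    have "integral\<^sup>L ?M (\<lambda>z. (?D w z - ?D u z) * p z) =
       integral\<^sup>L ?M (\<lambda>z. (?D w z - ?D u z) * ?f z) + integral\<^sup>L ?M (\<lambda>z. (?D w z - ?D u z) * (p z - ?f z))"
      using i1 i3 by (subst Bochner_Integration.integral_add[symmetric]) (auto simp: algebra_simps)
    then show ?thesis using b1 b2 by linarith
  qed
  then show ?thesis using r by (intro exI[of _ r]) blast
qed

text \<open>The Dirichlet energy \<open>\<integral> |Du|\<^sup>2\<close>, where \<open>D\<close> collects the weak derivatives in all coordinate directions.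
  On a space-time cylinder this includes the time direction.\<close>

definition energy :: "'a::euclidean_space set \<Rightarrow> ('a \<Rightarrow> real) \<Rightarrow> real" where
  "energy S u = (\<Sum>b\<in>Basis. integral\<^sup>L (lebesgue_on S) (\<lambda>z. (weak_deriv S b u z)\<^sup>2))"

text \<open>The squared distance \<open>\<integral> |Dw - Du|\<^sup>2\<close> of the gradients.\<close>

definition energy_dist :: "'a::euclidean_space set \<Rightarrow> ('a \<Rightarrow> real) \<Rightarrow> ('a \<Rightarrow> real) \<Rightarrow> real" where
  "energy_dist S w u = (\<Sum>b\<in>Basis. integral\<^sup>L (lebesgue_on S) (\<lambda>z. (weak_deriv S b w z - weak_deriv S b u z)\<^sup>2))"

text \<open>Since \<open>|Dw - Du|\<^sup>2 = |Dw|\<^sup>2 - |Du|\<^sup>2 - 2 (Dw - Du) \<bullet> Du\<close> and the integral of the last term is small by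
  weak continuity, a uniformly close \<open>w\<close> can be far from \<open>u\<close> in gradient only by having larger energy.\<close>

lemma energy_gap:
  fixes u :: "'a::euclidean_space \<Rightarrow> real"
  assumes S: "open S" "bounded S" "convex S" "S \<noteq> {}" and M: "0 \<le> M"
    and u: "u \<in> sobolev_W1inf S" "\<And>b. b \<in> Basis \<Longrightarrow> AE z in lebesgue_on S. \<bar>weak_deriv S b u z\<bar> \<le> M"
    and \<epsilon>: "0 < \<epsilon>"
  shows "\<exists>r>0. \<forall>w. w \<in> sobolev_W1inf S \<and> (\<forall>b\<in>Basis. AE z in lebesgue_on S. \<bar>weak_deriv S b w z\<bar> \<le> M) \<and>
      (\<forall>z\<in>S. \<bar>w z - u z\<bar> \<le> r) \<longrightarrow> energy_dist S w u \<le> energy S w - energy S u + \<epsilon>"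
proof -
  let ?M = "lebesgue_on S" let ?D = "\<lambda>b. weak_deriv S b"
  have Sm: "S \<in> lmeasurable" using S by (simp add: lmeasurable_open)
  define \<epsilon>' where "\<epsilon>' = \<epsilon> / (2 * DIM('a))"
  have \<epsilon>': "0 < \<epsilon>'" using \<epsilon> by (simp add: \<epsilon>'_def)
  have "\<forall>b\<in>Basis. \<exists>r>0. \<forall>w. w \<in> sobolev_W1inf S \<and> (AE z in ?M. \<bar>?D b w z\<bar> \<le> M) \<and>
      (\<forall>z\<in>S. \<bar>w z - u z\<bar> \<le> r) \<longrightarrow> \<bar>integral\<^sup>L ?M (\<lambda>z. (?D b w z - ?D b u z) * ?D b u z)\<bar> \<le> \<epsilon>'"
    using weak_deriv_weak_continuity[OF S _ M u(1) u(2) sobolev_weak_deriv(2)[OF S u(1)] \<epsilon>'] by simp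
  then obtain r where r: "\<forall>b\<in>Basis. 0 < r b \<and> (\<forall>w. w \<in> sobolev_W1inf S \<and> (AE z in ?M. \<bar>?D b w z\<bar> \<le> M) \<and>
      (\<forall>z\<in>S. \<bar>w z - u z\<bar> \<le> r b) \<longrightarrow> \<bar>integral\<^sup>L ?M (\<lambda>z. (?D b w z - ?D b u z) * ?D b u z)\<bar> \<le> \<epsilon>')"
    using bchoice[of Basis "\<lambda>b r. 0 < r \<and> (\<forall>w. w \<in> sobolev_W1inf S \<and> (AE z in ?M. \<bar>?D b w z\<bar> \<le> M) \<and>
      (\<forall>z\<in>S. \<bar>w z - u z\<bar> \<le> r) \<longrightarrow> \<bar>integral\<^sup>L ?M (\<lambda>z. (?D b w z - ?D b u z) * ?D b u z)\<bar> \<le> \<epsilon>')"] by blast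
  define \<rho> where "\<rho> = Min (r ` Basis)"
  have \<rho>: "0 < \<rho>" using r by (simp add: \<rho>_def)
  have \<rho>r: "\<rho> \<le> r b" if "b \<in> Basis" for b using that by (simp add: \<rho>_def)
  have "energy_dist S w u \<le> energy S w - energy S u + \<epsilon>"
    if w: "w \<in> sobolev_W1inf S" "\<forall>b\<in>Basis. AE z in ?M. \<bar>?D b w z\<bar> \<le> M" "\<forall>z\<in>S. \<bar>w z - u z\<bar> \<le> \<rho>" for w
  proof -
    have "integral\<^sup>L ?M (\<lambda>z. (?D b w z - ?D b u z)\<^sup>2) \<le>
        integral\<^sup>L ?M (\<lambda>z. (?D b w z)\<^sup>2) - integral\<^sup>L ?M (\<lambda>z. (?D b u z)\<^sup>2) + 2 * \<epsilon>'" if b: "b \<in> Basis" for b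
    proof -
      note Dw = sobolev_weak_deriv(2)[OF S w(1) b] and Du = sobolev_weak_deriv(2)[OF S u(1) b]
      have "\<forall>z\<in>S. \<bar>w z - u z\<bar> \<le> r b" using w(3) \<rho>r[OF b] by fastforce
      then have le: "\<bar>integral\<^sup>L ?M (\<lambda>z. (?D b w z - ?D b u z) * ?D b u z)\<bar> \<le> \<epsilon>'"
        using r b w by blast
      have i: "integrable ?M (\<lambda>z. (?D b w z)\<^sup>2)" "integrable ?M (\<lambda>z. (?D b u z)\<^sup>2)"
        "integrable ?M (\<lambda>z. (?D b w z - ?D b u z) * ?D b u z)"
        unfolding power2_eq_square by (rule Linf_integrable[OF Sm] Linf_real_mult Linf_diff Dw Du)+
      have "(\<lambda>z. (?D b w z - ?D b u z)\<^sup>2) =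
          (\<lambda>z. (?D b w z)\<^sup>2 - (?D b u z)\<^sup>2 - 2 * ((?D b w z - ?D b u z) * ?D b u z))"
        by (auto simp: fun_eq_iff power2_eq_square algebra_simps)
      then have "integral\<^sup>L ?M (\<lambda>z. (?D b w z - ?D b u z)\<^sup>2) =
          integral\<^sup>L ?M (\<lambda>z. (?D b w z)\<^sup>2) - integral\<^sup>L ?M (\<lambda>z. (?D b u z)\<^sup>2)
          - 2 * integral\<^sup>L ?M (\<lambda>z. (?D b w z - ?D b u z) * ?D b u z)"
        using i by simp
      then show ?thesis using le by linarith
    qed
    then have "energy_dist S w u \<le> (\<Sum>b\<in>Basis.
        integral\<^sup>L ?M (\<lambda>z. (?D b w z)\<^sup>2) - integral\<^sup>L ?M (\<lambda>z. (?D b u z)\<^sup>2) + 2 * \<epsilon>')"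
      unfolding energy_dist_def by (intro sum_mono) auto
    also have "\<dots> = energy S w - energy S u + DIM('a) * (2 * \<epsilon>')"
      by (simp add: energy_def sum.distrib sum_subtractf)
    also have "DIM('a) * (2 * \<epsilon>') = \<epsilon>" by (simp add: \<epsilon>'_def)
    finally show ?thesis .
  qed
  then show ?thesis using \<rho> by (intro exI[of _ \<rho>]) blast
qed

lemma energy_bound:
  fixes u :: "'a::euclidean_space \<Rightarrow> real"
  assumes S: "open S" "bounded S" "convex S" "S \<noteq> {}" and M: "0 \<le> M"
    and u: "u \<in> sobolev_W1inf S" "\<And>b. b \<in> Basis \<Longrightarrow> AE z in lebesgue_on S. \<bar>weak_deriv S b u z\<bar> \<le> M"
  shows "energy S u \<le> DIM('a) * (M\<^sup>2 * measure lebesgue S)"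
proof -
  let ?M = "lebesgue_on S"
  have Sm: "S \<in> lmeasurable" using S by (simp add: lmeasurable_open)
  have "integral\<^sup>L ?M (\<lambda>z. (weak_deriv S b u z)\<^sup>2) \<le> M\<^sup>2 * measure lebesgue S" if b: "b \<in> Basis" for b
  proof -
    have "integral\<^sup>L ?M (\<lambda>z. (weak_deriv S b u z)\<^sup>2) \<le> integral\<^sup>L ?M (\<lambda>z. M\<^sup>2)"
    proof (rule integral_mono_AE)
      show "integrable ?M (\<lambda>z. (weak_deriv S b u z)\<^sup>2)"
        unfolding power2_eq_square by (rule Linf_integrable[OF Sm] Linf_real_mult sobolev_weak_deriv(2)[OF S u(1) b])+
      show "integrable ?M (\<lambda>z. M\<^sup>2)" by (rule integrable_lebesgue_on_bounded[OF Sm, of _ "M\<^sup>2"]) auto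
      show "AE z in ?M. (weak_deriv S b u z)\<^sup>2 \<le> M\<^sup>2"
        using u(2)[OF b] by eventually_elim (metis abs_le_square_iff abs_of_nonneg M)
    qed
    also have "\<dots> = M\<^sup>2 * measure lebesgue S" using Sm by (simp add: measure_restrict_space space_restrict_space fmeasurableD)
    finally show ?thesis .
  qed
  then have "energy S u \<le> (\<Sum>b\<in>(Basis::'a set). M\<^sup>2 * measure lebesgue S)"
    unfolding energy_def by (intro sum_mono) auto
  then show ?thesis by simp
qed

section \<open>Limits of the approximating sequence\<close>

text \<open>The \<open>L\<^sup>2\<close> bounds on the increments imply summable \<open>L\<^sup>1\<close> norms, because the domain has finite
  measure; hence the series of increments converges absolutely almost everywhere.\<close>

lemma AE_convergent_of_L2_geometric:
  fixes f :: "nat \<Rightarrow> 'a::euclidean_space \<Rightarrow> real"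
  assumes S: "S \<in> lmeasurable" and f: "\<And>k. f k \<in> Linf S"
    and L2: "\<And>k. integral\<^sup>L (lebesgue_on S) (\<lambda>z. (f (Suc k) z - f k z)\<^sup>2) \<le> (1/4) ^ k"
  shows "AE z in lebesgue_on S. convergent (\<lambda>k. f k z)"
proof -
  let ?M = "lebesgue_on S"
  define a where "a k z = f (Suc k) z - f k z" for k z
  have aL: "a k \<in> Linf S" for k unfolding a_def[abs_def] by (rule Linf_diff[OF f f])
  have ai: "integrable ?M (a k)" for k by (rule Linf_integrable[OF S aL])
  have a2: "integrable ?M (\<lambda>z. (a k z)\<^sup>2)" for k
    unfolding power2_eq_square by (rule Linf_integrable[OF S] Linf_real_mult aL)+
  have const: "integrable ?M (\<lambda>z. c)" for c :: real
    by (rule integrable_lebesgue_on_bounded[OF S, of _ "\<bar>c\<bar>"]) auto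
  define C where "C = (measure lebesgue S + 1) / 2"
  have L1: "integral\<^sup>L ?M (\<lambda>z. \<bar>a k z\<bar>) \<le> C * (1/2) ^ k" for k
  proof -
    \<comment> \<open>Young's inequality with weight \<open>2\<^sup>k\<close>\<close>
    have pt: "\<bar>x\<bar> \<le> ((1/2) ^ k + 2 ^ k * x\<^sup>2) / 2" for x :: real
    proof -
      have "0 \<le> (1 - 2 ^ k * \<bar>x\<bar>)\<^sup>2" by simp
      then have "2 * (2 ^ k * \<bar>x\<bar>) \<le> 1 + (2 ^ k)\<^sup>2 * x\<^sup>2" by (simp add: power2_diff power_mult_distrib)
      then have "2 ^ k * (2 * \<bar>x\<bar>) \<le> 2 ^ k * ((1/2) ^ k + 2 ^ k * x\<^sup>2)"
        by (simp add: power2_eq_square algebra_simps flip: power_mult_distrib)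
      then show ?thesis by simp
    qed
    have "integral\<^sup>L ?M (\<lambda>z. \<bar>a k z\<bar>) \<le> integral\<^sup>L ?M (\<lambda>z. ((1/2) ^ k + 2 ^ k * (a k z)\<^sup>2) / 2)"
      using pt ai a2 const by (intro integral_mono) auto
    also have "\<dots> = ((1/2) ^ k * measure lebesgue S + 2 ^ k * integral\<^sup>L ?M (\<lambda>z. (a k z)\<^sup>2)) / 2"
      using a2 const S by (simp add: measure_restrict_space space_restrict_space fmeasurableD)
    also have "\<dots> \<le> ((1/2) ^ k * measure lebesgue S + 2 ^ k * (1/4) ^ k) / 2"
      using L2[of k] by (simp add: a_def)
    also have "\<dots> = C * (1/2) ^ k" by (simp add: C_def field_simps flip: power_mult_distrib)
    finally show ?thesis .
  qed
  have nn: "(\<integral>\<^sup>+z. ennreal \<bar>a k z\<bar> \<partial>?M) = ennreal (integral\<^sup>L ?M (\<lambda>z. \<bar>a k z\<bar>))" for k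
    using ai by (intro nn_integral_eq_integral) auto
  have "summable (\<lambda>k. C * (1/2) ^ k)" by (intro summable_mult summable_geometric) simp
  then have sL: "summable (\<lambda>k. integral\<^sup>L ?M (\<lambda>z. \<bar>a k z\<bar>))"
    by (rule summable_comparison_test') (use L1 in auto)
  have em: "(\<lambda>z. ennreal \<bar>a k z\<bar>) \<in> borel_measurable ?M" for k
    using borel_measurable_integrable[OF ai[of k]] by measurable
  have "(\<lambda>z. \<Sum>k. ennreal \<bar>a k z\<bar>) \<in> borel_measurable ?M"
    by (intro borel_measurable_suminf_order em)
  note sm = this
  have "(\<integral>\<^sup>+z. (\<Sum>k. ennreal \<bar>a k z\<bar>) \<partial>?M) = (\<Sum>k. \<integral>\<^sup>+z. ennreal \<bar>a k z\<bar> \<partial>?M)"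
    by (rule nn_integral_suminf[OF em])
  also have "\<dots> = (\<Sum>k. ennreal (integral\<^sup>L ?M (\<lambda>z. \<bar>a k z\<bar>)))" by (simp only: nn)
  also have "\<dots> \<noteq> \<infinity>" unfolding infinity_ennreal_def
    by (rule ennreal_suminf_neq_top[OF sL]) (rule integral_nonneg_AE, simp)
  finally have "AE z in ?M. (\<Sum>k. ennreal \<bar>a k z\<bar>) \<noteq> \<infinity>"
    by (rule nn_integral_PInf_AE[OF sm])
  then show ?thesis
  proof eventually_elim
    case (elim z)
    then have "summable (\<lambda>k. \<bar>a k z\<bar>)" by (intro summable_suminf_not_top) auto
    then have "summable (\<lambda>k. a k z)" by (rule summable_rabs_cancel)
    then have "(\<lambda>n. \<Sum>k<n. a k z) \<longlonglongrightarrow> (\<Sum>k. a k z)" by (rule summable_LIMSEQ)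
    moreover have "(\<Sum>k<n. a k z) = f n z - f 0 z" for n
      unfolding a_def by (rule sum_lessThan_telescope)
    ultimately have "(\<lambda>n. f n z - f 0 z + f 0 z) \<longlonglongrightarrow> (\<Sum>k. a k z) + f 0 z"
      by (intro tendsto_add tendsto_const) simp
    then show ?case by (auto simp: convergent_def)
  qed
qed

text \<open>No weak-star compactness is needed: the weak derivative of the uniform limit is the almost everywhere
  limit of the derivatives, by dominated convergence in the defining identity.\<close>

lemma W1inf_limit:
  fixes u :: "nat \<Rightarrow> 'a::euclidean_space \<Rightarrow> real"
  assumes S: "open S" "bounded S" "convex S" "S \<noteq> {}" and M: "0 \<le> M"
    and u: "\<And>k. u k \<in> W1inf S"
    and ub: "\<And>k b. b \<in> Basis \<Longrightarrow> AE z in lebesgue_on S. \<bar>weak_deriv S b (u k) z\<bar> \<le> M"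
    and N: "\<And>k m. k \<le> m \<Longrightarrow> energy_dist S (u m) (u k) \<le> (1/4) ^ k"
    and d: "\<And>k m. k \<le> m \<Longrightarrow> sup_dist (closure S) (u k) (u m) < (1/2) ^ k"
  shows "\<exists>w\<in>W1inf S. (\<forall>k. \<forall>z\<in>closure S. \<bar>u k z - w z\<bar> \<le> (1/2) ^ k) \<and>
    (\<forall>b\<in>Basis. AE z in lebesgue_on S. (\<lambda>k. weak_deriv S b (u k) z) \<longlonglongrightarrow> weak_deriv S b w z)"
proof -
  let ?M = "lebesgue_on S" let ?K = "closure S"
  have Sm: "S \<in> lmeasurable" using S by (simp add: lmeasurable_open)
  have Ss: "S \<in> sets lebesgue" using S(1) by auto
  have cK: "compact ?K" using S(2) by simp
  have SK: "S \<subseteq> ?K" by (rule closure_subset)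
  have uc: "continuous_on ?K (u k)" and us: "u k \<in> sobolev_W1inf S" for k using u[of k] by (auto simp: W1inf_def)
  have dp: "\<bar>u k z - u m z\<bar> < (1/2) ^ k" if "k \<le> m" "z \<in> ?K" for k m z
    using sup_dist_upper[OF cK uc uc that(2), of k m] d[OF that(1)] by linarith
  have h0: "(\<lambda>k. (1/2::real) ^ k) \<longlonglongrightarrow> 0" by (rule LIMSEQ_realpow_zero) auto
  have conv: "convergent (\<lambda>k. u k z)" if z: "z \<in> ?K" for z
  proof -
    have "Cauchy (\<lambda>k. u k z)"
    proof (rule CauchyI)
      fix e :: real assume "0 < e"
      then have "\<forall>\<^sub>F k in sequentially. (1/2::real) ^ k < e / 2" using order_tendstoD(2)[OF h0, of "e / 2"] by simp
      then obtain n where n: "(1/2::real) ^ n < e / 2" by (auto simp: eventually_sequentially)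
      have "norm (u k z - u m z) < e" if "n \<le> k" "n \<le> m" for k m
        using dp[OF that(1) z] dp[OF that(2) z] n unfolding real_norm_def by linarith
      then show "\<exists>M. \<forall>m\<ge>M. \<forall>n\<ge>M. norm (u m z - u n z) < e" by blast
    qed
    then show ?thesis by (simp add: Cauchy_convergent_iff)
  qed
  define w where "w z = lim (\<lambda>k. u k z)" for z
  have lim: "(\<lambda>k. u k z) \<longlonglongrightarrow> w z" if "z \<in> ?K" for z
    using conv[OF that] by (simp add: w_def convergent_LIMSEQ_iff)
  have uw: "\<bar>u k z - w z\<bar> \<le> (1/2) ^ k" if z: "z \<in> ?K" for k z
  proof (rule LIMSEQ_le_const2)
    show "(\<lambda>m. \<bar>u k z - u m z\<bar>) \<longlonglongrightarrow> \<bar>u k z - w z\<bar>" by (intro tendsto_intros lim[OF z])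
    show "\<exists>N. \<forall>m\<ge>N. \<bar>u k z - u m z\<bar> \<le> (1/2) ^ k" using dp[OF _ z] by (intro exI[of _ k]) (auto intro: less_imp_le)
  qed
  have wc: "continuous_on ?K w"
  proof (rule uniform_limit_theorem[where F=sequentially])
    show "\<forall>\<^sub>F k in sequentially. continuous_on ?K (u k)" using uc by simp
    show "uniform_limit ?K u w sequentially"
    proof (rule uniform_limitI)
      fix e :: real assume "0 < e"
      then have "\<forall>\<^sub>F k in sequentially. (1/2::real) ^ k < e" using order_tendstoD(2)[OF h0] by simp
      then show "\<forall>\<^sub>F k in sequentially. \<forall>z\<in>?K. dist (u k z) (w z) < e"
        by eventually_elim (use uw in \<open>fastforce simp: dist_real_def intro: le_less_trans\<close>)
    qed
  qed simp
  have meas: "f \<in> borel_measurable ?M" if "continuous_on ?K f" for f :: "'a \<Rightarrow> real"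
    by (rule continuous_imp_measurable_on_sets_lebesgue[OF continuous_on_subset[OF that SK] Ss])
  obtain B where B: "B \<ge> 0" "\<forall>z\<in>?K. norm (w z) \<le> B"
    using continuous_on_compact_norm_bound[OF cK wc] by blast
  have wL: "w \<in> Linf S"
    using meas[OF wc] AE_lebesgue_on_I[OF SK B(2)] by (auto simp: Linf_iff)
  have ub1: "\<bar>u k z\<bar> \<le> B + 1" if "z \<in> ?K" for k z
  proof -
    have "(1/2::real) ^ k \<le> 1" by (simp add: power_le_one)
    moreover have "\<bar>w z\<bar> \<le> B" using B(2) that by auto
    ultimately show ?thesis using uw[OF that, of k] by linarith
  qed
  have deriv: "\<exists>g\<in>Linf S. has_weak_deriv S b w g \<and> (AE z in ?M. (\<lambda>k. weak_deriv S b (u k) z) \<longlonglongrightarrow> g z)"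
    if b: "b \<in> Basis" for b
  proof -
    let ?D = "\<lambda>k. weak_deriv S b (u k)"
    note Du = sobolev_weak_deriv[OF S us b]
    have Dm: "?D k \<in> borel_measurable ?M" for k using Du(2) by (simp add: Linf_iff)
    have "AE z in ?M. convergent (\<lambda>k. ?D k z)"
    proof (rule AE_convergent_of_L2_geometric[OF Sm Du(2)])
      fix k
      have "integral\<^sup>L ?M (\<lambda>z. (?D (Suc k) z - ?D k z)\<^sup>2) \<le> energy_dist S (u (Suc k)) (u k)"
        unfolding energy_dist_def
        by (rule member_le_sum[OF b, where f="\<lambda>b. integral\<^sup>L ?M (\<lambda>z. (weak_deriv S b (u (Suc k)) z - weak_deriv S b (u k) z)\<^sup>2)"]) auto
      then show "integral\<^sup>L ?M (\<lambda>z. (?D (Suc k) z - ?D k z)\<^sup>2) \<le> (1/4) ^ k" using N[of k "Suc k"] by simp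
    qed
    moreover define g where "g z = lim (\<lambda>k. ?D k z)" for z
    ultimately have Dg: "AE z in ?M. (\<lambda>k. ?D k z) \<longlonglongrightarrow> g z"
      by (simp add: convergent_LIMSEQ_iff)
    have gm: "g \<in> borel_measurable ?M" unfolding g_def[abs_def] by (rule borel_measurable_lim_metric[OF Dm])
    have "AE z in ?M. \<forall>k. \<bar>?D k z\<bar> \<le> M" using ub[OF b] by (simp add: AE_all_countable)
    with Dg have gb: "AE z in ?M. norm (g z) \<le> M"
    proof eventually_elim
      case (elim z)
      have "(\<lambda>k. \<bar>?D k z\<bar>) \<longlonglongrightarrow> \<bar>g z\<bar>" using elim(1) by (rule tendsto_rabs)
      then show ?case using elim(2) by (auto intro: LIMSEQ_le_const2)
    qed
    have gL: "g \<in> Linf S" using gm gb by (auto simp: Linf_iff)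
    have lw: "locally_integrable_on w S"
      using bounded_measurable_imp_locally_integrable[OF Sm meas[OF wc] AE_lebesgue_on_I[OF SK B(2)]] .
    have lg: "locally_integrable_on g S"
      using bounded_measurable_imp_locally_integrable[OF Sm gm gb] .
    have one: "locally_integrable_on (\<lambda>_. 1::real) S"
      by (rule bounded_measurable_imp_locally_integrable[OF Sm, of _ 1]) auto
    have "(LINT x:S|lebesgue. frechet_derivative \<phi> (at x) b *\<^sub>R w x) = - (LINT x:S|lebesgue. \<phi> x *\<^sub>R g x)"
      if \<phi>: "test_function S \<phi>" for \<phi>
    proof -
      let ?d = "\<lambda>x. frechet_derivative \<phi> (at x) b"
      have d: "integrable ?M ?d" using test_function_integrable[OF S(1) one test_function_deriv[OF \<phi>, of b]] by simp
      have p: "integrable ?M \<phi>" using test_function_integrable[OF S(1) one \<phi>] by simp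
      have lim1: "(\<lambda>k. integral\<^sup>L ?M (\<lambda>x. ?d x * u k x)) \<longlonglongrightarrow> integral\<^sup>L ?M (\<lambda>x. ?d x * w x)"
      proof (rule integral_dominated_convergence[where w="\<lambda>x. \<bar>?d x\<bar> * (B + 1)"])
        show "AE x in ?M. (\<lambda>k. ?d x * u k x) \<longlonglongrightarrow> ?d x * w x"
          using SK by (intro AE_I2 tendsto_intros lim) (auto simp: space_restrict_space)
        show "AE x in ?M. norm (?d x * u k x) \<le> \<bar>?d x\<bar> * (B + 1)" for k
          using SK ub1[of _ k] by (intro AE_I2) (auto simp: space_restrict_space abs_mult intro!: mult_left_mono)
        show "(\<lambda>x. ?d x * w x) \<in> borel_measurable ?M"
          by (rule borel_measurable_times[OF borel_measurable_integrable[OF d] meas[OF wc]])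
        show "(\<lambda>x. ?d x * u k x) \<in> borel_measurable ?M" for k
          by (rule borel_measurable_times[OF borel_measurable_integrable[OF d] meas[OF uc]])
        show "integrable ?M (\<lambda>x. \<bar>?d x\<bar> * (B + 1))" using d by simp
      qed
      have eqk: "integral\<^sup>L ?M (\<lambda>x. ?d x * u k x) = - integral\<^sup>L ?M (\<lambda>x. \<phi> x * ?D k x)" for k
        using Du(1)[of k] \<phi> by (simp add: has_weak_deriv_def set_integral_lebesgue_on[OF Ss])
      have lim2: "(\<lambda>k. integral\<^sup>L ?M (\<lambda>x. \<phi> x * ?D k x)) \<longlonglongrightarrow> integral\<^sup>L ?M (\<lambda>x. \<phi> x * g x)"
      proof (rule integral_dominated_convergence[where w="\<lambda>x. \<bar>\<phi> x\<bar> * M"])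
        show "AE x in ?M. (\<lambda>k. \<phi> x * ?D k x) \<longlonglongrightarrow> \<phi> x * g x"
          using Dg by eventually_elim (intro tendsto_intros)
        show "AE x in ?M. norm (\<phi> x * ?D k x) \<le> \<bar>\<phi> x\<bar> * M" for k
          using ub[OF b, of k] by eventually_elim (simp add: abs_mult mult_left_mono)
        show "(\<lambda>x. \<phi> x * g x) \<in> borel_measurable ?M"
          by (rule borel_measurable_times[OF borel_measurable_integrable[OF p] gm])
        show "(\<lambda>x. \<phi> x * ?D k x) \<in> borel_measurable ?M" for k
          by (rule borel_measurable_times[OF borel_measurable_integrable[OF p] Dm])
        show "integrable ?M (\<lambda>x. \<bar>\<phi> x\<bar> * M)" using p by simp
      qed
      have "integral\<^sup>L ?M (\<lambda>x. ?d x * w x) = - integral\<^sup>L ?M (\<lambda>x. \<phi> x * g x)"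
        using LIMSEQ_unique[OF lim1[unfolded eqk] tendsto_minus[OF lim2]] .
      then show ?thesis by (simp add: set_integral_lebesgue_on[OF Ss])
    qed
    then have "has_weak_deriv S b w g" using lw lg by (simp add: has_weak_deriv_def)
    then show ?thesis using gL Dg by blast
  qed
  have wW: "w \<in> W1inf S" using wL wc deriv by (auto simp: W1inf_def sobolev_W1inf_def)
  have "AE z in ?M. (\<lambda>k. weak_deriv S b (u k) z) \<longlonglongrightarrow> weak_deriv S b w z" if b: "b \<in> Basis" for b
  proof -
    obtain g where g: "has_weak_deriv S b w g" "AE z in ?M. (\<lambda>k. weak_deriv S b (u k) z) \<longlonglongrightarrow> g z"
      using deriv[OF b] by blast
    from weak_deriv_AE_eq[OF S g(1)] g(2) show ?thesis by eventually_elim simp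
  qed
  then show ?thesis using wW uw by blast
qed

section \<open>The nonlinearity \<open>\<sigma>\<close>\<close>

lemma norm_sigma_le: "norm (sigma p) \<le> 1"
proof -
  have "norm p \<le> 1 + (norm p)\<^sup>2"
  proof (cases "norm p \<le> 1")
    case False
    then have "norm p * 1 \<le> norm p * norm p" by (intro mult_left_mono) auto
    then show ?thesis by (simp add: power2_eq_square)
  qed (smt (verit) zero_le_power2)
  moreover have "0 < 1 + (norm p)\<^sup>2" by (simp add: add_pos_nonneg)
  ultimately show ?thesis by (simp add: sigma_def divide_simps)
qed

lemma continuous_on_sigma: "continuous_on UNIV (sigma :: real^'n \<Rightarrow> real^'n)"
proof -
  have "1 + (norm p)\<^sup>2 \<noteq> 0" for p :: "real^'n" by (metis add_pos_nonneg less_irrefl zero_le_power2 zero_less_one)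
  then show ?thesis unfolding sigma_def[abs_def] by (intro continuous_intros) auto
qed

lemma Dx_measurable:
  fixes u :: "(real^'n) \<times> real \<Rightarrow> real"
  assumes "\<And>i. weak_deriv S (axis i 1, 0) u \<in> borel_measurable (lebesgue_on S)"
  shows "Dx S u \<in> borel_measurable (lebesgue_on S)"
proof (subst borel_measurable_euclidean_space, rule ballI)
  fix e :: "real^'n" assume "e \<in> Basis"
  then obtain i where "e = axis i 1" by (auto simp: Basis_vec_def)
  then have "(\<lambda>z. Dx S u z \<bullet> e) = weak_deriv S (axis i 1, 0) u" by (simp add: fun_eq_iff Dx_def inner_axis)
  then show "(\<lambda>z. Dx S u z \<bullet> e) \<in> borel_measurable (lebesgue_on S)" using assms by simp
qed

section \<open>Passing to the limit in the integral identity\<close>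

text \<open>In the flux identity for \<open>u k\<close> the term \<open>v\<^sub>t\<close> may be replaced by \<open>\<sigma>(Du)\<close> up to an error that
  tends to zero; almost everywhere convergence of the gradients does the rest.\<close>

lemma weak_solution_of_limit:
  fixes \<Omega> :: "(real^'n) set" and T :: real and u :: "nat \<Rightarrow> (real^'n) \<times> real \<Rightarrow> real"
    and v :: "nat \<Rightarrow> (real^'n) \<times> real \<Rightarrow> real^'n" and w :: "(real^'n) \<times> real \<Rightarrow> real"
  assumes dom: "smooth_bounded_convex_domain \<Omega>" and T: "0 < T"
    and vs_normal: "\<forall>t\<in>{0..T}. \<forall>x\<in>frontier \<Omega>. vs (x, t) \<bullet> outer_normal \<Omega> x = 0"
    and u: "\<And>k. u k \<in> W1inf (cylinder \<Omega> T)" and u_initial: "\<And>k x. x \<in> \<Omega> \<Longrightarrow> u k (x, 0) = u0 x"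
    and flux: "\<And>k. admissible_flux \<Omega> T vs (u k) (v k)"
    and close: "\<And>k. (LINT z:cylinder \<Omega> T|lebesgue.
        norm (Dt (cylinder \<Omega> T) (v k) z - sigma (Dx (cylinder \<Omega> T) (u k) z))) \<le> \<epsilon> k"
      and \<epsilon>: "\<epsilon> \<longlonglongrightarrow> 0"
    and w: "w \<in> W1inf (cylinder \<Omega> T)"
    and uw: "\<And>k z. z \<in> closure (cylinder \<Omega> T) \<Longrightarrow> \<bar>u k z - w z\<bar> \<le> (1/2) ^ k"
    and Duw: "\<And>b. b \<in> Basis \<Longrightarrow> AE z in lebesgue_on (cylinder \<Omega> T).
        (\<lambda>k. weak_deriv (cylinder \<Omega> T) b (u k) z) \<longlonglongrightarrow> weak_deriv (cylinder \<Omega> T) b w z"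
  shows "weak_solution \<Omega> T u0 w"
  unfolding weak_solution_def
proof (intro conjI w allI impI, elim conjE)
  fix \<zeta> :: "(real^'n) \<times> real \<Rightarrow> real" and s :: real
  define S where "S = cylinder \<Omega> T"
  assume \<zeta>: "smooth_on (closure (cylinder \<Omega> T)) \<zeta>" and s: "s \<in> {0..T}"
  let ?M = "lebesgue_on S" let ?K = "closure S"
  define c where "c = cylinder \<Omega> s"
  let ?Mc = "lebesgue_on c"
  have dom': "open \<Omega>" "bounded \<Omega>" "convex \<Omega>" "\<Omega> \<noteq> {}"
    using dom by (auto simp: smooth_bounded_convex_domain_def)
  have K: "?K = closure \<Omega> \<times> {0..T}" unfolding S_def cylinder_def by (rule closure_cylinder_Times[OF T])
  have S: "open S" "bounded S" "convex S" "S \<noteq> {}"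
    unfolding S_def cylinder_def using dom' T by (auto intro: open_Times bounded_Times convex_Times)
  have opc: "open c" unfolding c_def cylinder_def using dom' by (auto intro: open_Times)
  have cS: "c \<subseteq> S" using s by (auto simp: c_def S_def cylinder_def)
  have Ss: "S \<in> sets lebesgue" and cs: "c \<in> sets lebesgue" and Os: "\<Omega> \<in> sets lebesgue" using S(1) opc dom'(1) by auto
  have Sm: "S \<in> lmeasurable" using S by (simp add: lmeasurable_open)
  have cm: "c \<in> lmeasurable" using opc bounded_subset[OF S(2) cS] by (simp add: lmeasurable_open)
  have Om: "\<Omega> \<in> lmeasurable" using dom' by (simp add: lmeasurable_open)
  have cK: "compact ?K" using S(2) by simp
  have SK: "S \<subseteq> ?K" by (rule closure_subset)
  have cK': "c \<subseteq> ?K" using cS SK by blast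
  have AEc: "AE z in ?Mc. P z" if "AE z in ?M. P z" for P
    using that cS unfolding AE_lebesgue_on_iff[OF Ss] AE_lebesgue_on_iff[OF cs] by (auto elim!: eventually_mono)
  have uc: "continuous_on ?K (u k)" and us: "u k \<in> sobolev_W1inf S" for k using u[of k] by (auto simp: W1inf_def S_def)
  have wc: "continuous_on ?K w" and ws: "w \<in> sobolev_W1inf S" using w by (auto simp: W1inf_def S_def)
  obtain U where U: "open U" "?K \<subseteq> U" "Cinf_on U \<zeta>" using \<zeta> unfolding smooth_on_def S_def by (elim exE conjE)
  have c\<zeta>: "continuous_on ?K \<zeta>" "continuous_on ?K (classical_Dt \<zeta>)" "continuous_on ?K (classical_Dx \<zeta>)"
    using continuous_on_subset[OF _ U(2)] Cinf_on_continuous[OF U(3)] classical_derivatives_continuous[OF U(3)] by blast+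
  obtain B0 where B0: "0 \<le> B0" "\<forall>z\<in>?K. norm (\<zeta> z) \<le> B0" using continuous_on_compact_norm_bound[OF cK c\<zeta>(1)] by blast
  obtain B1 where B1: "0 \<le> B1" "\<forall>z\<in>?K. norm (classical_Dt \<zeta> z) \<le> B1" using continuous_on_compact_norm_bound[OF cK c\<zeta>(2)] by blast
  obtain B2 where B2: "0 \<le> B2" "\<forall>z\<in>?K. norm (classical_Dx \<zeta> z) \<le> B2" using continuous_on_compact_norm_bound[OF cK c\<zeta>(3)] by blast
  obtain B where B: "0 \<le> B" "\<forall>z\<in>?K. norm (w z) \<le> B" using continuous_on_compact_norm_bound[OF cK wc] by blast
  have ub: "\<bar>u k z\<bar> \<le> B + 1" if "z \<in> ?K" for k z
  proof -
    have "(1/2::real) ^ k \<le> 1" by (simp add: power_le_one)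
    moreover have "\<bar>w z\<bar> \<le> B" using B(2) that by auto
    moreover have "\<bar>u k z - w z\<bar> \<le> (1/2) ^ k" using uw that by (simp add: S_def)
    ultimately show ?thesis by linarith
  qed
  have ulim: "(\<lambda>k. u k z) \<longlonglongrightarrow> w z" if "z \<in> ?K" for z
  proof (rule LIM_zero_cancel, rule Lim_null_comparison)
    show "\<forall>\<^sub>F k in sequentially. norm (u k z - w z) \<le> (1/2) ^ k" using uw that by (simp add: S_def)
    show "(\<lambda>k. (1/2::real) ^ k) \<longlonglongrightarrow> 0" by (rule LIMSEQ_realpow_zero) auto
  qed
  have meas: "f \<in> borel_measurable ?Mc" if "continuous_on ?K f" for f :: "(real^'n) \<times> real \<Rightarrow> 'b::euclidean_space"
    by (rule continuous_imp_measurable_on_sets_lebesgue[OF continuous_on_subset[OF that cK'] cs])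
  have sm: "(\<lambda>z. sigma (Dx S f z)) \<in> borel_measurable ?M" if f: "f \<in> sobolev_W1inf S" for f
  proof -
    have "Dx S f \<in> borel_measurable ?M"
      using sobolev_weak_deriv(2)[OF S f Basis_space_time(1)] by (intro Dx_measurable) (simp add: Linf_iff)
    then show ?thesis
      by (rule measurable_compose) (rule borel_measurable_continuous_onI[OF continuous_on_sigma])
  qed
  have smc: "(\<lambda>z. sigma (Dx S f z)) \<in> borel_measurable ?Mc" if f: "f \<in> sobolev_W1inf S" for f
    by (rule measurable_restrict_mono[OF sm[OF f] cS])
  define J where "J f z = - f z * classical_Dt \<zeta> z + sigma (Dx S f z) \<bullet> classical_Dx \<zeta> z" for f z
  have Jm: "J f \<in> borel_measurable ?Mc" if "continuous_on ?K f" "f \<in> sobolev_W1inf S" for f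
    unfolding J_def[abs_def] using meas[OF that(1)] meas[OF c\<zeta>(2)] meas[OF c\<zeta>(3)] smc[OF that(2)] by measurable
  have Jb: "norm (J (u k) z) \<le> (B + 1) * B1 + B2" if z: "z \<in> ?K" for k z
  proof -
    have "\<bar>u k z * classical_Dt \<zeta> z\<bar> \<le> (B + 1) * B1" unfolding abs_mult
      using ub[OF z] B1 z B(1) by (intro mult_mono) auto
    moreover have "\<bar>sigma (Dx S (u k) z) \<bullet> classical_Dx \<zeta> z\<bar> \<le> norm (sigma (Dx S (u k) z)) * norm (classical_Dx \<zeta> z)"
      by (rule Cauchy_Schwarz_ineq2)
    moreover have "norm (sigma (Dx S (u k) z)) * norm (classical_Dx \<zeta> z) \<le> 1 * B2"
      using B2 z norm_sigma_le by (intro mult_mono) auto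
    ultimately show ?thesis unfolding J_def real_norm_def by linarith
  qed
  have const: "integrable ?Mc (\<lambda>z. C)" for C :: real
    by (rule integrable_lebesgue_on_bounded[OF cm, of _ "\<bar>C\<bar>"]) auto
  have Jlim: "(\<lambda>k. integral\<^sup>L ?Mc (J (u k))) \<longlonglongrightarrow> integral\<^sup>L ?Mc (J w)"
  proof (rule integral_dominated_convergence[where w="\<lambda>z. (B + 1) * B1 + B2"])
    show "J w \<in> borel_measurable ?Mc" by (rule Jm[OF wc ws])
    show "J (u k) \<in> borel_measurable ?Mc" for k by (rule Jm[OF uc us])
    show "AE z in ?Mc. norm (J (u k) z) \<le> (B + 1) * B1 + B2" for k
      using Jb by (intro AE_lebesgue_on_I[OF cK']) blast
    have "AE z in ?M. \<forall>i. (\<lambda>k. weak_deriv S (axis i 1, 0) (u k) z) \<longlonglongrightarrow> weak_deriv S (axis i 1, 0) w z"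
      unfolding AE_all_countable S_def using Duw[OF Basis_space_time(1)] by (intro allI)
    then have "AE z in ?M. (\<lambda>k. J (u k) z) \<longlonglongrightarrow> J w z" using AE_space
    proof eventually_elim
      case (elim z)
      have z: "z \<in> ?K" using elim(2) SK by (auto simp: space_restrict_space)
      have "(\<lambda>k. Dx S (u k) z) \<longlonglongrightarrow> Dx S w z"
        by (rule vec_tendstoI) (use elim(1) in \<open>simp add: Dx_def\<close>)
      moreover have "isCont sigma (Dx S w z)"
        by (rule continuous_on_interior[OF continuous_on_sigma]) simp
      ultimately have "(\<lambda>k. sigma (Dx S (u k) z)) \<longlonglongrightarrow> sigma (Dx S w z)" by (rule isCont_tendsto_compose[rotated])
      then show ?case unfolding J_def by (intro tendsto_intros ulim[OF z])
    qed
    then show "AE z in ?Mc. (\<lambda>k. J (u k) z) \<longlonglongrightarrow> J w z" by (rule AEc)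
  qed (rule const)
  have vW: "v k \<in> W1inf S" and vfr: "\<forall>z\<in>frontier S. v k z = vs z"
    and vdiv: "AE z in ?M. divx S (v k) z = u k z" for k
    using flux[of k, unfolded admissible_flux_def W1inf_dirichlet_def, folded S_def] by auto
  have vn: "\<forall>t\<in>{0..T}. \<forall>x\<in>frontier \<Omega>. v k (x, t) \<bullet> outer_normal \<Omega> x = 0" for k
  proof (intro ballI)
    fix t x assume "t \<in> {0..T}" "x \<in> frontier \<Omega>"
    then have "(x, t) \<in> closure S" "x \<notin> \<Omega>"
      unfolding K using dom'(1) by (auto simp: frontier_def interior_open)
    then have "(x, t) \<in> frontier S" using S(1) by (auto simp: frontier_def interior_open S_def cylinder_def)
    then show "v k (x, t) \<bullet> outer_normal \<Omega> x = 0" using vfr vs_normal \<open>t \<in> {0..T}\<close> \<open>x \<in> frontier \<Omega>\<close> by simp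
  qed
  have tL: "Dt S (v k) \<in> Linf S" for k
  proof -
    have "v k \<in> sobolev_W1inf S" using vW[of k] by (simp add: W1inf_def)
    then show ?thesis unfolding Dt_def by (rule sobolev_weak_deriv(2)[OF S _ Basis_space_time(2)])
  qed
  define E where "E k z = norm (Dt S (v k) z - sigma (Dx S (u k) z))" for k z
  have Em: "E k \<in> borel_measurable ?M" for k
    unfolding E_def[abs_def] using tL[of k] sm[OF us, of k] by (auto simp: Linf_iff)
  have Ei: "integrable ?M (E k)" for k
  proof -
    obtain C where "AE z in ?M. norm (Dt S (v k) z) \<le> C" using tL[of k] by (auto simp: Linf_iff)
    then have "AE z in ?M. norm (E k z) \<le> C + 1"
    proof eventually_elim
      case (elim z)
      then show ?case using norm_triangle_ineq4[of "Dt S (v k) z" "sigma (Dx S (u k) z)"] norm_sigma_le[of "Dx S (u k) z"]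
        unfolding E_def by simp
    qed
    then show ?thesis by (rule integrable_lebesgue_on_bounded[OF Sm Em])
  qed
  have Ei': "integrable ?Mc (E k)" for k
  proof -
    have "set_integrable lebesgue S (E k)"
      unfolding set_integrable_def using Ei[of k] Ss by (subst (asm) integrable_restrict_space) auto
    then have "set_integrable lebesgue c (E k)" by (rule set_integrable_subset[OF _ cs cS])
    then show ?thesis unfolding set_integrable_def using cs by (subst integrable_restrict_space) auto
  qed
  have E\<epsilon>: "integral\<^sup>L ?Mc (E k) \<le> \<epsilon> k" for k
  proof -
    have "integral\<^sup>L ?Mc (E k) \<le> integral\<^sup>L ?M (E k)"
    proof -
      have i: "integrable lebesgue (\<lambda>z. indicator S z *\<^sub>R E k z)"
        using Ei[of k] Ss by (subst (asm) integrable_restrict_space) auto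
      have "integral\<^sup>L lebesgue (\<lambda>z. indicator c z *\<^sub>R E k z) \<le> integral\<^sup>L lebesgue (\<lambda>z. indicator S z *\<^sub>R E k z)"
        by (rule integral_mono'[OF i]) (use cS in \<open>auto simp: indicator_def E_def\<close>)
      then show ?thesis using Ss cs by (simp add: integral_restrict_space)
    qed
    also have "\<dots> \<le> \<epsilon> k"
      using close[of k] unfolding S_def[symmetric] set_integral_lebesgue_on[OF Ss] E_def .
    finally show ?thesis .
  qed
  define I where "I k z = - u k z * classical_Dt \<zeta> z + Dt S (v k) z \<bullet> classical_Dx \<zeta> z" for k z
  have IJ: "(\<lambda>k. integral\<^sup>L ?Mc (I k) - integral\<^sup>L ?Mc (J (u k))) \<longlonglongrightarrow> 0"
  proof (rule Lim_null_comparison)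
    have "(\<lambda>k. B2 * \<epsilon> k) \<longlonglongrightarrow> B2 * 0" using \<epsilon> by (intro tendsto_intros)
    then show "(\<lambda>k. B2 * \<epsilon> k) \<longlonglongrightarrow> 0" by simp
    show "\<forall>\<^sub>F k in sequentially. norm (integral\<^sup>L ?Mc (I k) - integral\<^sup>L ?Mc (J (u k))) \<le> B2 * \<epsilon> k"
    proof (rule always_eventually, rule allI)
      fix k
      have Ji: "integrable ?Mc (J (u k))"
        by (rule integrable_lebesgue_on_bounded[OF cm Jm[OF uc us] AE_lebesgue_on_I[OF cK']]) (use Jb in blast)
      have dm: "(\<lambda>z. I k z - J (u k) z) \<in> borel_measurable ?Mc"
      proof -
        have "(\<lambda>z. Dt S (v k) z - sigma (Dx S (u k) z)) \<in> borel_measurable ?M"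
          using tL[of k] sm[OF us, of k] by (intro borel_measurable_diff) (simp_all add: Linf_iff)
        then have "(\<lambda>z. Dt S (v k) z - sigma (Dx S (u k) z)) \<in> borel_measurable ?Mc"
          by (rule measurable_restrict_mono[OF _ cS])
        then have "(\<lambda>z. (Dt S (v k) z - sigma (Dx S (u k) z)) \<bullet> classical_Dx \<zeta> z) \<in> borel_measurable ?Mc"
          by (rule borel_measurable_inner[OF _ meas[OF c\<zeta>(3)]])
        then show ?thesis by (simp add: I_def J_def inner_diff_left)
      qed
      have pt: "norm (I k z - J (u k) z) \<le> B2 * E k z" if "z \<in> ?K" for z
      proof -
        have "I k z - J (u k) z = (Dt S (v k) z - sigma (Dx S (u k) z)) \<bullet> classical_Dx \<zeta> z"
          by (simp add: I_def J_def inner_diff_left)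
        then have "norm (I k z - J (u k) z) \<le> E k z * norm (classical_Dx \<zeta> z)"
          unfolding E_def by (simp add: Cauchy_Schwarz_ineq2)
        also have "\<dots> \<le> E k z * B2" using B2 that by (intro mult_left_mono) (auto simp: E_def)
        finally show ?thesis by (simp add: mult.commute)
      qed
      have E2: "integrable ?Mc (\<lambda>z. B2 * E k z)" using Ei'[of k] by simp
      have di: "integrable ?Mc (\<lambda>z. I k z - J (u k) z)"
      proof (rule Bochner_Integration.integrable_bound[OF E2 dm])
        show "AE z in ?Mc. norm (I k z - J (u k) z) \<le> norm (B2 * E k z)"
          using pt by (intro AE_lebesgue_on_I[OF cK']) (force intro: order_trans)
      qed
      have "integrable ?Mc (\<lambda>z. (I k z - J (u k) z) + J (u k) z)" by (rule Bochner_Integration.integrable_add[OF di Ji])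
      then have Ii: "integrable ?Mc (I k)" by simp
      have "norm (integral\<^sup>L ?Mc (I k) - integral\<^sup>L ?Mc (J (u k))) = norm (integral\<^sup>L ?Mc (\<lambda>z. I k z - J (u k) z))"
        using Ii Ji by simp
      also have "\<dots> \<le> integral\<^sup>L ?Mc (\<lambda>z. norm (I k z - J (u k) z))" by (rule integral_norm_bound)
      also have "\<dots> \<le> integral\<^sup>L ?Mc (\<lambda>z. B2 * E k z)"
        using cK' pt B2(1) by (intro integral_mono'[OF E2]) (auto simp: space_restrict_space E_def)
      also have "\<dots> \<le> B2 * \<epsilon> k" using E\<epsilon>[of k] B2(1) by (simp add: mult_left_mono)
      finally show "norm (integral\<^sup>L ?Mc (I k) - integral\<^sup>L ?Mc (J (u k))) \<le> B2 * \<epsilon> k" .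
    qed
  qed
  have xK: "(x, t) \<in> ?K" if "x \<in> \<Omega>" "t \<in> {0..T}" for x t
    using that closure_subset[of \<Omega>] by (auto simp: K)
  have slice: "continuous_on \<Omega> (\<lambda>x. f (x, t))" if "continuous_on ?K f" "t \<in> {0..T}" for f :: "_ \<Rightarrow> real" and t
    by (rule continuous_on_compose2[OF that(1)]) (use xK that(2) in \<open>auto intro!: continuous_intros\<close>)
  have Ilim: "(\<lambda>k. integral\<^sup>L (lebesgue_on \<Omega>) (\<lambda>x. u k (x, s) * \<zeta> (x, s))) \<longlonglongrightarrow>
      integral\<^sup>L (lebesgue_on \<Omega>) (\<lambda>x. w (x, s) * \<zeta> (x, s))"
  proof (rule integral_dominated_convergence[where w="\<lambda>x. (B + 1) * B0"])
    show "(\<lambda>x. w (x, s) * \<zeta> (x, s)) \<in> borel_measurable (lebesgue_on \<Omega>)"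
      by (intro continuous_imp_measurable_on_sets_lebesgue[OF _ Os] continuous_on_mult slice wc c\<zeta> s)
    show "(\<lambda>x. u k (x, s) * \<zeta> (x, s)) \<in> borel_measurable (lebesgue_on \<Omega>)" for k
      by (intro continuous_imp_measurable_on_sets_lebesgue[OF _ Os] continuous_on_mult slice uc c\<zeta> s)
    show "integrable (lebesgue_on \<Omega>) (\<lambda>x. (B + 1) * B0)"
      by (rule integrable_lebesgue_on_bounded[OF Om, of _ "\<bar>(B + 1) * B0\<bar>"]) auto
    show "AE x in lebesgue_on \<Omega>. (\<lambda>k. u k (x, s) * \<zeta> (x, s)) \<longlonglongrightarrow> w (x, s) * \<zeta> (x, s)"
      using xK[OF _ s] by (intro AE_lebesgue_on_I[OF subset_refl] ballI tendsto_intros ulim)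
    show "AE x in lebesgue_on \<Omega>. norm (u k (x, s) * \<zeta> (x, s)) \<le> (B + 1) * B0" for k
    proof (intro AE_lebesgue_on_I[OF subset_refl] ballI)
      fix x assume "x \<in> \<Omega>"
      from xK[OF this s] show "norm (u k (x, s) * \<zeta> (x, s)) \<le> (B + 1) * B0"
        using ub[of "(x, s)" k] B0 B(1) unfolding real_norm_def abs_mult by (intro mult_mono) auto
    qed
  qed
  have id: "integral\<^sup>L (lebesgue_on \<Omega>) (\<lambda>x. u k (x, s) * \<zeta> (x, s)) + integral\<^sup>L ?Mc (I k) =
      integral\<^sup>L (lebesgue_on \<Omega>) (\<lambda>x. u0 x * \<zeta> (x, 0))" for k
  proof -
    have "integral\<^sup>L (lebesgue_on \<Omega>) (\<lambda>x. u k (x, s) * \<zeta> (x, s)) + integral\<^sup>L ?Mc (I k) =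
      integral\<^sup>L (lebesgue_on \<Omega>) (\<lambda>x. u k (x, 0) * \<zeta> (x, 0))"
      unfolding I_def[abs_def] c_def S_def
      by (rule flux_identity[OF dom T vW[unfolded S_def] vn uc[unfolded S_def] vdiv[unfolded S_def] \<zeta> s])
    also have "\<dots> = integral\<^sup>L (lebesgue_on \<Omega>) (\<lambda>x. u0 x * \<zeta> (x, 0))"
      by (rule Bochner_Integration.integral_cong) (simp_all add: space_restrict_space u_initial)
    finally show ?thesis .
  qed
  have "(\<lambda>k. integral\<^sup>L (lebesgue_on \<Omega>) (\<lambda>x. u k (x, s) * \<zeta> (x, s)) +
      ((integral\<^sup>L ?Mc (I k) - integral\<^sup>L ?Mc (J (u k))) + integral\<^sup>L ?Mc (J (u k)))) \<longlonglongrightarrow>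
      integral\<^sup>L (lebesgue_on \<Omega>) (\<lambda>x. w (x, s) * \<zeta> (x, s)) + (0 + integral\<^sup>L ?Mc (J w))"
    by (intro tendsto_add Ilim IJ Jlim)
  then have "integral\<^sup>L (lebesgue_on \<Omega>) (\<lambda>x. u0 x * \<zeta> (x, 0)) =
      integral\<^sup>L (lebesgue_on \<Omega>) (\<lambda>x. w (x, s) * \<zeta> (x, s)) + integral\<^sup>L ?Mc (J w)"
    by (simp add: id LIMSEQ_const_iff)
  then show "(LINT x:\<Omega>|lebesgue. w (x, s) * \<zeta> (x, s)) +
      (LINT z:cylinder \<Omega> s|lebesgue. - w z * classical_Dt \<zeta> z + sigma (Dx (cylinder \<Omega> T) w z) \<bullet> classical_Dx \<zeta> z) =
      (LINT x:\<Omega>|lebesgue. u0 x * \<zeta> (x, 0))"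
    unfolding set_integral_lebesgue_on[OF Os] set_integral_lebesgue_on[OF cs[unfolded c_def]]
    by (simp only: J_def[abs_def] c_def S_def)
qed

section \<open>Existence near every element of the class\<close>

text \<open>The sequence \<open>u k\<close> of almost maximizers lies in \<open>\<U>\<^sub>\<epsilon>\<close> with \<open>\<epsilon> = 1/(k + 1)\<close>, stays within \<open>\<eta>\<close> of \<open>\<phi>\<close>, and
  converges uniformly, with almost everywhere convergent gradients.\<close>

lemma weak_solution_near:
  fixes \<Omega> :: "(real^'n) set" and T :: real
    and u0 :: "real^'n \<Rightarrow> real"
    and us :: "(real^'n) \<times> real \<Rightarrow> real" and vs :: "(real^'n) \<times> real \<Rightarrow> real^'n"
    and \<U> :: "((real^'n) \<times> real \<Rightarrow> real) set"
  assumes dom: "smooth_bounded_convex_domain \<Omega>" and T: "T > 0"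
    and us_initial: "\<forall>x\<in>\<Omega>. us (x, 0) = u0 x"
    and vs_normal: "\<forall>t\<in>{0..T}. \<forall>x\<in>frontier \<Omega>. vs (x, t) \<bullet> outer_normal \<Omega> x = 0"
    and adm: "admissible_class \<Omega> T us vs \<U>"
    and dense: "\<forall>\<epsilon>>0. Linf_dense_in (cylinder \<Omega> T) (approx_class \<Omega> T vs \<U> \<epsilon>) \<U>"
    and \<phi>: "\<phi> \<in> \<U>" and \<eta>: "0 < \<eta>"
  shows "\<exists>u\<in>W1inf_dirichlet (cylinder \<Omega> T) us. weak_solution \<Omega> T u0 u \<and>
     (\<forall>z\<in>closure (cylinder \<Omega> T). \<bar>u z - \<phi> z\<bar> \<le> \<eta>)"
proof -
  define S where "S = cylinder \<Omega> T"
  let ?M = "lebesgue_on S" let ?K = "closure S"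
  have dom': "open \<Omega>" "bounded \<Omega>" "convex \<Omega>" "\<Omega> \<noteq> {}"
    using dom by (auto simp: smooth_bounded_convex_domain_def)
  have K: "?K = closure \<Omega> \<times> {0..T}" unfolding S_def cylinder_def by (rule closure_cylinder_Times[OF T])
  have S: "open S" "bounded S" "convex S" "S \<noteq> {}"
    unfolding S_def cylinder_def using dom' T by (auto intro: open_Times bounded_Times convex_Times)
  have cK: "compact ?K" using S(2) by simp
  have SK: "S \<subseteq> ?K" by (rule closure_subset)
  have Kne: "?K \<noteq> {}" using S(4) by simp
  have UD: "\<U> \<subseteq> W1inf_dirichlet S us" using adm by (simp add: admissible_class_def S_def)
  have UW: "u \<in> W1inf S" and Uc: "continuous_on ?K u" and Us: "u \<in> sobolev_W1inf S"
    and Ufr: "\<forall>z\<in>frontier S. u z = us z" if "u \<in> \<U>" for u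
    using subsetD[OF UD that] by (auto simp: W1inf_dirichlet_def W1inf_def)
  obtain M0 where M0: "\<forall>u\<in>\<U>. W1inf_norm S u \<le> ereal M0" using adm by (auto simp: admissible_class_def S_def)
  define M where "M = max 0 M0"
  have M: "0 \<le> M" by (simp add: M_def)
  have UM: "AE z in ?M. \<bar>weak_deriv S b u z\<bar> \<le> M" if "u \<in> \<U>" "b \<in> Basis" for u b
  proof -
    have "W1inf_norm S u \<le> ereal M0" using M0 that(1) by blast
    from weak_deriv_bound_of_W1inf_norm[OF S(1,4) this that(2)]
    show ?thesis by eventually_elim (simp add: M_def)
  qed
  let ?A = "\<lambda>k. approx_class \<Omega> T vs \<U> (inverse (real (Suc k)))"
  have "\<exists>u :: nat \<Rightarrow> (real^'n) \<times> real \<Rightarrow> real. (\<forall>k. u k \<in> ?A k \<and> sup_dist ?K \<phi> (u k) < \<eta>) \<and>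
    (\<forall>k m. k \<le> m \<longrightarrow> energy_dist S (u m) (u k) \<le> (1/4) ^ k \<and> sup_dist ?K (u k) (u m) < (1/2) ^ k)"
  proof (rule nested_almost_maximizers[where X=\<U> and F="energy S"])
    show "sup_dist ?K u u = 0" for u using Kne by (simp add: sup_dist_def)
    show "sup_dist ?K u y \<le> sup_dist ?K u w + sup_dist ?K w y" if "u \<in> \<U>" "w \<in> \<U>" "y \<in> \<U>" for u w y
    proof (rule sup_dist_least[OF Kne])
      fix z assume z: "z \<in> ?K"
      show "\<bar>u z - y z\<bar> \<le> sup_dist ?K u w + sup_dist ?K w y"
        using sup_dist_upper[OF cK Uc[OF that(1)] Uc[OF that(2)] z]
          sup_dist_upper[OF cK Uc[OF that(2)] Uc[OF that(3)] z] by linarith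
    qed
    show "energy S u \<le> DIM((real^'n) \<times> real) * (M\<^sup>2 * measure lebesgue S)" if "u \<in> \<U>" for u
      by (rule energy_bound[OF S M Us[OF that] UM[OF that]])
    show "\<exists>r>0. \<forall>w\<in>\<U>. sup_dist ?K u w < r \<longrightarrow> energy_dist S w u \<le> energy S w - energy S u + \<epsilon>"
      if u: "u \<in> \<U>" and \<epsilon>: "0 < \<epsilon>" for u \<epsilon>
    proof -
      have "\<exists>r>0. \<forall>w. w \<in> sobolev_W1inf S \<and> (\<forall>b\<in>Basis. AE z in ?M. \<bar>weak_deriv S b w z\<bar> \<le> M) \<and>
        (\<forall>z\<in>S. \<bar>w z - u z\<bar> \<le> r) \<longrightarrow> energy_dist S w u \<le> energy S w - energy S u + \<epsilon>"
        by (rule energy_gap[OF S M Us[OF u] UM[OF u] \<epsilon>])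
      then obtain r where r: "0 < r" "\<forall>w. w \<in> sobolev_W1inf S \<and> (\<forall>b\<in>Basis. AE z in ?M. \<bar>weak_deriv S b w z\<bar> \<le> M) \<and>
        (\<forall>z\<in>S. \<bar>w z - u z\<bar> \<le> r) \<longrightarrow> energy_dist S w u \<le> energy S w - energy S u + \<epsilon>"
        by (elim exE conjE)
      have "energy_dist S w u \<le> energy S w - energy S u + \<epsilon>" if w: "w \<in> \<U>" "sup_dist ?K u w < r" for w
      proof -
        have "\<bar>w z - u z\<bar> \<le> r" if "z \<in> S" for z
          using sup_dist_upper[OF cK Uc[OF u] Uc[OF w(1)], of z] w(2) that SK by force
        then show ?thesis using r(2) Us[OF w(1)] UM[OF w(1)] by blast
      qed
      then show ?thesis using r(1) by blast
    qed
    show "?A k \<subseteq> \<U>" for k by (auto simp: approx_class_def)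
    show "?A (Suc k) \<subseteq> ?A k" for k
    proof -
      have "inverse (real (Suc (Suc k))) * measure lebesgue (cylinder \<Omega> T) \<le>
          inverse (real (Suc k)) * measure lebesgue (cylinder \<Omega> T)"
        by (intro mult_right_mono) auto
      then show ?thesis unfolding approx_class_def by (auto intro: order_trans)
    qed
    show "\<exists>w\<in>?A k. sup_dist ?K u w < \<delta>" if u: "u \<in> \<U>" and \<delta>: "0 < \<delta>" for k u \<delta>
    proof -
      have "Linf_dense_in S (?A k) \<U>" using dense by (simp add: S_def)
      moreover have "0 < \<delta> / 2" using \<delta> by simp
      ultimately obtain w where w: "w \<in> ?A k" "Linf_norm S (\<lambda>z. w z - u z) < ereal (\<delta> / 2)"
        using u unfolding Linf_dense_in_def by blast
      have wU: "w \<in> \<U>" using w(1) by (simp add: approx_class_def)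
      have "AE z in ?M. \<bar>w z - u z\<bar> \<le> \<delta> / 2" using Linf_norm_bound_AE[OF less_imp_le[OF w(2)]] by simp
      moreover have "continuous_on ?K (\<lambda>z. \<bar>w z - u z\<bar>)" by (intro continuous_intros Uc wU u)
      ultimately have "\<bar>w z - u z\<bar> \<le> \<delta> / 2" if "z \<in> ?K" for z
        using continuous_AE_le_imp_le[OF S(1)] that by blast
      then have "sup_dist ?K u w \<le> \<delta> / 2" by (intro sup_dist_least[OF Kne]) (simp add: abs_minus_commute)
      then show ?thesis using w(1) \<delta> by (intro bexI[of _ w]) auto
    qed
  qed (use \<phi> \<eta> in auto)
  then obtain u where u: "\<And>k. u k \<in> ?A k" "\<And>k. sup_dist ?K \<phi> (u k) < \<eta>"
    "\<And>k m. k \<le> m \<Longrightarrow> energy_dist S (u m) (u k) \<le> (1/4) ^ k"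
    "\<And>k m. k \<le> m \<Longrightarrow> sup_dist ?K (u k) (u m) < (1/2) ^ k" by blast
  have uU: "u k \<in> \<U>" for k using u(1) by (simp add: approx_class_def)
  obtain w where w: "w \<in> W1inf S" "\<forall>k. \<forall>z\<in>?K. \<bar>u k z - w z\<bar> \<le> (1/2) ^ k"
    "\<forall>b\<in>Basis. AE z in ?M. (\<lambda>k. weak_deriv S b (u k) z) \<longlonglongrightarrow> weak_deriv S b w z"
    using W1inf_limit[OF S M UW[OF uU] UM[OF uU] u(3,4)] by blast
  have h0: "(\<lambda>k. (1/2::real) ^ k) \<longlonglongrightarrow> 0" by (rule LIMSEQ_realpow_zero) auto
  have fr: "z \<in> ?K" if "z \<in> frontier S" for z using that by (simp add: frontier_def)
  have wD: "w \<in> W1inf_dirichlet S us"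
  proof -
    have "w z = us z" if z: "z \<in> frontier S" for z
    proof -
      have "\<bar>us z - w z\<bar> \<le> (1/2) ^ k" for k using w(2) fr[OF z] Ufr[OF uU[of k]] z by metis
      then have "\<bar>us z - w z\<bar> \<le> 0" by (intro LIMSEQ_le_const[OF h0]) auto
      then show ?thesis by simp
    qed
    then show ?thesis using w(1) by (simp add: W1inf_dirichlet_def)
  qed
  have near: "\<bar>w z - \<phi> z\<bar> \<le> \<eta>" if z: "z \<in> ?K" for z
  proof -
    have "\<bar>w z - \<phi> z\<bar> \<le> \<eta> + (1/2) ^ k" for k
      using sup_dist_upper[OF cK Uc[OF \<phi>] Uc[OF uU[of k]] z] u(2)[of k] w(2)[rule_format, OF z, of k] by linarith
    moreover have "(\<lambda>k. \<eta> + (1/2::real) ^ k) \<longlonglongrightarrow> \<eta> + 0" by (intro tendsto_intros h0)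
    ultimately show ?thesis by (intro LIMSEQ_le_const[of "\<lambda>k. \<eta> + (1/2) ^ k"]) auto
  qed
  have "\<forall>k. \<exists>v. admissible_flux \<Omega> T vs (u k) v \<and>
      (LINT z:cylinder \<Omega> T|lebesgue. norm (Dt (cylinder \<Omega> T) v z - sigma (Dx (cylinder \<Omega> T) (u k) z)))
       \<le> inverse (real (Suc k)) * measure lebesgue (cylinder \<Omega> T)"
    using u(1) by (auto simp: approx_class_def)
  then obtain v where v: "\<forall>k. admissible_flux \<Omega> T vs (u k) (v k) \<and>
      (LINT z:cylinder \<Omega> T|lebesgue. norm (Dt (cylinder \<Omega> T) (v k) z - sigma (Dx (cylinder \<Omega> T) (u k) z)))
       \<le> inverse (real (Suc k)) * measure lebesgue (cylinder \<Omega> T)"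
    by (drule_tac choice, elim exE)
  have ini: "u k (x, 0) = u0 x" if "x \<in> \<Omega>" for k x
  proof -
    have "(x, 0) \<in> ?K" using that T closure_subset[of \<Omega>] by (auto simp: K)
    then have "(x, 0) \<in> frontier S" using S(1) by (auto simp: frontier_def interior_open S_def cylinder_def)
    then show ?thesis using Ufr[OF uU[of k]] us_initial that by simp
  qed
  have "weak_solution \<Omega> T u0 w"
  proof (rule weak_solution_of_limit[where u=u and v=v, OF dom T vs_normal])
    show "(\<lambda>k. inverse (real (Suc k)) * measure lebesgue (cylinder \<Omega> T)) \<longlonglongrightarrow> 0"
      using tendsto_mult_left_zero[OF LIMSEQ_inverse_real_of_nat] .
    show "AE z in lebesgue_on (cylinder \<Omega> T).
        (\<lambda>k. weak_deriv (cylinder \<Omega> T) b (u k) z) \<longlonglongrightarrow> weak_deriv (cylinder \<Omega> T) b w z"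
      if "b \<in> Basis" for b using w(3) that unfolding S_def by blast
  qed (use v w(1,2) UW[OF uU] ini in \<open>simp_all add: S_def\<close>)
  then show ?thesis using wD near by (auto simp: S_def)
qed

section \<open>Infinitely many weak solutions\<close>

text \<open>Being a weak solution depends only on the values on the closed cylinder.\<close>

lemma weak_solution_cong:
  assumes u: "weak_solution \<Omega> T u0 u" and w: "w \<in> W1inf (cylinder \<Omega> T)" and T: "0 < T"
    and eq: "\<And>z. z \<in> closure (cylinder \<Omega> T) \<Longrightarrow> u z = w z"
  shows "weak_solution \<Omega> T u0 w"
proof -
  let ?S = "cylinder \<Omega> T"
  have SK: "?S \<subseteq> closure ?S" by (rule closure_subset)
  have eqS: "u z = w z" if "z \<in> ?S" for z using eq SK that by blast
  have ind: "indicator A z *\<^sub>R u z = indicator A z *\<^sub>R w z" if "A \<subseteq> ?S" for A z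
  proof (cases "z \<in> A")
    case True
    then show ?thesis using eqS[of z] that by auto
  qed simp
  have "has_weak_deriv ?S b u = has_weak_deriv ?S b w" for b
  proof -
    have "locally_integrable_on u ?S \<longleftrightarrow> locally_integrable_on w ?S"
      unfolding locally_integrable_on_def set_integrable_def by (metis (no_types, lifting) ext ind)
    moreover have "(LINT x:?S|lebesgue. f x *\<^sub>R u x) = (LINT x:?S|lebesgue. f x *\<^sub>R w x)" for f
      unfolding set_lebesgue_integral_def using eqS
      by (intro Bochner_Integration.integral_cong) (auto simp: indicator_def)
    ultimately show ?thesis unfolding has_weak_deriv_def[abs_def] by simp
  qed
  then have D: "Dx ?S u = Dx ?S w" by (simp add: Dx_def[abs_def] weak_deriv_def)
  have "(LINT x:\<Omega>|lebesgue. w (x, s) * \<zeta> (x, s)) + (LINT z:cylinder \<Omega> s|lebesgue.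
             - w z * classical_Dt \<zeta> z + sigma (Dx ?S w z) \<bullet> classical_Dx \<zeta> z) =
        (LINT x:\<Omega>|lebesgue. u0 x * \<zeta> (x, 0))"
    if \<zeta>: "smooth_on (closure ?S) \<zeta>" "s \<in> {0..T}" for \<zeta> s
  proof -
    have "(x, s) \<in> closure ?S" if "x \<in> \<Omega>" for x
      using that \<zeta>(2) T closure_subset[of \<Omega>] closure_cylinder_Times[of T \<Omega>] by (auto simp: cylinder_def)
    then have "(LINT x:\<Omega>|lebesgue. w (x, s) * \<zeta> (x, s)) = (LINT x:\<Omega>|lebesgue. u (x, s) * \<zeta> (x, s))"
      unfolding set_lebesgue_integral_def using eq
      by (intro Bochner_Integration.integral_cong) (auto simp: indicator_def)
    moreover have "z \<in> ?S" if "z \<in> cylinder \<Omega> s" for z using that \<zeta>(2) by (auto simp: cylinder_def)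
    then have "(LINT z:cylinder \<Omega> s|lebesgue. - w z * classical_Dt \<zeta> z + sigma (Dx ?S w z) \<bullet> classical_Dx \<zeta> z) =
       (LINT z:cylinder \<Omega> s|lebesgue. - u z * classical_Dt \<zeta> z + sigma (Dx ?S u z) \<bullet> classical_Dx \<zeta> z)"
      unfolding set_lebesgue_integral_def D using eqS
      by (intro Bochner_Integration.integral_cong) (auto simp: indicator_def)
    ultimately show ?thesis using u \<zeta> unfolding weak_solution_def by simp
  qed
  then show ?thesis using w by (simp add: weak_solution_def)
qed

theorem theorem3p3:
  fixes \<Omega> :: "(real^'n) set" and T :: real
    and u0 :: "real^'n \<Rightarrow> real"
    and us :: "(real^'n) \<times> real \<Rightarrow> real" and vs :: "(real^'n) \<times> real \<Rightarrow> real^'n"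
    and \<U> :: "((real^'n) \<times> real \<Rightarrow> real) set"
  assumes domain: "smooth_bounded_convex_domain \<Omega>" and T: "T > 0"
    and u0_smooth: "smooth_on (closure \<Omega>) u0"
    and u0_nonconst: "\<exists>x\<in>\<Omega>. grad u0 x \<noteq> 0"
    and u0_neumann: "\<forall>x\<in>frontier \<Omega>. grad u0 x \<bullet> outer_normal \<Omega> x = 0"
    and u0_mean: "(LINT x:\<Omega>|lebesgue. u0 x) = 0"
    and us: "us \<in> W1inf (cylinder \<Omega> T)"
    and vs: "vs \<in> W1inf (cylinder \<Omega> T)"
    and us_initial: "\<forall>x\<in>\<Omega>. us (x, 0) = u0 x"
    and vs_div: "AE z in lebesgue_on (cylinder \<Omega> T). divx (cylinder \<Omega> T) vs z = us z"
    and vs_normal: "\<forall>t\<in>{0..T}. \<forall>x\<in>frontier \<Omega>. vs (x, t) \<bullet> outer_normal \<Omega> x = 0"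
    and admissible: "admissible_class \<Omega> T us vs \<U>"
    and dense: "\<forall>\<epsilon>>0. Linf_dense_in (cylinder \<Omega> T) (approx_class \<Omega> T vs \<U> \<epsilon>) \<U>"
  shows "(\<forall>\<phi>\<in>\<U>. \<forall>\<eta>>0. \<exists>u\<in>W1inf_dirichlet (cylinder \<Omega> T) us.
            weak_solution \<Omega> T u0 u \<and> Linf_norm (cylinder \<Omega> T) (\<lambda>z. u z - \<phi> z) < ereal \<eta>) \<and>
         ((\<exists>w\<in>\<U>. w \<in> W1inf_dirichlet (cylinder \<Omega> T) us \<and> \<not> weak_solution \<Omega> T u0 w) \<longrightarrow>
            infinite ({u. weak_solution \<Omega> T u0 u} // ae_equal (cylinder \<Omega> T)))"
proof -
  define S where "S = cylinder \<Omega> T"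
  let ?M = "lebesgue_on S" let ?K = "closure S" let ?R = "ae_equal S"
  have dom': "open \<Omega>" "bounded \<Omega>" "convex \<Omega>" "\<Omega> \<noteq> {}"
    using domain by (auto simp: smooth_bounded_convex_domain_def)
  have S: "open S" "bounded S" "S \<noteq> {}"
    unfolding S_def cylinder_def using dom' T by (auto intro: open_Times bounded_Times)
  have Ss: "S \<in> sets lebesgue" using S(1) by auto
  have cK: "compact ?K" using S(2) by simp
  have SK: "S \<subseteq> ?K" by (rule closure_subset)
  have Kne: "?K \<noteq> {}" using S(3) by simp
  have Uc: "continuous_on ?K u" if "u \<in> \<U>" for u
    using that admissible by (auto simp: admissible_class_def W1inf_dirichlet_def W1inf_def S_def)
  note near = weak_solution_near[OF domain T us_initial vs_normal admissible dense, folded S_def]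
  have first: "\<exists>u\<in>W1inf_dirichlet S us. weak_solution \<Omega> T u0 u \<and> Linf_norm S (\<lambda>z. u z - \<phi> z) < ereal \<eta>"
    if \<phi>: "\<phi> \<in> \<U>" and \<eta>: "0 < \<eta>" for \<phi> \<eta>
  proof -
    have "0 < \<eta> / 2" using \<eta> by simp
    from near[OF \<phi> this] obtain u where u: "u \<in> W1inf_dirichlet S us" "weak_solution \<Omega> T u0 u"
      "\<forall>z\<in>?K. \<bar>u z - \<phi> z\<bar> \<le> \<eta> / 2" by blast
    have "continuous_on ?K u" using u(1) by (simp add: W1inf_dirichlet_def W1inf_def)
    then have "continuous_on S (\<lambda>z. u z - \<phi> z)"
      using Uc[OF \<phi>] by (intro continuous_intros) (auto intro: continuous_on_subset[OF _ SK])
    then have "(\<lambda>z. u z - \<phi> z) \<in> borel_measurable ?M" by (rule continuous_imp_measurable_on_sets_lebesgue[OF _ Ss])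
    moreover have "AE z in ?M. norm (u z - \<phi> z) \<le> \<eta> / 2" using u(3) by (intro AE_lebesgue_on_I[OF SK]) simp
    ultimately have "Linf_norm S (\<lambda>z. u z - \<phi> z) \<le> ereal (\<eta> / 2)" by (rule Linf_norm_leI)
    also have "\<dots> < ereal \<eta>" using \<eta> by simp
    finally show ?thesis using u(1,2) by blast
  qed
  have second: "infinite ({u. weak_solution \<Omega> T u0 u} // ?R)"
    if w: "w \<in> \<U>" "w \<in> W1inf_dirichlet S us" "\<not> weak_solution \<Omega> T u0 w" for w
  proof
    let ?W = "{u. weak_solution \<Omega> T u0 u}"
    assume fin: "finite (?W // ?R)"
    have Wc: "continuous_on ?K u" if "u \<in> ?W" for u using that by (simp add: weak_solution_def W1inf_def S_def)
    have AEeq: "\<forall>z\<in>?K. u z = y z" if "u \<in> ?W" "y \<in> ?W" "(u, y) \<in> ?R" for u y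
    proof
      fix z assume z: "z \<in> ?K"
      have "AE z in ?M. \<bar>u z - y z\<bar> \<le> 0" using that(3) by (simp add: ae_equal_def)
      moreover have "continuous_on ?K (\<lambda>z. \<bar>u z - y z\<bar>)" by (intro continuous_intros Wc that(1,2))
      ultimately have "\<bar>u z - y z\<bar> \<le> 0" using continuous_AE_le_imp_le[OF S(1) _ _ z] by blast
      then show "u z = y z" by simp
    qed
    have pos: "0 < sup_dist ?K u w" if u: "u \<in> ?W" for u
    proof (rule ccontr)
      assume "\<not> 0 < sup_dist ?K u w"
      then have "u z = w z" if "z \<in> ?K" for z
        using sup_dist_upper[OF cK Wc[OF u] Uc[OF w(1)] that] by linarith
      moreover have "w \<in> W1inf (cylinder \<Omega> T)" using w(2) by (simp add: W1inf_dirichlet_def S_def)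
      ultimately have "weak_solution \<Omega> T u0 w"
        using weak_solution_cong[of \<Omega> T u0 u w] u T by (simp add: S_def)
      then show False using w(3) by blast
    qed
    \<comment> \<open>If there were finitely many classes, their distances to \<open>w\<close> would have a positive minimum, but there is
      a weak solution closer to \<open>w\<close> than that.\<close>
    define rep where "rep C = (SOME u. u \<in> C \<and> u \<in> ?W)" for C
    have rep: "rep C \<in> C \<and> rep C \<in> ?W" if CQ: "C \<in> ?W // ?R" for C
    proof -
      from CQ obtain u where "u \<in> ?W" "C = ?R `` {u}" by (auto simp: quotient_def)
      then have "u \<in> C \<and> u \<in> ?W" by (simp add: ae_equal_def)
      then show ?thesis unfolding rep_def by (rule someI[where P="\<lambda>u. u \<in> C \<and> u \<in> ?W"])
    qed
    define D where "D = (\<lambda>C. sup_dist ?K (rep C) w) ` (?W // ?R)"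
    obtain u1 where "weak_solution \<Omega> T u0 u1" using near[OF w(1), of 1] by auto
    then have "D \<noteq> {}" by (auto simp: D_def quotient_def)
    moreover have "finite D" using fin by (simp add: D_def)
    ultimately have Dpos: "0 < Min D" using rep pos by (auto simp: D_def)
    then have "0 < Min D / 2" by simp
    from near[OF w(1) this] obtain u where u: "weak_solution \<Omega> T u0 u" "\<forall>z\<in>?K. \<bar>u z - w z\<bar> \<le> Min D / 2" by blast
    define C where "C = ?R `` {u}"
    have C: "C \<in> ?W // ?R" using u(1) by (auto simp: C_def intro: quotientI)
    have "(u, rep C) \<in> ?R" using rep[OF C] by (simp add: C_def)
    then have "\<forall>z\<in>?K. u z = rep C z" using AEeq rep[OF C] u(1) by blast
    then have "sup_dist ?K (rep C) w \<le> Min D / 2" using u(2) by (intro sup_dist_least[OF Kne]) simp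
    moreover have "Min D \<le> sup_dist ?K (rep C) w" using \<open>finite D\<close> C by (intro Min_le) (auto simp: D_def)
    ultimately show False using Dpos by linarith
  qed
  show ?thesis using first second unfolding S_def by blast
qed

end
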